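(* Let $F$ be a field of characteristic different from $2$ and $3$, let $\mathbb{M}$ be a $7$-dimensional exceptional Malcev algebra over $F$, and let $\mathcal{M}=\mathcal{M}_0\oplus\mathcal{M}_1$ be a Malcev superalgebra over $F$ in $\mathcal{H}$ such that $\mathcal{M}_0$ contains $\mathbb{M}$ as a subalgebra and $m\mathbb{M}\neq 0$ for every homogeneous element $0\neq m\in\mathcal{M}_0\cup\mathcal{M}_1$. Then $\mathcal{M}\cong\mathbb{M}\otimes_F U$ (as superalgebras) for a certain supercommutative associative superalgebra $U$ over $F$.
   Context: A Malcev algebra over $F$ is an $F$-vector space with a bilinear product satisfying $x^2=0$ and $J(x,y,xz)=J(x,y,z)x$, where $J(x,y,z)=(xy)z+(yz)x+(zx)y$. A superalgebra is a $\mathbb{Z}_2$-graded algebra. If $G=G_0\oplus G_1$ is the Grassmann algebra over $F$ on generators $1,e_1,e_2,\ldots$, the Grassmann envelope of a superalgebra $\mathcal{M}=\mathcal{M}_0\oplus\mathcal{M}_1$ is $G(\mathcal{M})=G_0\otimes\mathcal{M}_0+G_1\otimes\mathcal{M}_1$; $\mathcal{M}$ is a Malcev superalgebra if $G(\mathcal{M})$ is a Malcev algebra. $|x|$ denotes the parity of a homogeneous $x$. For homogeneous elements put $\{x,y,z\}^{\sim}=(xy)z-(-1)^{|y||z|}(xz)y+2x(yz)$ and $$\tilde h(y,z,t,x,u)=\{yz,t,u\}^{\sim}x+(-1)^{|x||u|}\{yz,t,x\}^{\sim}u+(-1)^{|x|(|z|+|t|+|u|)+|u||t|}\{yx,z,u\}^{\sim}t+(-1)^{|u|(|z|+|t|)+|x||t|}\{yu,z,x\}^{\sim}t.$$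 A Malcev superalgebra is in $\mathcal{H}$ if $\tilde h(y,z,t,x,u)=0$ for all homogeneous elements. The exceptional algebra $\mathbb{M}$: it denotes either of the following $7$-dimensional simple non-Lie Malcev algebras. (1) $\mathcal{M}_7(F)=C(F)^{(-)}/F\cdot e_0$, where $C(F)$ is the split Cayley-Dickson matrix algebra of matrices $\begin{bmatrix} a&\alpha\\ \beta&b\end{bmatrix}$ with $a,b\in F$, $\alpha,\beta\in F^3$, entrywise addition, and product $$\begin{bmatrix} a&\alpha\\ \beta&b\end{bmatrix}\begin{bmatrix} c&\gamma\\ \delta&d\end{bmatrix}=\begin{bmatrix} ac+\alpha\bullet\delta & a\gamma+d\alpha-\beta\times\delta\\ c\beta+b\delta+\alpha\times\gamma & \beta\bullet\gamma+bd\end{bmatrix}$$ ($\bullet$ the scalar product, $\times$ the vector product on $F^3$), $e_0$ is the identity matrix, and $A^{(-)}$ denotes the vector space $A$ with product $[x,y]=xy-yx$. (2) $\mathbb{M}_7=\mathbb{O}^{(-)}/F\cdot 1$, where $\mathbb{O}=\mathbb{H}\oplus v\mathbb{H}$ is a division Cayley-Dickson algebra over $F$ obtained from a division quaternion algebra $\mathbb{H}$ with basis $1,i,j,k$, $i^2=j^2=k^2=-1$, and canonical involution $a\mapsto\bar a$, with $v^2=\gamma\in F$, $\gamma\ne 0$, and $aw=w\bar a$ for $a\in\mathbb{H}$, $w\in v\mathbb{H}$, and $(ab)v=b(av)$, $v(ab)=(vb)a$, $(va)(vb)=\gamma b\bar a$ for $a,b\in\mathbb{H}$. A superalgebra $U=U_0\oplus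 U_1$ is supercommutative if $uw=(-1)^{|u||w|}wu$ for homogeneous $u,w$. On $\mathbb{M}\otimes_F U$ the algebra $\mathbb{M}$ is taken purely even, the grading is $\mathbb{M}\otimes U_0\oplus\mathbb{M}\otimes U_1$, and $(a\otimes u)(b\otimes w)=ab\otimes uw$. *)

theory Defs
  imports Complex_Main "HOL-Library.Poly_Mapping" "HOL-Library.Product_Plus"
begin

section \<open>Not necessarily associative algebras\<close>

text \<open>
  Algebras over a field \<open>'f\<close> carry an explicit carrier set, since quotients, tensor products and the
  existentially quantified superalgebra of the main theorem are not types. Products need not
  be associative or unital.
\<close>

record ('f, 'a) alg =
  carr :: "'a set"
  zer :: 'a
  add :: "'a \<Rightarrow> 'a \<Rightarrow> 'a"
  smul :: "'f \<Rightarrow> 'a \<Rightarrow> 'a"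
  mul :: "'a \<Rightarrow> 'a \<Rightarrow> 'a"

locale nonassoc_algebra =
  fixes A :: "('f::field, 'a, 'z) alg_scheme"
  assumes zer_closed: "zer A \<in> carr A"
    and add_closed: "x \<in> carr A \<Longrightarrow> y \<in> carr A \<Longrightarrow> add A x y \<in> carr A"
    and smul_closed: "x \<in> carr A \<Longrightarrow> smul A c x \<in> carr A"
    and mul_closed: "x \<in> carr A \<Longrightarrow> y \<in> carr A \<Longrightarrow> mul A x y \<in> carr A"
    and add_assoc: "x \<in> carr A \<Longrightarrow> y \<in> carr A \<Longrightarrow> z \<in> carr A \<Longrightarrow>
      add A (add A x y) z = add A x (add A y z)"
    and add_commute: "x \<in> carr A \<Longrightarrow> y \<in> carr A \<Longrightarrow> add A x y = add A y x"
    and add_zer: "x \<in> carr A \<Longrightarrow> add A x (zer A) = x"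
    and add_neg: "x \<in> carr A \<Longrightarrow> \<exists>y\<in>carr A. add A x y = zer A"
    and smul_add: "x \<in> carr A \<Longrightarrow> y \<in> carr A \<Longrightarrow>
      smul A c (add A x y) = add A (smul A c x) (smul A c y)"
    and add_smul: "x \<in> carr A \<Longrightarrow> smul A (c + d) x = add A (smul A c x) (smul A d x)"
    and smul_smul: "x \<in> carr A \<Longrightarrow> smul A c (smul A d x) = smul A (c * d) x"
    and smul_one: "x \<in> carr A \<Longrightarrow> smul A 1 x = x"
    and mul_add_left: "x \<in> carr A \<Longrightarrow> y \<in> carr A \<Longrightarrow> z \<in> carr A \<Longrightarrow>
      mul A (add A x y) z = add A (mul A x z) (mul A y z)"
    and mul_add_right: "x \<in> carr A \<Longrightarrow> y \<in> carr A \<Longrightarrow> z \<in> carr A \<Longrightarrow>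
      mul A x (add A y z) = add A (mul A x y) (mul A x z)"
    and mul_smul_left: "x \<in> carr A \<Longrightarrow> y \<in> carr A \<Longrightarrow>
      mul A (smul A c x) y = smul A c (mul A x y)"
    and mul_smul_right: "x \<in> carr A \<Longrightarrow> y \<in> carr A \<Longrightarrow>
      mul A x (smul A c y) = smul A c (mul A x y)"

definition lin_subspace :: "('f, 'a, 'z) alg_scheme \<Rightarrow> 'a set \<Rightarrow> bool" where
  "lin_subspace A S \<longleftrightarrow> S \<subseteq> carr A \<and> zer A \<in> S \<and>
     (\<forall>x\<in>S. \<forall>y\<in>S. add A x y \<in> S) \<and> (\<forall>c. \<forall>x\<in>S. smul A c x \<in> S)"

definition subalgebra :: "('f, 'a, 'z) alg_scheme \<Rightarrow> 'a set \<Rightarrow> bool" where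
  "subalgebra A S \<longleftrightarrow> lin_subspace A S \<and> (\<forall>x\<in>S. \<forall>y\<in>S. mul A x y \<in> S)"

definition restr :: "('f, 'a, 'z) alg_scheme \<Rightarrow> 'a set \<Rightarrow> ('f, 'a) alg" where
  "restr A S = \<lparr>carr = S, zer = zer A, add = add A, smul = smul A, mul = mul A\<rparr>"

definition type_alg ::
  "('f \<Rightarrow> 'a \<Rightarrow> 'a) \<Rightarrow> ('a \<Rightarrow> 'a \<Rightarrow> 'a) \<Rightarrow> ('f, 'a::ab_group_add) alg" where
  "type_alg scale mult = \<lparr>carr = UNIV, zer = 0, add = (+), smul = scale, mul = mult\<rparr>"

definition alg_hom_bij ::
  "('a \<Rightarrow> 'b) \<Rightarrow> ('f, 'a, 'y) alg_scheme \<Rightarrow> ('f, 'b, 'z) alg_scheme \<Rightarrow> bool" where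
  "alg_hom_bij \<phi> A B \<longleftrightarrow> bij_betw \<phi> (carr A) (carr B) \<and>
     (\<forall>x\<in>carr A. \<forall>y\<in>carr A. \<phi> (add A x y) = add B (\<phi> x) (\<phi> y)) \<and>
     (\<forall>c. \<forall>x\<in>carr A. \<phi> (smul A c x) = smul B c (\<phi> x)) \<and>
     (\<forall>x\<in>carr A. \<forall>y\<in>carr A. \<phi> (mul A x y) = mul B (\<phi> x) (\<phi> y))"

definition alg_isomorphic :: "('f, 'a, 'y) alg_scheme \<Rightarrow> ('f, 'b, 'z) alg_scheme \<Rightarrow> bool" where
  "alg_isomorphic A B \<longleftrightarrow> (\<exists>\<phi>. alg_hom_bij \<phi> A B)"

definition division_algebra :: "('f, 'a, 'z) alg_scheme \<Rightarrow> bool" where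
  "division_algebra A \<longleftrightarrow> carr A \<noteq> {zer A} \<and>
     (\<forall>a\<in>carr A. a \<noteq> zer A \<longrightarrow>
        bij_betw (\<lambda>x. mul A a x) (carr A) (carr A) \<and> bij_betw (\<lambda>x. mul A x a) (carr A) (carr A))"

definition commutator_alg :: "('f::field, 'a, 'z) alg_scheme \<Rightarrow> ('f, 'a) alg" where
  "commutator_alg A = \<lparr>carr = carr A, zer = zer A, add = add A, smul = smul A,
     mul = (\<lambda>x y. add A (mul A x y) (smul A (-1) (mul A y x)))\<rparr>"

text \<open>
  The quotient by an ideal \<open>I\<close>, as the set of cosets. The unions are single cosets,
  since the result does not depend on the representatives modulo \<open>I\<close>.
\<close>

definition alg_coset :: "('f, 'a, 'z) alg_scheme \<Rightarrow> 'a set \<Rightarrow> 'a \<Rightarrow> 'a set" where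
  "alg_coset A I x = {add A x i | i. i \<in> I}"

definition alg_quot :: "('f, 'a, 'z) alg_scheme \<Rightarrow> 'a set \<Rightarrow> ('f, 'a set) alg" where
  "alg_quot A I =
    \<lparr>carr = alg_coset A I ` carr A,
     zer = alg_coset A I (zer A),
     add = (\<lambda>X Y. \<Union>x\<in>X. \<Union>y\<in>Y. alg_coset A I (add A x y)),
     smul = (\<lambda>c X. \<Union>x\<in>X. alg_coset A I (smul A c x)),
     mul = (\<lambda>X Y. \<Union>x\<in>X. \<Union>y\<in>Y. alg_coset A I (mul A x y))\<rparr>"


section \<open>Superalgebras\<close>

record ('f, 'a) superalg = "('f, 'a) alg" +
  even_part :: "'a set"
  odd_part :: "'a set"

definition graded :: "('f, 'a, 'z) alg_scheme \<Rightarrow> 'a set \<Rightarrow> 'a set \<Rightarrow> ('f, 'a) superalg" where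
  "graded A A0 A1 = \<lparr>carr = carr A, zer = zer A, add = add A, smul = smul A, mul = mul A,
     even_part = A0, odd_part = A1\<rparr>"

text \<open>Parities are natural numbers, read modulo 2.\<close>

definition parity_part :: "('f, 'a, 'z) superalg_scheme \<Rightarrow> nat \<Rightarrow> 'a set" where
  "parity_part M p = (if even p then even_part M else odd_part M)"

locale superalgebra = nonassoc_algebra M for M :: "('f::field, 'a, 'z) superalg_scheme" +
  assumes part_subspace: "lin_subspace M (parity_part M p)"
    and part_sum: "x \<in> carr M \<Longrightarrow> \<exists>a\<in>parity_part M 0. \<exists>b\<in>parity_part M 1. x = add M a b"
    and part_disjoint: "parity_part M 0 \<inter> parity_part M 1 = {zer M}"
    and part_mul: "x \<in> parity_part M p \<Longrightarrow> y \<in> parity_part M q \<Longrightarrow> mul M x y \<in> parity_part M (p + q)"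

definition associative_alg :: "('f, 'a, 'z) alg_scheme \<Rightarrow> bool" where
  "associative_alg A \<longleftrightarrow> (\<forall>x\<in>carr A. \<forall>y\<in>carr A. \<forall>z\<in>carr A.
     mul A (mul A x y) z = mul A x (mul A y z))"

definition supercommutative :: "('f::field, 'a, 'z) superalg_scheme \<Rightarrow> bool" where
  "supercommutative U \<longleftrightarrow> (\<forall>p q. \<forall>u\<in>parity_part U p. \<forall>w\<in>parity_part U q.
     mul U u w = smul U ((-1) ^ (p * q)) (mul U w u))"

definition superalg_isomorphic ::
  "('f, 'a, 'y) superalg_scheme \<Rightarrow> ('f, 'b, 'z) superalg_scheme \<Rightarrow> bool" where
  "superalg_isomorphic M N \<longleftrightarrow> (\<exists>\<phi>. alg_hom_bij \<phi> M N \<and> (\<forall>p. \<phi> ` parity_part M p = parity_part N p))"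


section \<open>Tensor products\<close>

definition pm_scale :: "'f::field \<Rightarrow> ('k \<Rightarrow>\<^sub>0 'f) \<Rightarrow> ('k \<Rightarrow>\<^sub>0 'f)" where
  "pm_scale c f = Poly_Mapping.map (\<lambda>x. c * x) f"

text \<open>The bilinear extension of a product \<open>m\<close> given on basis elements.\<close>

definition pm_bilin ::
  "('k \<Rightarrow> 'k \<Rightarrow> ('k \<Rightarrow>\<^sub>0 'f)) \<Rightarrow> ('k \<Rightarrow>\<^sub>0 'f) \<Rightarrow> ('k \<Rightarrow>\<^sub>0 'f) \<Rightarrow> ('k \<Rightarrow>\<^sub>0 'f::field)" where
  "pm_bilin m f g = (\<Sum>i\<in>Poly_Mapping.keys f. \<Sum>j\<in>Poly_Mapping.keys g.
     pm_scale (Poly_Mapping.lookup f i * Poly_Mapping.lookup g j) (m i j))"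

text \<open>
  \<open>A \<otimes> B\<close> is the free vector space on the set \<open>carr A \<times> carr B\<close>, modulo the span of the
  bilinearity relations.
\<close>

definition free_pairs ::
  "('f::field, 'a, 'y) alg_scheme \<Rightarrow> ('f, 'b, 'z) alg_scheme \<Rightarrow> ('f, 'a \<times> 'b \<Rightarrow>\<^sub>0 'f) alg" where
  "free_pairs A B =
    \<lparr>carr = {f. Poly_Mapping.keys f \<subseteq> carr A \<times> carr B},
     zer = 0, add = (+), smul = pm_scale,
     mul = pm_bilin (\<lambda>(a, b) (a', b'). Poly_Mapping.single (mul A a a', mul B b b') 1)\<rparr>"

definition tensor_relations ::
  "('f::field, 'a, 'y) alg_scheme \<Rightarrow> ('f, 'b, 'z) alg_scheme \<Rightarrow> ('a \<times> 'b \<Rightarrow>\<^sub>0 'f) set" where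
  "tensor_relations A B =
     {Poly_Mapping.single (add A a a', b) 1 - Poly_Mapping.single (a, b) 1
        - Poly_Mapping.single (a', b) 1 | a a' b. a \<in> carr A \<and> a' \<in> carr A \<and> b \<in> carr B} \<union>
     {Poly_Mapping.single (a, add B b b') 1 - Poly_Mapping.single (a, b) 1
        - Poly_Mapping.single (a, b') 1 | a b b'. a \<in> carr A \<and> b \<in> carr B \<and> b' \<in> carr B} \<union>
     {Poly_Mapping.single (smul A c a, b) 1 - Poly_Mapping.single (a, b) c
        | c a b. a \<in> carr A \<and> b \<in> carr B} \<union>
     {Poly_Mapping.single (a, smul B c b) 1 - Poly_Mapping.single (a, b) c
        | c a b. a \<in> carr A \<and> b \<in> carr B}"

definition tensor_null ::
  "('f::field, 'a, 'y) alg_scheme \<Rightarrow> ('f, 'b, 'z) alg_scheme \<Rightarrow> ('a \<times> 'b \<Rightarrow>\<^sub>0 'f) set" where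
  "tensor_null A B = module.span pm_scale (tensor_relations A B)"

definition tensor ::
  "('f::field, 'a, 'y) alg_scheme \<Rightarrow> ('f, 'b, 'z) alg_scheme \<Rightarrow>
     ('f, ('a \<times> 'b \<Rightarrow>\<^sub>0 'f) set) alg" where
  "tensor A B = alg_quot (free_pairs A B) (tensor_null A B)"

text \<open>For subspaces \<open>S\<close> and \<open>T\<close>, this is the subspace \<open>S \<otimes> T\<close> of \<open>A \<otimes> B\<close>.\<close>

definition tensor_sub ::
  "('f::field, 'a, 'y) alg_scheme \<Rightarrow> ('f, 'b, 'z) alg_scheme \<Rightarrow> 'a set \<Rightarrow> 'b set \<Rightarrow>
     ('a \<times> 'b \<Rightarrow>\<^sub>0 'f) set set" where
  "tensor_sub A B S T =
     alg_coset (free_pairs A B) (tensor_null A B) ` {f. Poly_Mapping.keys f \<subseteq> S \<times> T}"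

text \<open>\<open>A \<otimes> U\<close> for a superalgebra \<open>U\<close> and a purely even algebra \<open>A\<close>.\<close>

definition tensor_super ::
  "('f::field, 'a, 'y) alg_scheme \<Rightarrow> ('f, 'b, 'z) superalg_scheme \<Rightarrow>
     ('f, ('a \<times> 'b \<Rightarrow>\<^sub>0 'f) set) superalg" where
  "tensor_super A U = graded (tensor A U)
     (tensor_sub A U (carr A) (even_part U)) (tensor_sub A U (carr A) (odd_part U))"


section \<open>The Grassmann algebra and Malcev superalgebras\<close>

text \<open>
  The Grassmann algebra has the basis \<open>e\<^sub>S = e\<^bsub>i\<^sub>1\<^esub> \<cdots> e\<^bsub>i\<^sub>k\<^esub>\<close>, for
  \<open>S = {i\<^sub>1 < \<dots> < i\<^sub>k}\<close> a finite set of naturals; in particular \<open>e\<^bsub>{}\<^esub> = 1\<close>. The generators are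
  indexed from 0. The sign of \<open>e\<^sub>S e\<^sub>T\<close> comes from sorting the concatenated index sequences.
\<close>

definition grassmann_basis_mul :: "nat set \<Rightarrow> nat set \<Rightarrow> (nat set \<Rightarrow>\<^sub>0 'f::field)" where
  "grassmann_basis_mul S T =
     (if S \<inter> T = {}
      then Poly_Mapping.single (S \<union> T) ((-1) ^ card {(i, j). i \<in> S \<and> j \<in> T \<and> j < i})
      else 0)"

definition grassmann :: "('f::field, nat set \<Rightarrow>\<^sub>0 'f) superalg" where
  "grassmann =
    \<lparr>carr = {g. Poly_Mapping.keys g \<subseteq> {S. finite S}},
     zer = 0, add = (+), smul = pm_scale, mul = pm_bilin grassmann_basis_mul,
     even_part = {g. Poly_Mapping.keys g \<subseteq> {S. finite S \<and> even (card S)}},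
     odd_part = {g. Poly_Mapping.keys g \<subseteq> {S. finite S \<and> odd (card S)}}\<rparr>"

definition grassmann_envelope ::
  "('f::field, 'a, 'z) superalg_scheme \<Rightarrow> ('f, ((nat set \<Rightarrow>\<^sub>0 'f) \<times> 'a \<Rightarrow>\<^sub>0 'f) set) alg" where
  "grassmann_envelope M =
    (let G = (grassmann :: ('f, nat set \<Rightarrow>\<^sub>0 'f) superalg); T = tensor G M in
     restr T {add T x y | x y. x \<in> tensor_sub G M (even_part G) (even_part M) \<and>
                               y \<in> tensor_sub G M (odd_part G) (odd_part M)})"

definition jacobian :: "('f, 'a, 'z) alg_scheme \<Rightarrow> 'a \<Rightarrow> 'a \<Rightarrow> 'a \<Rightarrow> 'a" where
  "jacobian A x y z =
     add A (add A (mul A (mul A x y) z) (mul A (mul A y z) x)) (mul A (mul A z x) y)"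

locale malcev_algebra = nonassoc_algebra A for A :: "('f::field, 'a, 'z) alg_scheme" +
  assumes square_zero: "x \<in> carr A \<Longrightarrow> mul A x x = zer A"
    and malcev_identity: "x \<in> carr A \<Longrightarrow> y \<in> carr A \<Longrightarrow> z \<in> carr A \<Longrightarrow>
      jacobian A x y (mul A x z) = mul A (jacobian A x y z) x"

definition malcev_superalgebra :: "('f::field, 'a, 'z) superalg_scheme \<Rightarrow> bool" where
  "malcev_superalgebra M \<longleftrightarrow> superalgebra M \<and> malcev_algebra (grassmann_envelope M)"


section \<open>The class H\<close>

text \<open>The arguments \<open>q\<close>, \<open>r\<close>, etc. are the parities of \<open>y\<close>, \<open>z\<close>, etc.\<close>

definition supertriple ::
  "('f::field, 'a, 'z) superalg_scheme \<Rightarrow> nat \<Rightarrow> nat \<Rightarrow> 'a \<Rightarrow> 'a \<Rightarrow> 'a \<Rightarrow> 'a" where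
  "supertriple M q r x y z =
     add M (add M (mul M (mul M x y) z) (smul M (- ((-1) ^ (q * r))) (mul M (mul M x z) y)))
       (smul M 2 (mul M x (mul M y z)))"

definition super_h ::
  "('f::field, 'a, 'z) superalg_scheme \<Rightarrow> nat \<Rightarrow> nat \<Rightarrow> nat \<Rightarrow> nat \<Rightarrow>
     'a \<Rightarrow> 'a \<Rightarrow> 'a \<Rightarrow> 'a \<Rightarrow> 'a \<Rightarrow> 'a" where
  "super_h M pz pt px pu y z t x u =
     add M (add M (add M
       (mul M (supertriple M pt pu (mul M y z) t u) x)
       (smul M ((-1) ^ (px * pu)) (mul M (supertriple M pt px (mul M y z) t x) u)))
       (smul M ((-1) ^ (px * (pz + pt + pu) + pu * pt))
          (mul M (supertriple M pz pu (mul M y x) z u) t)))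
       (smul M ((-1) ^ (pu * (pz + pt) + px * pt))
          (mul M (supertriple M pz px (mul M y u) z x) t))"

definition in_class_H :: "('f::field, 'a, 'z) superalg_scheme \<Rightarrow> bool" where
  "in_class_H M \<longleftrightarrow> (\<forall>py pz pt px pu.
     \<forall>y\<in>parity_part M py. \<forall>z\<in>parity_part M pz. \<forall>t\<in>parity_part M pt. \<forall>x\<in>parity_part M px. \<forall>u\<in>parity_part M pu.
       super_h M pz pt px pu y z t x u = zer M)"


section \<open>The exceptional seven-dimensional Malcev algebras\<close>

subsection \<open>The split case\<close>

type_synonym 'f vec3 = "'f \<times> 'f \<times> 'f"

fun vec3_scale :: "'f::field \<Rightarrow> 'f vec3 \<Rightarrow> 'f vec3" where
  "vec3_scale c (x1, x2, x3) = (c * x1, c * x2, c * x3)"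

fun vec3_dot :: "'f::field vec3 \<Rightarrow> 'f vec3 \<Rightarrow> 'f" where
  "vec3_dot (x1, x2, x3) (y1, y2, y3) = x1 * y1 + x2 * y2 + x3 * y3"

fun vec3_cross :: "'f::field vec3 \<Rightarrow> 'f vec3 \<Rightarrow> 'f vec3" where
  "vec3_cross (x1, x2, x3) (y1, y2, y3) = (x2 * y3 - x3 * y2, x3 * y1 - x1 * y3, x1 * y2 - x2 * y1)"

text \<open>\<open>(a, \<alpha>, \<beta>, b)\<close> is the matrix with rows \<open>a, \<alpha>\<close> and \<open>\<beta>, b\<close>.\<close>

type_synonym 'f cmat = "'f \<times> 'f vec3 \<times> 'f vec3 \<times> 'f"

fun cmat_scale :: "'f::field \<Rightarrow> 'f cmat \<Rightarrow> 'f cmat" where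
  "cmat_scale c (a, \<alpha>, \<beta>, b) = (c * a, vec3_scale c \<alpha>, vec3_scale c \<beta>, c * b)"

fun cmat_mul :: "'f::field cmat \<Rightarrow> 'f cmat \<Rightarrow> 'f cmat" where
  "cmat_mul (a, \<alpha>, \<beta>, b) (c, \<gamma>, \<delta>, d) =
     (a * c + vec3_dot \<alpha> \<delta>,
      vec3_scale a \<gamma> + vec3_scale d \<alpha> - vec3_cross \<beta> \<delta>,
      vec3_scale c \<beta> + vec3_scale b \<delta> + vec3_cross \<alpha> \<gamma>,
      vec3_dot \<beta> \<gamma> + b * d)"

definition cayley_split :: "('f::field, 'f cmat) alg" where
  "cayley_split = type_alg cmat_scale cmat_mul"

definition cmat_unit :: "'f::field cmat" where
  "cmat_unit = (1, 0, 0, 1)"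

definition M7_split :: "('f::field, 'f cmat set) alg" where
  "M7_split = alg_quot (commutator_alg cayley_split) {cmat_scale c cmat_unit | c. True}"

subsection \<open>The division case\<close>

text \<open>\<open>(a, b, c, d)\<close> is the quaternion \<open>a + b i + c j + d k\<close>.\<close>

type_synonym 'f quat = "'f \<times> 'f \<times> 'f \<times> 'f"

fun quat_scale :: "'f::field \<Rightarrow> 'f quat \<Rightarrow> 'f quat" where
  "quat_scale c (x0, x1, x2, x3) = (c * x0, c * x1, c * x2, c * x3)"

fun quat_mul :: "'f::field quat \<Rightarrow> 'f quat \<Rightarrow> 'f quat" where
  "quat_mul (x0, x1, x2, x3) (y0, y1, y2, y3) =
     (x0 * y0 - x1 * y1 - x2 * y2 - x3 * y3,
      x0 * y1 + x1 * y0 + x2 * y3 - x3 * y2,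
      x0 * y2 - x1 * y3 + x2 * y0 + x3 * y1,
      x0 * y3 + x1 * y2 - x2 * y1 + x3 * y0)"

fun quat_conj :: "'f::field quat \<Rightarrow> 'f quat" where
  "quat_conj (x0, x1, x2, x3) = (x0, - x1, - x2, - x3)"

definition quat_alg :: "('f::field, 'f quat) alg" where
  "quat_alg = type_alg quat_scale quat_mul"

text \<open>
  \<open>(a, b)\<close> is the element \<open>a + v b\<close>. The multiplication rules of the doubling process give
  \<open>a (v d) = v (a\<^sup>* d)\<close>, \<open>(v b) c = v (c b)\<close> and \<open>(v b) (v d) = \<gamma> d b\<^sup>*\<close>, with \<open>a\<^sup>*\<close> the conjugate of
  \<open>a\<close>; see \<open>oct_mul_rules\<close> below.
\<close>

type_synonym 'f oct = "'f quat \<times> 'f quat"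

fun oct_scale :: "'f::field \<Rightarrow> 'f oct \<Rightarrow> 'f oct" where
  "oct_scale c (a, b) = (quat_scale c a, quat_scale c b)"

fun oct_mul :: "'f::field \<Rightarrow> 'f oct \<Rightarrow> 'f oct \<Rightarrow> 'f oct" where
  "oct_mul \<gamma> (a, b) (c, d) =
     (quat_mul a c + quat_scale \<gamma> (quat_mul d (quat_conj b)),
      quat_mul (quat_conj a) d + quat_mul c b)"

definition oct_alg :: "'f::field \<Rightarrow> ('f, 'f oct) alg" where
  "oct_alg \<gamma> = type_alg oct_scale (oct_mul \<gamma>)"

definition oct_unit :: "'f::field oct" where
  "oct_unit = ((1, 0, 0, 0), 0)"

definition M7_div :: "'f::field \<Rightarrow> ('f, 'f oct set) alg" where
  "M7_div \<gamma> = alg_quot (commutator_alg (oct_alg \<gamma>)) {oct_scale c oct_unit | c. True}"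

lemma oct_mul_rules:
  fixes a b c :: "'f::field quat" and \<gamma> :: 'f
  defines "v \<equiv> (0, (1, 0, 0, 0)) :: 'f oct" and "h \<equiv> (\<lambda>x. (x, 0)) :: 'f quat \<Rightarrow> 'f oct"
  shows "(a, b) = h a + oct_mul \<gamma> v (h b)"
    and "oct_mul \<gamma> (h a) (h b) = h (quat_mul a b)"
    and "oct_mul \<gamma> v v = oct_scale \<gamma> oct_unit"
    and "oct_mul \<gamma> (h a) (oct_mul \<gamma> v (h b)) = oct_mul \<gamma> (oct_mul \<gamma> v (h b)) (h (quat_conj a))"
    and "oct_mul \<gamma> (h (quat_mul a b)) v = oct_mul \<gamma> (h b) (oct_mul \<gamma> (h a) v)"
    and "oct_mul \<gamma> v (h (quat_mul a b)) = oct_mul \<gamma> (oct_mul \<gamma> v (h b)) (h a)"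
    and "oct_mul \<gamma> (oct_mul \<gamma> v (h a)) (oct_mul \<gamma> v (h b)) =
           oct_scale \<gamma> (h (quat_mul b (quat_conj a)))"
  by (cases a; cases b; simp add: v_def h_def oct_unit_def zero_prod_def algebra_simps)+

definition exceptional_malcev :: "('f::field, 'a, 'z) alg_scheme \<Rightarrow> bool" where
  "exceptional_malcev A \<longleftrightarrow>
     alg_isomorphic A (M7_split :: ('f, 'f cmat set) alg) \<or>
     (\<exists>\<gamma>. \<gamma> \<noteq> 0 \<and> division_algebra (quat_alg :: ('f, 'f quat) alg) \<and>
        division_algebra (oct_alg \<gamma>) \<and> alg_isomorphic A (M7_div \<gamma>))"

end

theory Submission
  imports Defs
begin

text \<open>
  The algebra \<open>E\<close> consists of octonions modulo scalars, and its commutator product is, up to a factor,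
  the vector product in dimension seven: there is a symmetric bilinear form \<open>g\<close> with
  \<open>(x y) y = g(y,y) x - g(x,y) y\<close>. This identity, together with one orthogonal anisotropic triple
  \<open>a, b, c\<close> with \<open>g(a b, c) = 0\<close>, determines all of \<open>E\<close>: the seven products of \<open>a, b, c\<close> form an
  orthogonal basis (\<open>triple_complement\<close>, \<open>frame_expand\<close>). Both the split and the division case have this
  form (\<open>exceptional_cross_form\<close>), so everything afterwards is free of coordinates and of case
  distinctions.

  Let \<open>E\<close> act on \<open>M\<close> by right multiplications \<open>R\<^sub>a\<close>. On \<open>E\<close> itself the operator
  \<open>dyad a b = 3 g(a,b) - R\<^sub>a R\<^sub>b - 2 R\<^sub>b R\<^sub>a + R\<^bsub>ab\<^esub>\<close> (operators act from the right, so
  \<open>R\<^sub>a R\<^sub>b\<close> is first \<open>R\<^sub>a\<close>) is three times the rank one operator \<open>x \<mapsto> g(x,a) b\<close>. Therefore, on \<open>E\<close>,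
  \<open>b \<mapsto> dyad a b m\<close> commutes with right multiplications. The heart of the proof is that this persists
  on all of \<open>M\<close>: \<open>dyad a b m \<cdot> c = dyad a (b c) m\<close> (\<open>dyad_mult\<close>), so that each \<open>m\<close> and each \<open>a\<close> give
  an \<open>E\<close>-module homomorphism from \<open>E\<close> to \<open>M\<close>. The difference of the two sides is the \<open>defect\<close>.
  The identity \<open>h\<close> of the class \<open>\<H>\<close> says that \<open>dyad a b m \<cdot> c\<close> is skew in \<open>b\<close> and \<open>c\<close>; with the
  Malcev identity it follows that the defect is alternating in \<open>a, b, c\<close>, that it is annihilated by
  \<open>a\<close>, \<open>b\<close> and \<open>c\<close>, then by their products, hence by \<open>E\<close>; as \<open>E\<close> annihilates no nonzero element,
  it vanishes. The same faithfulness shows that the homomorphisms span (\<open>dyad_expand\<close>). Thus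
  \<open>M = E \<otimes> U\<close> as an \<open>E\<close>-module, where \<open>U\<close>, the space of module homomorphisms from \<open>E\<close> to \<open>M\<close>, is
  realised inside \<open>M\<close> by evaluation at a basis vector \<open>e1\<close>, that is, as the annihilator of \<open>e1\<close>.
  The homomorphism that belongs to \<open>u \<in> U\<close> is \<open>phi u\<close>.

  For \<open>w, u \<in> U\<close> the map \<open>(a, b) \<mapsto> phi w a \<cdot> phi u b\<close> is a bilinear map on \<open>E\<close>, and the identity \<open>h\<close>
  with two arguments in \<open>M\<close> forces it to be determined by its value at one pair of orthogonal vectors
  (\<open>B_zero\<close>). Comparison with \<open>(a, b) \<mapsto> phi v (a b)\<close> gives \<open>phi w a \<cdot> phi u b = phi v (a b)\<close> for
  one \<open>v \<in> U\<close>, which defines the product of \<open>U\<close>. Its supercommutativity is the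
  superanticommutativity of \<open>M\<close>, and its associativity follows from one instance of \<open>h\<close> with three
  arguments outside \<open>E\<close> (\<open>umul_right_comm\<close>).

  The class \<open>\<H>\<close> is given by identities of \<open>M\<close>, but the Malcev identity only by the Grassmann
  envelope. Two consequences of the latter are used: superanticommutativity, and the Malcev identity
  with three even arguments and one arbitrary argument.
\<close>

section \<open>Vector products and dyads\<close>

text \<open>
  The expression \<open>{x, y, z}\<close> of the definition of \<open>\<H>\<close>, without signs. For \<open>y, z \<in> E\<close> it is, as an
  operator on \<open>x\<close>, the skew part of a dyad, and for \<open>x, z \<in> E\<close>
  it is the dyad of \<open>x\<close> and \<open>z\<close> applied to \<open>y\<close>, up to a multiple of \<open>y\<close>.
\<close>

definition triple_product :: "('f::field \<Rightarrow> 'm \<Rightarrow> 'm) \<Rightarrow> ('m \<Rightarrow> 'm \<Rightarrow> 'm) \<Rightarrow> 'm \<Rightarrow> 'm \<Rightarrow> 'm \<Rightarrow> 'm::ab_group_add" where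
  "triple_product scale mult x y z = mult (mult x y) z - mult (mult x z) y + scale 2 (mult x (mult y z))"

text \<open>
  The algebra \<open>E\<close> acting on the whole space \<open>'m\<close>, with the Malcev identity linear in one element of
  the space and in Sagle's form.
\<close>

locale cross_action = vector_space scale
  for scale :: "'f::field \<Rightarrow> 'm::ab_group_add \<Rightarrow> 'm" (infixr "*s" 69) +
  fixes mult :: "'m \<Rightarrow> 'm \<Rightarrow> 'm" (infixl "\<cdot>" 80)
    and E :: "'m set" and g :: "'m \<Rightarrow> 'm \<Rightarrow> 'f"
  assumes two: "(2::'f) \<noteq> 0" and three: "(3::'f) \<noteq> 0"
    and mult_add_l: "(x + y) \<cdot> z = x \<cdot> z + y \<cdot> z"
    and mult_add_r: "x \<cdot> (y + z) = x \<cdot> y + x \<cdot> z"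
    and mult_sc_l: "(r *s x) \<cdot> y = r *s (x \<cdot> y)"
    and mult_sc_r: "x \<cdot> (r *s y) = r *s (x \<cdot> y)"
    and E_sub: "subspace E"
    and E_mult: "a \<in> E \<Longrightarrow> b \<in> E \<Longrightarrow> a \<cdot> b \<in> E"
    and g_sym: "a \<in> E \<Longrightarrow> b \<in> E \<Longrightarrow> g a b = g b a"
    and g_add: "a \<in> E \<Longrightarrow> b \<in> E \<Longrightarrow> c \<in> E \<Longrightarrow> g (a + b) c = g a c + g b c"
    and g_sc: "a \<in> E \<Longrightarrow> b \<in> E \<Longrightarrow> g (r *s a) b = r * g a b"
    and anticomm: "a \<in> E \<Longrightarrow> a \<cdot> m = - (m \<cdot> a)"
    and square_0: "a \<in> E \<Longrightarrow> a \<cdot> a = 0"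
    and cross: "x \<in> E \<Longrightarrow> y \<in> E \<Longrightarrow> (x \<cdot> y) \<cdot> y = g y y *s x - g x y *s y"
    and sagle: "y \<in> E \<Longrightarrow> z \<in> E \<Longrightarrow> t \<in> E \<Longrightarrow>
      (v \<cdot> z) \<cdot> (y \<cdot> t) = v \<cdot> y \<cdot> z \<cdot> t - v \<cdot> t \<cdot> y \<cdot> z - v \<cdot> ((y \<cdot> z) \<cdot> t) - v \<cdot> (z \<cdot> t) \<cdot> y"
    and faithful: "(\<And>a. a \<in> E \<Longrightarrow> m \<cdot> a = 0) \<Longrightarrow> m = 0"
begin

lemma E_add: "a \<in> E \<Longrightarrow> b \<in> E \<Longrightarrow> a + b \<in> E"
  and E_sc: "a \<in> E \<Longrightarrow> r *s a \<in> E"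
  and E_neg: "a \<in> E \<Longrightarrow> - a \<in> E"
  and E_diff: "a \<in> E \<Longrightarrow> b \<in> E \<Longrightarrow> a - b \<in> E"
  and E_0: "0 \<in> E"
  using E_sub subspace_add subspace_scale subspace_neg subspace_diff subspace_0 by blast+

lemmas E_cl = E_add E_sc E_neg E_diff E_0 E_mult

lemma mult_0_l: "0 \<cdot> x = 0" and mult_0_r: "x \<cdot> 0 = 0"
  using mult_sc_l[of 0 0 x] mult_sc_r[of x 0 0] by simp_all

lemma mult_neg_l: "(- x) \<cdot> y = - (x \<cdot> y)" and mult_neg_r: "x \<cdot> (- y) = - (x \<cdot> y)"
  using mult_sc_l[of "-1" x y] mult_sc_r[of x "-1" y] by simp_all

lemma mult_diff_l: "(x - y) \<cdot> z = x \<cdot> z - y \<cdot> z"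
  and mult_diff_r: "x \<cdot> (y - z) = x \<cdot> y - x \<cdot> z"
  using mult_add_l[of x "- y" z] mult_add_r[of x y "- z"] by (simp_all add: mult_neg_l mult_neg_r)

lemmas mult_lin = mult_add_l mult_add_r mult_sc_l mult_sc_r mult_0_l mult_0_r mult_neg_l mult_neg_r
  mult_diff_l mult_diff_r

lemma g_add_r: "a \<in> E \<Longrightarrow> b \<in> E \<Longrightarrow> c \<in> E \<Longrightarrow> g c (a + b) = g c a + g c b"
  using g_add g_sym E_add by metis
lemma g_sc_r: "a \<in> E \<Longrightarrow> b \<in> E \<Longrightarrow> g b (r *s a) = r * g b a"
  using g_sc g_sym E_sc by metis
lemma g_neg: "a \<in> E \<Longrightarrow> b \<in> E \<Longrightarrow> g (- a) b = - g a b"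
  using g_sc[of a b "-1"] by simp
lemma g_neg_r: "a \<in> E \<Longrightarrow> b \<in> E \<Longrightarrow> g b (- a) = - g b a"
  using g_sc_r[of a b "-1"] by simp
lemma g_diff: "a \<in> E \<Longrightarrow> b \<in> E \<Longrightarrow> c \<in> E \<Longrightarrow> g (a - b) c = g a c - g b c"
  using g_add[of a "-b" c] by (simp add: g_neg E_neg)
lemma g_diff_r: "a \<in> E \<Longrightarrow> b \<in> E \<Longrightarrow> c \<in> E \<Longrightarrow> g c (a - b) = g c a - g c b"
  using g_add_r[of a "-b" c] by (simp add: g_neg_r E_neg)
lemma g_0: "b \<in> E \<Longrightarrow> g 0 b = 0" and g_0_r: "b \<in> E \<Longrightarrow> g b 0 = 0"
  using g_sc[of 0 b 0] g_sc_r[of 0 b 0] by (simp_all add: E_0)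

lemmas g_lin = g_add g_add_r g_sc g_sc_r g_neg g_neg_r g_diff g_diff_r g_0 g_0_r

text \<open>
  Linear identities in \<open>'m\<close> are proved by expanding small integer multiples into sums, on which
  cancellation in abelian groups works.
\<close>

lemma sc2: "2 *s x = x + x" and sc3: "3 *s x = x + x + x"
proof -
  show a: "2 *s x = x + x" using scale_left_distrib[of 1 1 x] by simp
  show "3 *s x = x + x + x" using scale_left_distrib[of 2 1 x] a by simp
qed

lemma sc2r: "(2 * r) *s x = r *s x + r *s x" and sc3r: "(3 * r) *s x = r *s x + r *s x + r *s x"
  using sc2[of "r *s x"] sc3[of "r *s x"] by simp_all

lemmas sc23 = sc2 sc3 sc2r sc3r

lemma cancel2: "x + x = 0 \<Longrightarrow> x = (0::'m)" and cancel3: "x + x + x = 0 \<Longrightarrow> x = (0::'m)"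
  using sc2[of x] sc3[of x] two three by auto

lemma anti_E: "a \<in> E \<Longrightarrow> b \<in> E \<Longrightarrow> b \<cdot> a = - (a \<cdot> b)"
  by (rule anticomm)

lemma cross2:
  assumes "x \<in> E" "y \<in> E" "z \<in> E"
  shows "(x \<cdot> y) \<cdot> z + (x \<cdot> z) \<cdot> y = 2 * g y z *s x - g x y *s z - g x z *s y"
proof -
  have "(x \<cdot> y) \<cdot> z + (x \<cdot> z) \<cdot> y
      = x \<cdot> (y + z) \<cdot> (y + z) - x \<cdot> y \<cdot> y - x \<cdot> z \<cdot> z"
    by (simp add: mult_add_l mult_add_r algebra_simps)
  also have "\<dots> = (g (y + z) (y + z) - g y y - g z z) *s x
      - (g x (y + z) *s (y + z) - g x y *s y - g x z *s z)"
    using assms by (simp add: cross E_add scale_left_diff_distrib)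
  also have "g (y + z) (y + z) - g y y - g z z = 2 * g y z"
    using assms by (simp add: g_add g_add_r E_add g_sym[of z y])
  also have "g x (y + z) *s (y + z) - g x y *s y - g x z *s z = g x y *s z + g x z *s y"
    using assms by (simp add: g_add_r scale_left_distrib scale_right_distrib)
  finally show ?thesis by (simp add: algebra_simps)
qed

text \<open>
  Compare \<open>((x y) y) y\<close>, computed from \<open>cross\<close> for the pair \<open>(x y, y)\<close>, with the same element computed
  by multiplying \<open>cross\<close> for \<open>(x, y)\<close> by \<open>y\<close>. Consequently \<open>g(x y, z)\<close> is an alternating trilinear form.
\<close>

lemma g_mult_self: assumes "x \<in> E" "y \<in> E" shows "g (x \<cdot> y) y = 0"
proof -
  have "(x \<cdot> y \<cdot> y) \<cdot> y = g y y *s (x \<cdot> y) - g (x \<cdot> y) y *s y"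
    using cross[of "x \<cdot> y" y] assms E_mult by simp
  moreover have "(x \<cdot> y \<cdot> y) \<cdot> y = g y y *s (x \<cdot> y)"
    using assms by (simp add: cross mult_lin square_0)
  ultimately have "g (x \<cdot> y) y *s y = 0" by simp
  then show ?thesis using g_0_r assms E_mult by auto
qed

lemma g_mult_swap: 
  assumes "x \<in> E" "y \<in> E" "z \<in> E" shows "g (x \<cdot> z) y = - g (x \<cdot> y) z"
  using g_mult_self[of x "y + z"] g_mult_self[of x y] g_mult_self[of x z] assms
  by (simp add: mult_lin g_lin E_cl eq_neg_iff_add_eq_0 add.commute)

lemma g_mult_rot: 
  assumes "x \<in> E" "y \<in> E" "z \<in> E" shows "g (y \<cdot> z) x = g (x \<cdot> y) z"
proof -
  have "g (y \<cdot> z) x = - g (y \<cdot> x) z" using g_mult_swap assms by blast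
  also have "... = g (x \<cdot> y) z" using anti_E[of x y] assms by (simp add: g_neg E_mult)
  finally show ?thesis .
qed

lemma g_mult_self': assumes "x \<in> E" "y \<in> E" shows "g (x \<cdot> y) x = 0"
  using g_mult_self[of y x] anti_E[of x y] assms by (simp add: g_neg E_mult)

lemma cross': assumes "x \<in> E" "y \<in> E" shows "y \<cdot> (x \<cdot> y) = g x y *s y - g y y *s x"
    and "y \<cdot> (y \<cdot> x) = g y y *s x - g x y *s y" "(y \<cdot> x) \<cdot> y = g x y *s y - g y y *s x"
  using cross[of x y] anti_E[of "x \<cdot> y" y] anti_E[of x y] assms by (simp_all add: E_cl mult_lin)

lemma g_mult_mult: assumes "x \<in> E" "y \<in> E" "z \<in> E"
  shows "g (x \<cdot> y) (x \<cdot> z) = g x y * g x z - g x x * g y z"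
proof -
  have "g (x \<cdot> y) (x \<cdot> z) = - g (x \<cdot> (x \<cdot> z)) y" by (rule g_mult_swap) (use assms in \<open>simp_all add: E_mult\<close>)
  also have "... = - g (g x x *s z - g z x *s x) y" using cross'(2)[OF assms(3,1)] by simp
  also have "\<dots> = g x y * g x z - g x x * g y z"
    using assms by (simp add: g_diff g_sc E_sc g_sym[of z y] g_sym[of z x])
  finally show ?thesis .
qed

text \<open>
  Three times the operator \<open>x \<mapsto> g(x, a) b\<close> of \<open>E\<close>, written as a polynomial in right multiplications, so
  that it makes sense on the whole space. The factor 3 avoids division.
\<close>

definition dyad where "dyad a b m = 3 * g a b *s m - m \<cdot> a \<cdot> b - 2 *s (m \<cdot> b \<cdot> a) + m \<cdot> (a \<cdot> b)"

lemma dyad_E: assumes "a \<in> E" "b \<in> E" "x \<in> E" shows "dyad a b x = 3 * g x a *s b"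
proof -
  have 1: "x \<cdot> a \<cdot> b = 2 * g a b *s x - g x a *s b - g x b *s a - x \<cdot> b \<cdot> a"
    using cross2[of x a b] assms by (simp add: algebra_simps)
  have "(a \<cdot> b) \<cdot> x + (a \<cdot> x) \<cdot> b = 2 * g x b *s a - g a b *s x - g x a *s b"
    using cross2[OF assms] g_sym[of a x] g_sym[of b x] assms by simp
  then have "x \<cdot> (a \<cdot> b) = - (x \<cdot> a \<cdot> b) - (2 * g x b *s a - g a b *s x - g x a *s b)"
    using anti_E[of "a \<cdot> b" x] anti_E[of x a] assms by (simp add: mult_lin E_cl algebra_simps)
  then have 2: "x \<cdot> (a \<cdot> b) = x \<cdot> b \<cdot> a - g a b *s x + 2 * g x a *s b - g x b *s a"
    unfolding 1 by (simp add: algebra_simps sc23)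
  show ?thesis unfolding dyad_def 2 1
    by (simp add: algebra_simps sc23)
qed

section \<open>Orthogonal triples and the seven-dimensional frame\<close>

lemma swap_orth:
  assumes "u \<in> E" "v \<in> E" "w \<in> E" "g u v = 0" "g u w = 0" "g v w = 0"
  shows "u \<cdot> v \<cdot> w = - (u \<cdot> w \<cdot> v)"
  using cross2[OF assms(1-3)] assms(4-6) by (simp add: eq_neg_iff_add_eq_0)

text \<open>
  Such elements generate \<open>E\<close>, like \<open>i, j\<close> and the doubling element \<open>v\<close> of the octonions. The condition
  \<open>g(a b, c) = 0\<close> keeps \<open>c\<close> out of the quaternion part of \<open>a\<close> and \<open>b\<close>.
\<close>

definition triple where
  "triple a b c \<longleftrightarrow> a \<in> E \<and> b \<in> E \<and> c \<in> E \<and> g a b = 0 \<and> g a c = 0 \<and> g b c = 0 \<and>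
     g (a \<cdot> b) c = 0 \<and> g a a \<noteq> 0 \<and> g b b \<noteq> 0 \<and> g c c \<noteq> 0"

lemma triple_swap: assumes "triple a b c" shows "triple b a c"
  using assms anti_E[of a b] unfolding triple_def by (auto simp: g_neg E_mult g_sym[of b a])

lemma triple_swap': assumes "triple a b c" shows "triple a c b"
  using assms g_mult_swap[of a b c] unfolding triple_def by (auto simp: g_sym[of c b])

lemma triple_mult: assumes "triple a b c" shows "triple a b (c \<cdot> a)"
proof -
  have E: "a \<in> E" "b \<in> E" "c \<in> E" "c \<cdot> a \<in> E" "a \<cdot> b \<in> E" "a \<cdot> c \<in> E"
    and o: "g a b = 0" "g a c = 0" "g b c = 0" "g (a \<cdot> b) c = 0"
    and n: "g a a \<noteq> 0" "g b b \<noteq> 0" "g c c \<noteq> 0"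
    using assms unfolding triple_def by (auto simp: E_mult)
  have "g a (c \<cdot> a) = 0" using g_mult_self[OF E(3,1)] g_sym[OF E(1,4)] by simp
  moreover have "g b (c \<cdot> a) = 0"
    using g_mult_rot[OF E(3,1,2)] o(4) g_sym[OF E(2,4)] by simp
  moreover have "g (a \<cdot> b) (c \<cdot> a) = 0"
    using g_mult_mult[OF E(1,2,3)] anti_E[OF E(1,3)] o by (simp add: g_neg_r E)
  moreover have "g (c \<cdot> a) (c \<cdot> a) \<noteq> 0"
    using g_mult_mult[OF E(3,1,1)] g_sym[OF E(1,3)] o n by simp
  ultimately show ?thesis unfolding triple_def using E o n by simp
qed

lemma triple_mult': assumes "triple a b c" shows "triple a b (c \<cdot> b)"
  using triple_swap triple_mult assms by blast

definition frame where "frame a b c = {a, b, a \<cdot> b, c, c \<cdot> a, c \<cdot> b, c \<cdot> b \<cdot> a}"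

lemma triple_frame:
  assumes "triple a b c"
  shows "frame a b c \<subseteq> E" "\<forall>s\<in>frame a b c. g s s \<noteq> 0"
    "\<forall>s\<in>frame a b c. \<forall>t\<in>frame a b c. s \<noteq> t \<longrightarrow> g s t = 0"
proof -
  have t: "triple a b c" "triple a b (c \<cdot> a)" "triple a b (c \<cdot> b)" "triple a b (c \<cdot> b \<cdot> a)"
    using assms triple_mult triple_mult' by blast+
  have E: "a \<in> E" "b \<in> E" "c \<in> E" "a \<cdot> b \<in> E" "c \<cdot> a \<in> E" "c \<cdot> b \<in> E" "c \<cdot> b \<cdot> a \<in> E"
    using t unfolding triple_def by (auto simp: E_mult)
  have n: "g a a \<noteq> 0" "g b b \<noteq> 0" "g (a \<cdot> b) (a \<cdot> b) \<noteq> 0" "g c c \<noteq> 0"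
    "g (c \<cdot> a) (c \<cdot> a) \<noteq> 0" "g (c \<cdot> b) (c \<cdot> b) \<noteq> 0" "g (c \<cdot> b \<cdot> a) (c \<cdot> b \<cdot> a) \<noteq> 0"
    using t g_mult_mult[OF E(1,2,2)] unfolding triple_def by auto
  have ab: "g a b = 0" "g b (a \<cdot> b) = 0" "g a (a \<cdot> b) = 0"
    using t g_mult_self[OF E(1,2)] g_mult_self'[OF E(1,2)] g_sym E unfolding triple_def by auto
  have x: "g a s = 0 \<and> g b s = 0 \<and> g (a \<cdot> b) s = 0" if "s \<in> {c, c \<cdot> a, c \<cdot> b, c \<cdot> b \<cdot> a}" for s
    using that t unfolding triple_def by auto
  have c: "g c (c \<cdot> a) = 0" "g c (c \<cdot> b) = 0" "g (c \<cdot> b) (c \<cdot> b \<cdot> a) = 0"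
    using g_mult_self' g_sym E by metis+
  have c1: "g (c \<cdot> a) (c \<cdot> b) = 0"
    using g_mult_mult[OF E(3,1,2)] x[of c] g_sym[OF E(1,3)] g_sym[OF E(2,3)] ab by simp
  have "g (c \<cdot> b \<cdot> a) c = g (c \<cdot> (c \<cdot> b)) a" using g_mult_rot[OF E(3,6,1)] .
  also have "\<dots> = 0" using cross'(2)[OF E(2,3)] x[of c] ab E
    by (simp add: g_diff g_sc E_sc g_sym[of b a] g_sym[of c a])
  finally have c2: "g c (c \<cdot> b \<cdot> a) = 0" using g_sym E by metis
  have "g (a \<cdot> c) (a \<cdot> (c \<cdot> b)) = 0"
    using g_mult_mult[OF E(1,3,6)] x[of c] c by simp
  then have c3: "g (c \<cdot> a) (c \<cdot> b \<cdot> a) = 0"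
    using anti_E[OF E(1,3)] anti_E[OF E(1,6)] E by (simp add: g_neg g_neg_r E_cl)
  show "frame a b c \<subseteq> E" "\<forall>s\<in>frame a b c. g s s \<noteq> 0" unfolding frame_def using E n by auto
  show "\<forall>s\<in>frame a b c. \<forall>t\<in>frame a b c. s \<noteq> t \<longrightarrow> g s t = 0"
  proof -
    have o: "g a b = 0" "g a (a \<cdot> b) = 0" "g b (a \<cdot> b) = 0"
      "g a c = 0" "g a (c \<cdot> a) = 0" "g a (c \<cdot> b) = 0" "g a (c \<cdot> b \<cdot> a) = 0"
      "g b c = 0" "g b (c \<cdot> a) = 0" "g b (c \<cdot> b) = 0" "g b (c \<cdot> b \<cdot> a) = 0"
      "g (a \<cdot> b) c = 0" "g (a \<cdot> b) (c \<cdot> a) = 0" "g (a \<cdot> b) (c \<cdot> b) = 0" "g (a \<cdot> b) (c \<cdot> b \<cdot> a) = 0"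
      "g c (c \<cdot> a) = 0" "g c (c \<cdot> b) = 0" "g c (c \<cdot> b \<cdot> a) = 0"
      "g (c \<cdot> a) (c \<cdot> b) = 0" "g (c \<cdot> a) (c \<cdot> b \<cdot> a) = 0" "g (c \<cdot> b) (c \<cdot> b \<cdot> a) = 0"
      using ab x c c1 c2 c3 by auto
    have o': "g b a = 0" "g (a \<cdot> b) a = 0" "g (a \<cdot> b) b = 0"
      "g c a = 0" "g (c \<cdot> a) a = 0" "g (c \<cdot> b) a = 0" "g (c \<cdot> b \<cdot> a) a = 0"
      "g c b = 0" "g (c \<cdot> a) b = 0" "g (c \<cdot> b) b = 0" "g (c \<cdot> b \<cdot> a) b = 0"
      "g c (a \<cdot> b) = 0" "g (c \<cdot> a) (a \<cdot> b) = 0" "g (c \<cdot> b) (a \<cdot> b) = 0" "g (c \<cdot> b \<cdot> a) (a \<cdot> b) = 0"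
      "g (c \<cdot> a) c = 0" "g (c \<cdot> b) c = 0" "g (c \<cdot> b \<cdot> a) c = 0"
      "g (c \<cdot> b) (c \<cdot> a) = 0" "g (c \<cdot> b \<cdot> a) (c \<cdot> a) = 0" "g (c \<cdot> b \<cdot> a) (c \<cdot> b) = 0"
      by ((rule trans[OF g_sym]; (rule o | rule E)?)+)
    show ?thesis unfolding frame_def using o o' by auto
  qed
qed

text \<open>
  The reason that composition algebras stop at dimension eight. If \<open>d\<close> is orthogonal to the frame, all
  products involved anticommute under exchanges of neighbours, and \<open>((a b) c) d\<close> can be rewritten both as
  \<open>(c d) (a b)\<close> and as \<open>(a b) (c d)\<close>. It is therefore zero, and multiplication by \<open>s = (a b) c\<close>, which
  is anisotropic and orthogonal to \<open>d\<close>, is injective on \<open>d\<close>.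
\<close>

lemma triple_complement:
  assumes "triple a b c" "d \<in> E" "\<forall>s\<in>frame a b c. g d s = 0"
  shows "d = 0"
proof -
  have E: "a \<in> E" "b \<in> E" "c \<in> E" "a \<cdot> b \<in> E" "c \<cdot> a \<in> E" "c \<cdot> b \<in> E" "c \<cdot> b \<cdot> a \<in> E" "c \<cdot> d \<in> E"
    "d \<in> E" "a \<cdot> d \<in> E" "a \<cdot> c \<in> E"
    using assms unfolding triple_def by (auto simp: E_mult)
  have o: "g a b = 0" "g a c = 0" "g b c = 0" "g (a \<cdot> b) c = 0"
    using assms unfolding triple_def by auto
  have "g d a = 0" "g d b = 0" "g d c = 0" "g d (a \<cdot> b) = 0" "g d (c \<cdot> a) = 0" "g d (c \<cdot> b) = 0"
    "g d (c \<cdot> b \<cdot> a) = 0" using assms(3) unfolding frame_def by auto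
  then have d: "g a d = 0" "g b d = 0" "g c d = 0" "g (a \<cdot> b) d = 0" "g (c \<cdot> a) d = 0"
    "g (c \<cdot> b) d = 0" "g (c \<cdot> b \<cdot> a) d = 0" using g_sym E by metis+
  have sy: "g b a = 0" "g c a = 0" "g c b = 0" "g d a = 0" "g d b = 0" "g d c = 0"
    using o d g_sym E by metis+
  have cd: "g (c \<cdot> d) a = 0" "g (c \<cdot> d) b = 0"
    using g_mult_swap E d by (metis neg_0_equal_iff_equal)+
  have ca: "g (c \<cdot> a) b = 0" using g_mult_rot[OF E(3,1,2)] o by simp
  define s where "s = a \<cdot> b \<cdot> c"
  have s: "s = - (c \<cdot> b \<cdot> a)"
  proof -
    have "a \<cdot> b \<cdot> c = - (a \<cdot> c \<cdot> b)" using swap_orth E o by blast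
    also have "\<dots> = c \<cdot> a \<cdot> b" using anti_E[OF E(1,3)] by (simp add: mult_lin)
    also have "\<dots> = - (c \<cdot> b \<cdot> a)" using swap_orth E o sy by blast
    finally show ?thesis unfolding s_def .
  qed
  \<comment> \<open>one evaluation of \<open>((a b) c) d\<close>\<close>
  have 1: "s \<cdot> d = (c \<cdot> d) \<cdot> (a \<cdot> b)"
  proof -
    have "c \<cdot> (a \<cdot> b) \<cdot> d = - (c \<cdot> d \<cdot> (a \<cdot> b))"
      using swap_orth[of c "a \<cdot> b" d] E d o g_sym[of c "a \<cdot> b"] by simp
    then show ?thesis using anti_E[OF E(3,4)] unfolding s_def by (simp add: mult_lin)
  qed
  \<comment> \<open>the other one, since \<open>((c d) a) b = ((a b) c) d\<close> as shown next\<close>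
  have 2: "(c \<cdot> d \<cdot> a) \<cdot> b = (a \<cdot> b) \<cdot> (c \<cdot> d)"
  proof -
    have "a \<cdot> (c \<cdot> d) \<cdot> b = - (a \<cdot> b \<cdot> (c \<cdot> d))"
      using swap_orth[of a "c \<cdot> d" b] E cd o g_sym[of a "c \<cdot> d"] by simp
    then show ?thesis using anti_E[OF E(1,8)] by (simp add: mult_lin)
  qed
  have "c \<cdot> d \<cdot> a \<cdot> b = - (c \<cdot> a \<cdot> d \<cdot> b)"
    using swap_orth[of c d a] E d sy by (simp add: mult_lin)
  also have "\<dots> = c \<cdot> a \<cdot> b \<cdot> d"
    using swap_orth[of "c \<cdot> a" d b] E d sy ca by simp
  also have "\<dots> = s \<cdot> d"
    using swap_orth[of c a b] E sy o s by (simp add: mult_lin)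
  finally have "s \<cdot> d = - (s \<cdot> d)" using 1 2 anti_E[OF E(8,4)] by simp
  then have "s \<cdot> d + s \<cdot> d = 0" by (simp only: eq_neg_iff_add_eq_0)
  then have sd: "s \<cdot> d = 0" by (rule cancel2)
  have sE: "s \<in> E" using s E E_neg by simp
  have "d \<cdot> s \<cdot> s = g s s *s d - g d s *s s" using cross E sE by blast
  moreover have "d \<cdot> s = 0" using anti_E[OF sE E(9)] sd by simp
  moreover have "g d s = 0" using s d E g_sym[OF E(9,7)] by (simp add: g_neg_r)
  moreover have "g s s \<noteq> 0" using triple_frame(2)[OF assms(1)] E unfolding s frame_def
    by (simp add: g_neg g_neg_r E_neg)
  ultimately show ?thesis by (simp add: mult_lin)
qed

lemma g_sum: 
  assumes "finite B" "\<And>i. i \<in> B \<Longrightarrow> f i \<in> E" "d \<in> E"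
  shows "(\<Sum>i\<in>B. f i) \<in> E \<and> g (\<Sum>i\<in>B. f i) d = (\<Sum>i\<in>B. g (f i) d)"
  using assms by (induction B rule: finite_induct) (auto simp: g_lin E_cl)

lemma finite_frame: "finite (frame a b c)" unfolding frame_def by simp

lemma frame_expand:
  assumes t: "triple a b c" and d: "d \<in> E"
  shows "d = (\<Sum>s\<in>frame a b c. (g d s / g s s) *s s)"
proof -
  let ?B = "frame a b c"
  let ?e = "\<Sum>s\<in>?B. (g d s / g s s) *s s"
  note f = triple_frame[OF t]
  have e: "?e \<in> E" "\<And>x. x \<in> E \<Longrightarrow> g ?e x = (\<Sum>s\<in>?B. g ((g d s / g s s) *s s) x)"
    using g_sum[OF finite_frame, of a b c "\<lambda>s. (g d s / g s s) *s s"] f(1) E_sc E_0 by blast+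
  have "g (d - ?e) r = 0" if r: "r \<in> ?B" for r
  proof -
    have "g ?e r = (\<Sum>s\<in>?B. g ((g d s / g s s) *s s) r)" using e(2) f(1) r by blast
    also have "\<dots> = (\<Sum>s\<in>?B. if s = r then g d r else 0)"
      using f r by (intro sum.cong) (auto simp: g_sc subset_iff)
    also have "\<dots> = g d r" using r finite_frame by simp
    finally show ?thesis using d e(1) f(1) r by (auto simp: g_diff)
  qed
  then have "d - ?e = 0" using triple_complement[OF t] d e(1) E_diff by blast
  then show ?thesis by simp
qed

lemma frame_induct:
  assumes t: "triple a b c" and S: "subspace S" and "frame a b c \<subseteq> S"
  shows "E \<subseteq> S"
proof
  fix d assume "d \<in> E"
  from frame_expand[OF t this] show "d \<in> S"
    by (metis (no_types, lifting) S assms(3) subsetD subspace_scale subspace_sum)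
qed

abbreviation tri where "tri \<equiv> triple_product scale mult"

lemma tri_E: assumes "a \<in> E" "b \<in> E" "c \<in> E"
  shows "tri a b c = 3 * g a b *s c - 3 * g a c *s b"
proof -
  have "tri a b c = dyad b c a - dyad c b a"
    unfolding triple_product_def dyad_def using anti_E[OF assms(2,3)] g_sym[OF assms(2,3)]
    by (simp add: mult_lin algebra_simps sc23)
  then show ?thesis using assms by (simp add: dyad_E)
qed

lemma dyad_add1: "a \<in> E \<Longrightarrow> a' \<in> E \<Longrightarrow> b \<in> E \<Longrightarrow> dyad (a + a') b m = dyad a b m + dyad a' b m"
  and dyad_sc1: "a \<in> E \<Longrightarrow> b \<in> E \<Longrightarrow> dyad (r *s a) b m = r *s dyad a b m"
  and dyad_add2: "a \<in> E \<Longrightarrow> b \<in> E \<Longrightarrow> b' \<in> E \<Longrightarrow> dyad a (b + b') m = dyad a b m + dyad a b' m"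
  and dyad_sc2: "a \<in> E \<Longrightarrow> b \<in> E \<Longrightarrow> dyad a (r *s b) m = r *s dyad a b m"
  and dyad_add3: "dyad a b (m + m') = dyad a b m + dyad a b m'"
  and dyad_sc3: "dyad a b (r *s m) = r *s dyad a b m"
  unfolding dyad_def by (simp_all add: mult_lin g_lin algebra_simps)

lemma dyad_neg1: "a \<in> E \<Longrightarrow> b \<in> E \<Longrightarrow> dyad (- a) b m = - dyad a b m"
  and dyad_neg2: "a \<in> E \<Longrightarrow> b \<in> E \<Longrightarrow> dyad a (- b) m = - dyad a b m"
  and dyad_neg3: "dyad a b (- m) = - dyad a b m"
  and dyad_0_1: "b \<in> E \<Longrightarrow> dyad 0 b m = 0"
  and dyad_0_2: "a \<in> E \<Longrightarrow> dyad a 0 m = 0"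
  and dyad_0_3: "dyad a b 0 = 0"
  using dyad_sc1[of a b "-1" m] dyad_sc2[of a b "-1" m] dyad_sc3[of a b "-1" m] dyad_sc1[of 0 b 0 m]
    dyad_sc2[of a 0 0 m] dyad_sc3[of a b 0 m] E_0 by simp_all

lemma dyad_diff1: "a \<in> E \<Longrightarrow> a' \<in> E \<Longrightarrow> b \<in> E \<Longrightarrow> dyad (a - a') b m = dyad a b m - dyad a' b m"
  and dyad_diff2: "a \<in> E \<Longrightarrow> b \<in> E \<Longrightarrow> b' \<in> E \<Longrightarrow> dyad a (b - b') m = dyad a b m - dyad a b' m"
  and dyad_diff3: "dyad a b (m - m') = dyad a b m - dyad a b m'"
  using dyad_add1[of a "- a'" b m] dyad_add2[of a b "- b'" m] dyad_add3[of a b m "- m'"]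
  by (simp_all add: dyad_neg1 dyad_neg2 dyad_neg3 E_cl)

lemmas dyad_lin = dyad_add1 dyad_add2 dyad_add3 dyad_sc1 dyad_sc2 dyad_sc3 dyad_neg1 dyad_neg2 dyad_neg3 dyad_0_1 dyad_0_2 dyad_0_3
  dyad_diff1 dyad_diff2 dyad_diff3

text \<open>
  Many identities below are obtained after division by \<open>g(x,x)\<close>. An isotropic \<open>x\<close> is reached along the
  line \<open>x + r w\<close>: among \<open>r = 1, -1, 2\<close> at most one value makes \<open>x + r w\<close> isotropic, and two others
  determine the linear function \<open>q(x,x) + r h\<close> of \<open>r\<close>.
\<close>

lemma alternating_if_anisotropic:
  fixes q :: "'m \<Rightarrow> 'm \<Rightarrow> 'm"
  assumes add1: "\<And>x y z. x \<in> E \<Longrightarrow> y \<in> E \<Longrightarrow> z \<in> E \<Longrightarrow> q (x + y) z = q x z + q y z"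
    and add2: "\<And>x y z. x \<in> E \<Longrightarrow> y \<in> E \<Longrightarrow> z \<in> E \<Longrightarrow> q z (x + y) = q z x + q z y"
    and sc1: "\<And>x y r. x \<in> E \<Longrightarrow> y \<in> E \<Longrightarrow> q (r *s x) y = r *s q x y"
    and sc2: "\<And>x y r. x \<in> E \<Longrightarrow> y \<in> E \<Longrightarrow> q y (r *s x) = r *s q y x"
    and alt: "\<And>x. x \<in> E \<Longrightarrow> g x x \<noteq> 0 \<Longrightarrow> q x x = 0"
    and w: "w \<in> E" "g w w \<noteq> 0" and x: "x \<in> E"
  shows "q x x = 0"
proof (cases "g x x = 0")
  case False then show ?thesis using alt x by blast
next
  case True
  define h where "h = q x w + q w x"
  have q: "q x x + r *s h = 0" if "r * (2 * g x w + r * g w w) \<noteq> 0" for r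
  proof -
    have e: "x + r *s w \<in> E" using x w E_cl by blast
    have "g (x + r *s w) (x + r *s w) = r * (2 * g x w + r * g w w)"
      using x w True g_sym[OF w(1) x] by (simp add: g_lin E_cl algebra_simps)
    then have "q (x + r *s w) (x + r *s w) = 0" using that alt e by metis
    moreover have "q (x + r *s w) (x + r *s w) = q x x + r *s h + (r * r) *s q w w"
      unfolding h_def using x w by (simp add: add1 add2 sc1 sc2 E_cl algebra_simps)
    ultimately show ?thesis using alt w by simp
  qed
  have ne: "r \<noteq> s \<Longrightarrow> \<not> (2 * g x w + r * g w w = 0 \<and> 2 * g x w + s * g w w = 0)" for r s
    using w(2) by (metis add_left_cancel mult_cancel_right)
  have fin: "q x x = 0" if "q x x + r *s h = 0" "q x x + s *s h = 0" "r \<noteq> s" for r s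
  proof -
    have "(r - s) *s h = (q x x + r *s h) - (q x x + s *s h)" by (simp add: scale_left_diff_distrib)
    then have "h = 0" using that by simp
    then show ?thesis using that by simp
  qed
  have d: "(1::'f) \<noteq> -1" "(1::'f) \<noteq> 2" "(-1::'f) \<noteq> 2" "(2::'f) \<noteq> 0"
  proof -
    show "(1::'f) \<noteq> -1" "(-1::'f) \<noteq> 2" "(2::'f) \<noteq> 0"
      using two three by (auto simp: eq_neg_iff_add_eq_0 neg_eq_iff_add_eq_0)
    show "(1::'f) \<noteq> 2" by (metis add_cancel_right_left one_add_one zero_neq_one)
  qed
  have "2 * g x w + 1 * g w w \<noteq> 0 \<and> 2 * g x w + (-1) * g w w \<noteq> 0 \<or>
     2 * g x w + 2 * g w w \<noteq> 0 \<and> 2 * g x w + 1 * g w w \<noteq> 0 \<or>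
     2 * g x w + 2 * g w w \<noteq> 0 \<and> 2 * g x w + (-1) * g w w \<noteq> 0"
    using ne[OF d(1)] ne[OF d(2)] ne[OF d(3)] by blast
  moreover have "q x x + r *s h = 0" if "2 * g x w + r * g w w \<noteq> 0" "r \<noteq> 0" for r
    using q that by simp
  ultimately show ?thesis
    using fin[of 1 "-1"] fin[of 2 1] fin[of 2 "-1"] d by (metis neg_equal_0_iff_equal one_neq_zero)
qed

end

section \<open>The action of the exceptional algebra\<close>

text \<open>
  The identity \<open>h\<close> with two arbitrary arguments \<open>n, m\<close> in the positions of \<open>y\<close> and \<open>t\<close>. In these positions
  all its signs are trivial when the other three arguments are even.
\<close>

locale exceptional_action = cross_action scale mult E g
  for scale :: "'f::field \<Rightarrow> 'm::ab_group_add \<Rightarrow> 'm" (infixr "*s" 69)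
    and mult :: "'m \<Rightarrow> 'm \<Rightarrow> 'm" (infixl "\<cdot>" 80) and E and g +
  fixes e1 e2 e3 :: 'm
  assumes h_identity: "z \<in> E \<Longrightarrow> x \<in> E \<Longrightarrow> u \<in> E \<Longrightarrow>
      tri (n \<cdot> z) m u \<cdot> x + tri (n \<cdot> z) m x \<cdot> u + tri (n \<cdot> x) z u \<cdot> m + tri (n \<cdot> u) z x \<cdot> m = 0"
    and triple: "triple e1 e2 e3"
begin

lemma e_E: "e1 \<in> E" "e2 \<in> E" "e3 \<in> E"
  and n1: "g e1 e1 \<noteq> 0"
  using triple unfolding triple_def by auto

text \<open>
  This is the identity \<open>h\<close> with \<open>v\<close> in the position of \<open>t\<close>: the first two terms are dyads applied to \<open>v\<close>,
  up to multiples of \<open>v\<close>, and the last two only contain values of \<open>g\<close>, which cancel these multiples.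
\<close>

lemma dyad_skew_product:
  assumes E: "y \<in> E" "z \<in> E" "b \<in> E" "c \<in> E"
  shows "dyad (y \<cdot> z) b v \<cdot> c = - (dyad (y \<cdot> z) c v \<cdot> b)"
proof -
  define a where "a = y \<cdot> z"
  have a: "a \<in> E" unfolding a_def using E E_mult by blast
  have T: "tri a v b = dyad a b v - 3 * g a b *s v" if "b \<in> E" for b
    unfolding triple_product_def dyad_def using anticomm[OF a] anticomm[OF E_mult[OF a that]] 
    by (simp add: mult_lin algebra_simps sc23)
  have 1: "g (y \<cdot> b) z = - g a b" "g (y \<cdot> c) z = - g a c" "g (y \<cdot> b) c = - g (y \<cdot> c) b"
    unfolding a_def using g_mult_swap E by blast+
  have "tri (y \<cdot> c) z b \<cdot> v = - (v \<cdot> tri (y \<cdot> c) z b)" "tri (y \<cdot> b) z c \<cdot> v = - (v \<cdot> tri (y \<cdot> b) z c)"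
    by (rule anticomm, use E in \<open>simp add: tri_E E_cl\<close>)+
  then have 2: "tri (y \<cdot> c) z b \<cdot> v + tri (y \<cdot> b) z c \<cdot> v = 3 * g a c *s (v \<cdot> b) + 3 * g a b *s (v \<cdot> c)"
    using E 1 by (simp add: tri_E E_cl mult_lin algebra_simps)
  have "tri a v b \<cdot> c + tri a v c \<cdot> b + tri (y \<cdot> c) z b \<cdot> v + tri (y \<cdot> b) z c \<cdot> v = 0"
    unfolding a_def using h_identity[OF E(2,4,3)] .
  then have "(dyad a b v - 3 * g a b *s v) \<cdot> c + (dyad a c v - 3 * g a c *s v) \<cdot> b
      + (3 * g a c *s (v \<cdot> b) + 3 * g a b *s (v \<cdot> c)) = 0"
    using 2 T[OF E(3)] T[OF E(4)] by (simp add: add.assoc)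
  then show ?thesis unfolding a_def[symmetric]
    by (simp add: mult_lin eq_neg_iff_add_eq_0)
qed

text \<open>
  \<open>E\<close> is spanned by products, since a frame vector \<open>s\<close> is a multiple of \<open>(s r) r\<close> for each other \<open>r\<close>.
\<close>

lemma product_induct:
  assumes S: "subspace S" and p: "\<And>y z. y \<in> E \<Longrightarrow> z \<in> E \<Longrightarrow> y \<cdot> z \<in> S"
  shows "E \<subseteq> S"
proof -
  obtain a b c where t: "triple a b c" using triple by blast
  note f = triple_frame[OF t]
  have ab: "a \<in> frame a b c" "b \<in> frame a b c" "g a a \<noteq> 0" "g b b \<noteq> 0" "g a b = 0"
    using t unfolding frame_def triple_def by auto
  have "s \<in> S" if s: "s \<in> frame a b c" for s
  proof -
    obtain r where r: "r \<in> frame a b c" "r \<noteq> s" using ab by metis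
    have E: "s \<in> E" "r \<in> E" and "g s r = 0" "g r r \<noteq> 0" using f s r by auto
    then have "s \<cdot> r \<cdot> r = g r r *s s" by (simp add: cross)
    then have "s = (1 / g r r) *s (s \<cdot> r \<cdot> r)" using \<open>g r r \<noteq> 0\<close> by simp
    then show ?thesis using p[of "s \<cdot> r" r] E E_mult subspace_scale[OF S] by metis
  qed
  then show ?thesis using frame_induct[OF t S] by blast
qed

lemma dyad_skew:
  assumes "a \<in> E" "b \<in> E" "c \<in> E"
  shows "dyad a b v \<cdot> c = - (dyad a c v \<cdot> b)"
proof -
  let ?S = "{a \<in> E. dyad a b v \<cdot> c + dyad a c v \<cdot> b = 0}"
  have "subspace ?S" unfolding subspace_def using assms
    by (auto simp: E_cl dyad_lin mult_lin algebra_simps simp flip: scale_right_distrib)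
  moreover have "y \<cdot> z \<in> ?S" if "y \<in> E" "z \<in> E" for y z
    using dyad_skew_product[OF that assms(2,3)] E_mult[OF that] by simp
  ultimately have "E \<subseteq> ?S" by (rule product_induct)
  then show ?thesis using assms by (auto simp: eq_neg_iff_add_eq_0)
qed

lemma dyad_self: "a \<in> E \<Longrightarrow> b \<in> E \<Longrightarrow> dyad a b v \<cdot> b = 0"
  using dyad_skew[of a b b v] cancel2[of "dyad a b v \<cdot> b"] by (simp only: eq_neg_iff_add_eq_0)

lemma cube: assumes "a \<in> E" shows "v \<cdot> a \<cdot> a \<cdot> a = g a a *s (v \<cdot> a)"
proof -
  let ?x = "g a a *s (v \<cdot> a) - v \<cdot> a \<cdot> a \<cdot> a"
  have "dyad a a v \<cdot> a = 0" using dyad_self assms by blast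
  moreover have "dyad a a v \<cdot> a = ?x + ?x + ?x"
    unfolding dyad_def using assms by (simp add: mult_lin square_0 algebra_simps sc23)
  ultimately show ?thesis using cancel3[of ?x] by simp
qed

text \<open>
  The obstruction to \<open>b \<mapsto> dyad a b m\<close> being a homomorphism of \<open>E\<close>-modules.
\<close>

definition defect where "defect a b c m = dyad a b m \<cdot> c - dyad a (b \<cdot> c) m"

lemma defect_lin1: "a \<in> E \<Longrightarrow> a' \<in> E \<Longrightarrow> b \<in> E \<Longrightarrow> c \<in> E \<Longrightarrow> defect (a + a') b c m = defect a b c m + defect a' b c m"
  "a \<in> E \<Longrightarrow> b \<in> E \<Longrightarrow> c \<in> E \<Longrightarrow> defect (r *s a) b c m = r *s defect a b c m"
  unfolding defect_def by (simp_all add: dyad_lin mult_lin E_cl algebra_simps)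

lemma defect_lin2: "a \<in> E \<Longrightarrow> b \<in> E \<Longrightarrow> b' \<in> E \<Longrightarrow> c \<in> E \<Longrightarrow> defect a (b + b') c m = defect a b c m + defect a b' c m"
  "a \<in> E \<Longrightarrow> b \<in> E \<Longrightarrow> c \<in> E \<Longrightarrow> defect a (r *s b) c m = r *s defect a b c m"
  unfolding defect_def by (simp_all add: dyad_lin mult_lin E_cl algebra_simps)

lemma defect_lin3: "a \<in> E \<Longrightarrow> b \<in> E \<Longrightarrow> c \<in> E \<Longrightarrow> c' \<in> E \<Longrightarrow> defect a b (c + c') m = defect a b c m + defect a b c' m"
  "a \<in> E \<Longrightarrow> b \<in> E \<Longrightarrow> c \<in> E \<Longrightarrow> defect a b (r *s c) m = r *s defect a b c m"
  unfolding defect_def by (simp_all add: dyad_lin mult_lin E_cl algebra_simps)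

lemma defect_swap23: "a \<in> E \<Longrightarrow> b \<in> E \<Longrightarrow> c \<in> E \<Longrightarrow> defect a c b m = - defect a b c m"
  unfolding defect_def using dyad_skew[of a b c m] anti_E[of b c] by (simp add: dyad_lin E_mult)

text \<open>
  Write the defect in two ways, once with \<open>dyad a a m \<cdot> c\<close> expanded and once with \<open>- dyad a c m \<cdot> a\<close>
  expanded. After reduction by the Malcev identity all cubic terms of the sum cancel.
\<close>

lemma defect_aac: assumes "a \<in> E" "c \<in> E" shows "defect a a c m = 0"
proof -
  have s1: "m \<cdot> a \<cdot> (a \<cdot> c) = m \<cdot> a \<cdot> a \<cdot> c - m \<cdot> c \<cdot> a \<cdot> a - m \<cdot> (a \<cdot> c) \<cdot> a"
    using sagle[of a a c m] assms by (simp add: square_0 mult_lin)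
  have s2: "m \<cdot> a \<cdot> c \<cdot> a = m \<cdot> a \<cdot> a \<cdot> c + m \<cdot> (a \<cdot> c \<cdot> a) - m \<cdot> (a \<cdot> c) \<cdot> a"
    using sagle[of a c a m] anti_E[OF assms] assms by (simp add: square_0 mult_lin algebra_simps)
  have h: "dyad a a m \<cdot> c = - (dyad a c m \<cdot> a)" using dyad_skew assms by blast
  have c: "m \<cdot> (a \<cdot> (a \<cdot> c)) = - (m \<cdot> (a \<cdot> c \<cdot> a))"
    using anti_E[of "a \<cdot> c" a] assms by (simp add: mult_lin E_cl)
  have e: "m \<cdot> (a \<cdot> c \<cdot> a) = g a c *s (m \<cdot> a) - g a a *s (m \<cdot> c)"
    using cross'(3)[OF assms(2,1)] g_sym[OF assms] by (simp add: mult_lin)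
  have o: "g a (a \<cdot> c) = 0" using g_mult_self' assms g_sym E_mult by metis
  have k1: "defect a a c m = dyad a a m \<cdot> c - dyad a (a \<cdot> c) m" "defect a a c m = - (dyad a c m \<cdot> a) - dyad a (a \<cdot> c) m"
    unfolding defect_def h by simp_all
  have "defect a a c m + defect a a c m = 0"
    apply (subst k1(1), subst k1(2))
    unfolding dyad_def mult_lin o c e
    apply (simp add: mult_lin assms square_0 s1 s2 e)
    apply (simp add: algebra_simps sc23)
    done
  then show ?thesis by (rule cancel2)
qed

lemma triple_last:
  assumes t: "triple a b c" and s: "s \<in> {a, b, b \<cdot> a, c, c \<cdot> a, c \<cdot> b, c \<cdot> b \<cdot> a}"
  shows "\<exists>x y. triple x y s"
proof -
  have 1: "triple c b a" "triple c a b" "triple a c b" using t triple_swap triple_swap' by blast+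
  have 2: "triple a b (c \<cdot> a)" "triple a b (c \<cdot> b)" using t triple_mult triple_mult' by blast+
  have 3: "triple a b (c \<cdot> b \<cdot> a)" "triple a c (b \<cdot> a)" using 1 2 triple_mult by blast+
  show ?thesis using s t 1 2 3 by (elim insertE emptyE) (simp, blast)+
qed

lemma defect_swap12: assumes "a \<in> E" "b \<in> E" "c \<in> E" shows "defect b a c m = - defect a b c m"
proof -
  have "defect a (a + b) c m + defect b (a + b) c m = 0"
    using defect_aac[of "a + b" c m] defect_lin1(1)[of a b "a + b" c m] assms E_add by metis
  then have "defect a b c m + defect b a c m = 0"
    using assms by (simp add: defect_lin2 defect_aac)
  then show ?thesis by (simp add: add_eq_0_iff2 add.commute)
qed

text \<open>
  Put \<open>y = dyad a b m\<close>, so that \<open>y b = 0\<close>. Applying \<open>dyad_self\<close> to \<open>y\<close> gives \<open>y c b b = y (c b) b\<close>; when both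
  sides are expressed by dyads and defects, everything cancels except the defect.
\<close>

lemma defect_bb: assumes "a \<in> E" "b \<in> E" "c \<in> E" shows "defect a b c m \<cdot> b \<cdot> b = 0"
proof -
  define y where "y = dyad a b m"
  have yb: "y \<cdot> b = 0" unfolding y_def using dyad_self assms by blast
  have "dyad c b y \<cdot> b = 0" using dyad_self assms by blast
  then have 1: "y \<cdot> c \<cdot> b \<cdot> b = y \<cdot> (c \<cdot> b) \<cdot> b" unfolding dyad_def by (simp add: mult_lin yb)
  have bc: "b \<cdot> c = - (c \<cdot> b)" using anti_E assms by blast
  have e: "b \<cdot> (c \<cdot> b) = b \<cdot> c \<cdot> b" using anticomm[OF assms(2), of "c \<cdot> b"] bc by (simp add: mult_lin)
  have "y \<cdot> (c \<cdot> b) = dyad a (b \<cdot> (c \<cdot> b)) m + defect a b (c \<cdot> b) m" unfolding defect_def y_def by simp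
  also have "defect a b (c \<cdot> b) m = defect a (b \<cdot> c) b m"
    using defect_swap23[of a "c \<cdot> b" b] bc defect_lin2(2)[of a "c \<cdot> b" b "-1"] assms by (simp add: E_mult)
  also have "dyad a (b \<cdot> (c \<cdot> b)) m + defect a (b \<cdot> c) b m = dyad a (b \<cdot> c) m \<cdot> b" unfolding defect_def e by simp
  finally have "y \<cdot> c \<cdot> b \<cdot> b = dyad a (b \<cdot> c) m \<cdot> b \<cdot> b" using 1 by simp
  moreover have "y \<cdot> c = dyad a (b \<cdot> c) m + defect a b c m" unfolding defect_def y_def by simp
  ultimately show ?thesis by (simp add: mult_lin)
qed

text \<open>
  By \<open>cube\<close>, the operator \<open>R\<^sub>b\<close> is invertible on the image of \<open>R\<^sub>b\<close> for anisotropic \<open>b\<close>, so \<open>defect_bb\<close> can be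
  divided by \<open>R\<^sub>b\<close>.
\<close>

lemma defect_kill2: assumes "a \<in> E" "b \<in> E" "c \<in> E" shows "defect a b c m \<cdot> b = 0"
proof -
  have z: "defect a x c m \<cdot> x = 0" if "x \<in> E" "g x x \<noteq> 0" for x
    using cube[OF that(1), of "defect a x c m"] defect_bb[OF assms(1) that(1) assms(3)] that by (simp add: mult_lin)
  show ?thesis
    by (rule alternating_if_anisotropic[where q = "\<lambda>x y. defect a x c m \<cdot> y", OF _ _ _ _ z e_E(1) n1 assms(2)])
      (use assms in \<open>simp_all add: defect_lin2 mult_lin\<close>)
qed

lemma defect_kill1: assumes "a \<in> E" "b \<in> E" "c \<in> E" shows "defect a b c m \<cdot> a = 0"
  using defect_kill2[OF assms(2,1,3), of m] defect_swap12[OF assms, of m] by (simp add: mult_lin)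

lemma defect_kill3: assumes "a \<in> E" "b \<in> E" "c \<in> E" shows "defect a b c m \<cdot> c = 0"
  using defect_kill2[OF assms(1,3,2), of m] defect_swap23[OF assms, of m] by (simp add: mult_lin)

lemma defect_swap34: assumes "a \<in> E" "b \<in> E" "c \<in> E" "d \<in> E" 
  shows "defect a b c m \<cdot> d = - (defect a b d m \<cdot> c)"
proof -
  have "(defect a b c m + defect a b d m) \<cdot> (c + d) = 0"
    using defect_kill3[of a b "c + d" m] defect_lin3(1)[of a b c d m] assms E_add by metis
  then have "defect a b c m \<cdot> d + defect a b d m \<cdot> c = 0"
    using assms by (simp add: defect_kill3 mult_lin add.commute)
  then show ?thesis by (simp only: eq_neg_iff_add_eq_0)
qed

text \<open>
  If \<open>a\<close> annihilates \<open>p\<close>, the relations \<open>dyad y a p \<cdot> a = 0\<close> and \<open>dyad a a p \<cdot> y = - dyad a y p \<cdot> a\<close>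
  combine to \<open>p (a y) a = - g(a,a) p y\<close>. Replacing \<open>y\<close> by \<open>a y\<close> turns this into the claim.
\<close>

lemma kill_mult:
  assumes a: "a \<in> E" "g a a \<noteq> 0" and y: "y \<in> E" and pa: "p \<cdot> a = 0"
  shows "p \<cdot> y \<cdot> a = - (p \<cdot> (a \<cdot> y))"
proof -
  have 1: "p \<cdot> (a \<cdot> y) \<cdot> a = - (g a a *s (p \<cdot> y))" if y: "y \<in> E" for y
  proof -
    let ?n = "g a a *s (p \<cdot> y)"
    have "dyad y a p \<cdot> a = 0" using dyad_self a y by blast
    then have "- (p \<cdot> y \<cdot> a \<cdot> a) = p \<cdot> (a \<cdot> y) \<cdot> a"
      unfolding dyad_def using anti_E[OF a(1) y] by (simp add: mult_lin pa)
    then have e1: "p \<cdot> y \<cdot> a \<cdot> a = - (p \<cdot> (a \<cdot> y) \<cdot> a)" by (metis minus_minus)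
    have "dyad a a p \<cdot> y = - (dyad a y p \<cdot> a)" using dyad_skew a y by blast
    then have "?n + ?n + ?n = - (p \<cdot> (a \<cdot> y) \<cdot> a) - (p \<cdot> (a \<cdot> y) \<cdot> a) - (p \<cdot> (a \<cdot> y) \<cdot> a)"
      unfolding dyad_def using a by (simp add: mult_lin pa square_0 e1 sc23)
    then have "(?n + p \<cdot> (a \<cdot> y) \<cdot> a) + (?n + p \<cdot> (a \<cdot> y) \<cdot> a) + (?n + p \<cdot> (a \<cdot> y) \<cdot> a) = 0"
      by (simp add: algebra_simps)
    then have "?n + p \<cdot> (a \<cdot> y) \<cdot> a = 0" by (rule cancel3)
    then show ?thesis by (simp add: eq_neg_iff_add_eq_0 add.commute)
  qed
  have "p \<cdot> (a \<cdot> (a \<cdot> y)) \<cdot> a = - (g a a *s (p \<cdot> (a \<cdot> y)))" using 1 a y E_mult by blast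
  moreover have "p \<cdot> (a \<cdot> (a \<cdot> y)) \<cdot> a = g a a *s (p \<cdot> y \<cdot> a)"
    using cross'(2)[OF y a(1)] by (simp add: mult_lin pa)
  ultimately have "g a a *s (p \<cdot> y \<cdot> a + p \<cdot> (a \<cdot> y)) = 0" by (simp add: scale_right_distrib)
  then have "p \<cdot> y \<cdot> a + p \<cdot> (a \<cdot> y) = 0" using a by simp
  then show ?thesis by (simp add: eq_neg_iff_add_eq_0)
qed

lemma kill_product:
  assumes "a \<in> E" "g a a \<noteq> 0" "y \<in> E" "p \<cdot> a = 0" "p \<cdot> y = 0"
  shows "p \<cdot> (a \<cdot> y) = 0" "p \<cdot> (y \<cdot> a) = 0"
  using kill_mult[OF assms(1-4)] assms(5) anti_E[OF assms(1,3)] by (simp_all add: mult_lin)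

lemma subspace_kill: "subspace {d. p \<cdot> d = 0}"
  unfolding subspace_def by (simp add: mult_lin)

text \<open>
  The annihilator of the defect contains \<open>a, b, c\<close> and is closed under the products in
  \<open>kill_product\<close>, so it contains the whole frame; faithfulness of the action applies.
\<close>

lemma defect_triple: assumes "triple a b c" shows "defect a b c m = 0"
proof (rule faithful)
  let ?p = "defect a b c m"
  have E: "a \<in> E" "b \<in> E" "c \<in> E" "c \<cdot> b \<in> E" and n: "g a a \<noteq> 0" "g b b \<noteq> 0"
    using assms unfolding triple_def by (auto simp: E_mult)
  have abc: "?p \<cdot> a = 0" "?p \<cdot> b = 0" "?p \<cdot> c = 0" using defect_kill1 defect_kill2 defect_kill3 E by blast+
  then have "?p \<cdot> (a \<cdot> b) = 0" "?p \<cdot> (c \<cdot> a) = 0" "?p \<cdot> (c \<cdot> b) = 0"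
    using kill_product E n by blast+
  moreover from this have "?p \<cdot> (c \<cdot> b \<cdot> a) = 0" using kill_product E n abc by blast
  ultimately have "frame a b c \<subseteq> {d. ?p \<cdot> d = 0}" unfolding frame_def using abc by auto
  then show "?p \<cdot> d = 0" if "d \<in> E" for d using frame_induct[OF assms subspace_kill] that by blast
qed

text \<open>
  Here \<open>a, b, a b\<close> do not generate \<open>E\<close>, but skewness moves an arbitrary \<open>d\<close> into the defect and \<open>a b\<close> out
  of it, where it annihilates because \<open>a\<close> and \<open>b\<close> do.
\<close>

lemma defect_line: assumes "a \<in> E" "b \<in> E" "g a a \<noteq> 0" shows "defect a b (a \<cdot> b) m = 0"
proof (rule faithful)
  fix d assume d: "d \<in> E"
  have "defect a b d m \<cdot> (a \<cdot> b) = 0" 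
    by (rule kill_product(1)[OF assms(1,3,2) defect_kill1[OF assms(1,2) d] defect_kill2[OF assms(1,2) d]])
  then show "defect a b (a \<cdot> b) m \<cdot> d = 0" using defect_swap34[of a b "a \<cdot> b" d m] assms d E_mult by simp
qed

text \<open>
  The defect is trilinear, so frame vectors suffice. They are treated one argument at a time, here and
  in the next two lemmas: any two distinct frame vectors belong to a common triple.
\<close>

lemma defect_pair: assumes t: "triple a b z" and c: "c \<in> E" shows "defect a b c m = 0"
proof -
  have E: "a \<in> E" "b \<in> E" "g a a \<noteq> 0" using t unfolding triple_def by auto
  let ?S = "{c \<in> E. defect a b c m = 0}"
  have "subspace ?S" unfolding subspace_def using E defect_lin3(2)[of a b 0 0]
    by (auto simp: E_cl defect_lin3)
  moreover have "frame a b z \<subseteq> ?S"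
  proof -
    have "defect a b a m = 0" "defect a b b m = 0"
      using defect_swap23[of a a b m] defect_aac[of a b m] defect_swap12[of b a b m] defect_swap23[of b b a m] defect_aac[of b a m] E
      by simp_all
    moreover have "defect a b (a \<cdot> b) m = 0" using defect_line E by blast
    moreover have "defect a b s m = 0" if "s \<in> {z, z \<cdot> a, z \<cdot> b, z \<cdot> b \<cdot> a}" for s
      using that t triple_mult triple_mult' defect_triple by blast
    ultimately show ?thesis unfolding frame_def using triple_frame(1)[OF t] unfolding frame_def by auto
  qed
  ultimately show ?thesis using frame_induct[OF t] c by blast
qed

lemma defect_first: assumes t: "triple a y z" and b: "b \<in> E" and c: "c \<in> E" shows "defect a b c m = 0"
proof -
  have E: "a \<in> E" using t unfolding triple_def by auto
  let ?S = "{b \<in> E. defect a b c m = 0}"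
  have "subspace ?S" unfolding subspace_def using E c defect_lin2(2)[of a 0 c 0]
    by (auto simp: E_cl defect_lin2)
  moreover have "frame a y z \<subseteq> ?S"
  proof -
    have "defect a s c m = 0" if s: "s \<in> {y, y \<cdot> a, z, z \<cdot> a, z \<cdot> y, z \<cdot> y \<cdot> a}" for s
    proof -
      have 1: "triple a z y" "triple a z (y \<cdot> a)" using t triple_swap' triple_mult by blast+
      have 2: "triple a y (z \<cdot> a)" "triple a y (z \<cdot> y)" using t triple_mult triple_mult' by blast+
      have "triple a y (z \<cdot> y \<cdot> a)" using 2 triple_mult by blast
      then have "\<exists>w. triple a w s" using s t 1 2 by (elim insertE emptyE) (simp, blast)+
      then have "\<exists>w. triple a s w" using triple_swap' by blast
      then show ?thesis using defect_pair c by blast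
    qed
    moreover have "defect a (a \<cdot> y) c m = - defect a (y \<cdot> a) c m"
      using anti_E[of y a] defect_lin2(2)[of a "y \<cdot> a" c "-1"] t c unfolding triple_def by (simp add: E_mult)
    ultimately show ?thesis using triple_frame(1)[OF t] defect_aac[OF E c] unfolding frame_def by auto
  qed
  ultimately show ?thesis using frame_induct[OF t] b by blast
qed

lemma defect_zero: assumes a: "a \<in> E" and b: "b \<in> E" and c: "c \<in> E" shows "defect a b c m = 0"
proof -
  obtain x y z where t: "triple x y z" using triple by blast
  let ?S = "{a \<in> E. defect a b c m = 0}"
  have "subspace ?S" unfolding subspace_def using b c defect_lin1(2)[of 0 b c 0]
    by (auto simp: E_cl defect_lin1)
  moreover have "frame x y z \<subseteq> ?S"
  proof -
    have "defect s b c m = 0" if s: "s \<in> {x, y, y \<cdot> x, z, z \<cdot> x, z \<cdot> y, z \<cdot> y \<cdot> x}" for s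
    proof -
      have "\<exists>v w. triple v w s" using triple_last t s by blast
      then have "\<exists>v w. triple s v w" using triple_swap triple_swap' by blast
      then show ?thesis using defect_first b c by blast
    qed
    moreover have "defect (x \<cdot> y) b c m = - defect (y \<cdot> x) b c m"
      using anti_E[of y x] defect_lin1(2)[of "y \<cdot> x" b c "-1"] t b c unfolding triple_def by (simp add: E_mult)
    ultimately show ?thesis using triple_frame(1)[OF t] unfolding frame_def by auto
  qed
  ultimately show ?thesis using frame_induct[OF t] a by blast
qed

lemma dyad_mult: "a \<in> E \<Longrightarrow> b \<in> E \<Longrightarrow> c \<in> E \<Longrightarrow> dyad a b m \<cdot> c = dyad a (b \<cdot> c) m"
  using defect_zero[of a b c m] unfolding defect_def by simp

lemma dyad_dyad: 
  assumes "a \<in> E" "b \<in> E" "c \<in> E" "d \<in> E" 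
  shows "dyad c d (dyad a b m) = (3 * g b c) *s dyad a d m"
proof -
  have "dyad c d (dyad a b m) = dyad a (dyad c d b) m"
    using assms by (simp add: dyad_def[of c d] dyad_mult E_cl dyad_lin)
  then show ?thesis using assms by (simp add: dyad_E dyad_lin)
qed

text \<open>
  On \<open>E\<close> this is the expansion in an orthogonal basis. Let \<open>w\<close> be the difference of the two sides. Every dyad
  annihilates \<open>w\<close>, which means that \<open>w x y = g(x,y) w - w (x y)\<close>. Substituting this
  rule into the Malcev identity yields
  \<open>w ((z u) y) = w (g(u,y) z - g(y,z) u)\<close>, the right side of which vanishes for orthogonal
  arguments. So the frame, and hence \<open>E\<close>, annihilates \<open>w\<close>.
\<close>

lemma dyad_expand: 
  assumes t: "triple a b c" 
  shows "m = (\<Sum>s\<in>frame a b c. (1 / (3 * g s s)) *s dyad s s m)"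
proof -
  let ?B = "frame a b c"
  define w where "w = m - (\<Sum>s\<in>?B. (1 / (3 * g s s)) *s dyad s s m)"
  note f = triple_frame[OF t] 
  have P3: "dyad x y (\<Sum>s\<in>A. h s) = (\<Sum>s\<in>A. dyad x y (h s))" if "finite A" for x y A h
    using that by (induction A rule: finite_induct) (auto simp: dyad_lin)
  have P1: "(\<Sum>s\<in>A. r s *s s) \<in> E \<and> dyad (\<Sum>s\<in>A. r s *s s) y v = (\<Sum>s\<in>A. r s *s dyad s y v)" 
    if "finite A" "A \<subseteq> E" "y \<in> E" for A r y v
    using that by (induction A rule: finite_induct) (auto simp: dyad_lin E_cl)
  have Pw: "dyad x y w = 0" if xy: "x \<in> E" "y \<in> E" for x y
  proof -
    have "dyad x y (\<Sum>s\<in>?B. (1 / (3 * g s s)) *s dyad s s m) = (\<Sum>s\<in>?B. (g x s / g s s) *s dyad s y m)"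
      unfolding P3[OF finite_frame]
    proof (rule sum.cong[OF refl])
      fix s assume s: "s \<in> ?B"
      then have "s \<in> E" using f by blast
      then show "dyad x y ((1 / (3 * g s s)) *s dyad s s m) = (g x s / g s s) *s dyad s y m"
        using xy three by (simp add: dyad_lin dyad_dyad g_sym[of s x])
    qed
    also have "\<dots> = dyad (\<Sum>s\<in>?B. (g x s / g s s) *s s) y m"
      using P1[OF finite_frame f(1) xy(2)] by simp
    also have "\<dots> = dyad x y m" using frame_expand[OF t xy(1)] by simp
    finally show ?thesis unfolding w_def by (simp add: dyad_lin)
  qed
  \<comment> \<open>subtracting twice the transposed dyad removes \<open>w y x\<close>\<close>
  have w2: "w \<cdot> x \<cdot> y = g x y *s w - w \<cdot> (x \<cdot> y)" if xy: "x \<in> E" "y \<in> E" for x y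
  proof -
    let ?d = "w \<cdot> x \<cdot> y - (g x y *s w - w \<cdot> (x \<cdot> y))"
    have "2 *s dyad y x w - dyad x y w = 0" using Pw xy by simp
    moreover have "2 *s dyad y x w - dyad x y w = - (?d + ?d + ?d)"
      unfolding dyad_def using anti_E[OF xy] g_sym[OF xy]
      by (simp add: mult_lin algebra_simps sc23)
    ultimately have "?d + ?d + ?d = 0" by (metis neg_equal_0_iff_equal)
    from cancel3[OF this] show ?thesis by simp
  qed
  have w3: "w \<cdot> ((z \<cdot> u) \<cdot> y) = w \<cdot> (g u y *s z - g y z *s u)" 
    if E: "y \<in> E" "z \<in> E" "u \<in> E" for y z u
  proof -
    have e: "g z (y \<cdot> u) = - g (y \<cdot> z) u" "g (u \<cdot> y) z = g (y \<cdot> z) u" "g (z \<cdot> u) y = g (y \<cdot> z) u"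
      using E g_mult_rot[of u y z] g_mult_rot[of y z u] g_mult_swap[of y z u] g_sym[of z "y \<cdot> u"] 
      by (simp_all add: E_mult)
    have z: "z \<cdot> (y \<cdot> u) = u \<cdot> y \<cdot> z" 
      using anti_E[of "y \<cdot> u" z] anti_E[of y u] E by (simp add: mult_lin E_mult)
    have "w \<cdot> z \<cdot> (y \<cdot> u) = w \<cdot> y \<cdot> z \<cdot> u - w \<cdot> u \<cdot> y \<cdot> z - w \<cdot> ((y \<cdot> z) \<cdot> u) - w \<cdot> (z \<cdot> u) \<cdot> y"
      using sagle E by blast
    then show ?thesis using E g_sym[of u y] g_sym[of z y]
      by (simp add: w2 E_cl mult_lin e z algebra_simps)
  qed
  have "w = 0"
  proof (rule faithful)
    have a: "w \<cdot> s = 0" if tr: "triple x y s" for x y s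
    proof -
      have E: "x \<in> E" "y \<in> E" "s \<in> E" and o: "g x y = 0" "g x s = 0" "g y s = 0" "g (x \<cdot> y) s = 0"
        and n: "g x x \<noteq> 0" "g y y \<noteq> 0" using tr unfolding triple_def by auto
      have o': "g s x = 0" "g y x = 0" using o g_sym E by metis+
      have "g (s \<cdot> x) y = 0" using g_mult_rot[OF E(3,1,2)] o by simp
      then have "w \<cdot> ((s \<cdot> x) \<cdot> y \<cdot> y \<cdot> x) = (g y y * g x x) *s (w \<cdot> s)"
        using E o' by (simp add: cross E_mult mult_lin)
      moreover have "w \<cdot> ((s \<cdot> x) \<cdot> y \<cdot> y \<cdot> x) = w \<cdot> (g y x *s (s \<cdot> x \<cdot> y) - g x (s \<cdot> x \<cdot> y) *s y)"
        by (rule w3) (use E in \<open>simp_all add: E_mult\<close>)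
      moreover have "g x (s \<cdot> x \<cdot> y) = 0"
        using g_mult_swap[of "s \<cdot> x" x y] g_sym[of x "s \<cdot> x \<cdot> y"] E o o' g_sym[of s y]
        by (simp add: cross g_lin E_cl)
      ultimately show ?thesis using n o' by (simp add: mult_lin)
    qed
    have "w \<cdot> s = 0" if s: "s \<in> {a, b, a \<cdot> b, c, c \<cdot> a, c \<cdot> b, c \<cdot> b \<cdot> a}" for s
    proof -
      have "triple a c (b \<cdot> a)" using t triple_swap' triple_mult by blast
      then have "w \<cdot> (b \<cdot> a) = 0" using a by blast
      moreover have "a \<cdot> b = - (b \<cdot> a)" using anti_E t unfolding triple_def by blast
      moreover have "\<exists>x y. triple x y s" if "s \<noteq> a \<cdot> b"
        using triple_last[OF t] that s by blast
      ultimately show ?thesis using a by (cases "s = a \<cdot> b") (auto simp: mult_lin)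
    qed
    then have "frame a b c \<subseteq> {d. w \<cdot> d = 0}" unfolding frame_def by auto
    then show "w \<cdot> d = 0" if "d \<in> E" for d using frame_induct[OF t subspace_kill] that by blast
  qed
  then show ?thesis unfolding w_def by simp
qed

section \<open>Bilinear maps that satisfy the identity h\<close>

text \<open>
  Together with \<open>dyad_mult\<close>: an element \<open>y\<close> that is annihilated by an anisotropic \<open>z\<close> is the value at \<open>z\<close> of a
  homomorphism from \<open>E\<close>.
\<close>

lemma dyad_of_killed: "z \<in> E \<Longrightarrow> y \<cdot> z = 0 \<Longrightarrow> dyad z z y = (3 * g z z) *s y"
  unfolding dyad_def by (simp add: mult_lin square_0)

text \<open>
  What the identity \<open>h\<close> says about \<open>B c a = phi w c \<cdot> phi u a\<close>. The product of \<open>E\<close> itself satisfies the condition, and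
  the following lemmas show that, up to the choice of \<open>v \<in> U\<close>, it is the only solution.
\<close>

definition h_bilinear where "h_bilinear B \<longleftrightarrow>
  (\<forall>x\<in>E. \<forall>y\<in>E. \<forall>z\<in>E. B (x + y) z = B x z + B y z \<and> B z (x + y) = B z x + B z y) \<and>
  (\<forall>r. \<forall>x\<in>E. \<forall>y\<in>E. B (r *s x) y = r *s B x y \<and> B x (r *s y) = r *s B x y) \<and>
  (\<forall>c\<in>E. \<forall>a\<in>E. \<forall>x\<in>E. (B c a \<cdot> x - B (c \<cdot> x) a + 2 *s B c (a \<cdot> x)) \<cdot> x = (3 * g c x) *s B x a)"

context
  fixes B assumes B: "h_bilinear B"
begin

lemma B_add1: "x \<in> E \<Longrightarrow> y \<in> E \<Longrightarrow> z \<in> E \<Longrightarrow> B (x + y) z = B x z + B y z"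
  and B_add2: "x \<in> E \<Longrightarrow> y \<in> E \<Longrightarrow> z \<in> E \<Longrightarrow> B z (x + y) = B z x + B z y"
  and B_sc1: "x \<in> E \<Longrightarrow> y \<in> E \<Longrightarrow> B (r *s x) y = r *s B x y"
  and B_sc2: "x \<in> E \<Longrightarrow> y \<in> E \<Longrightarrow> B x (r *s y) = r *s B x y"
  and B_T: "c \<in> E \<Longrightarrow> a \<in> E \<Longrightarrow> x \<in> E \<Longrightarrow>
    (B c a \<cdot> x - B (c \<cdot> x) a + 2 *s B c (a \<cdot> x)) \<cdot> x = (3 * g c x) *s B x a"
  using B unfolding h_bilinear_def by blast+

lemma B_neg: "x \<in> E \<Longrightarrow> y \<in> E \<Longrightarrow> B (- x) y = - B x y" "x \<in> E \<Longrightarrow> y \<in> E \<Longrightarrow> B x (- y) = - B x y"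
  and B_0: "y \<in> E \<Longrightarrow> B 0 y = 0" "y \<in> E \<Longrightarrow> B y 0 = 0"
  using B_sc1[of x y "-1"] B_sc2[of x y "-1"] B_sc1[of 0 y 0] B_sc2[of y 0 0] E_0 by simp_all

lemma B_diff: "x \<in> E \<Longrightarrow> y \<in> E \<Longrightarrow> z \<in> E \<Longrightarrow> B (x - y) z = B x z - B y z"
  "x \<in> E \<Longrightarrow> y \<in> E \<Longrightarrow> z \<in> E \<Longrightarrow> B z (x - y) = B z x - B z y"
  using B_add1[of x "-y" z] B_add2[of x "-y" z] by (simp_all add: B_neg E_neg)

lemmas B_lin = B_add1 B_add2 B_sc1 B_sc2 B_neg B_0 B_diff

text \<open>
  All three arguments equal to \<open>x\<close> give \<open>B(x,x) x x = 3 g(x,x) B(x,x)\<close>, but by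
  \<open>cube\<close> the only nonzero eigenvalue of \<open>R\<^sub>x\<^sup>2\<close> is \<open>g(x,x)\<close>. Hence \<open>B(x,x) = 0\<close> for anisotropic \<open>x\<close>.
\<close>

lemma B_self: assumes "x \<in> E" shows "B x x = 0"
proof -
  have z: "B x x = 0" if x: "x \<in> E" "g x x \<noteq> 0" for x
  proof -
    let ?b = "B x x"
    have 1: "?b \<cdot> x \<cdot> x = (3 * g x x) *s ?b"
      using B_T[OF x(1) x(1) x(1)] x(1) by (simp add: square_0 B_0 mult_lin)
    have "(3 * g x x) *s (?b \<cdot> x) = g x x *s (?b \<cdot> x)"
      using cube[OF x(1), of ?b] unfolding 1 by (simp add: mult_lin)
    then have "(3 * g x x - g x x) *s (?b \<cdot> x) = 0" by (simp only: scale_left_diff_distrib right_minus_eq)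
    moreover have "3 * g x x - g x x = 2 * g x x" by simp
    ultimately have "?b \<cdot> x = 0" using x two by (metis mult_eq_0_iff scale_eq_0_iff)
    then have "(3 * g x x) *s ?b = 0" using 1 by (simp add: mult_lin)
    then show ?thesis using x three by simp
  qed
  show ?thesis
    by (rule alternating_if_anisotropic[where q = B, OF _ _ _ _ z e_E(1) n1 assms]) (simp_all add: B_lin)
qed

lemma B_swap: assumes "x \<in> E" "y \<in> E" shows "B y x = - B x y"
proof -
  have "B x (x + y) + B y (x + y) = 0" using B_self[of "x + y"] B_add1[of x y "x + y"] assms E_add by metis
  then have "B x y + B y x = 0" using assms by (simp add: B_lin B_self)
  then show ?thesis by (simp add: eq_neg_iff_add_eq_0 add.commute)
qed

lemma B_mult: assumes x: "x \<in> E" "g x x \<noteq> 0" and a: "a \<in> E"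
  shows "B x (a \<cdot> x) = B x a \<cdot> x"
proof -
  have 1: "B x c \<cdot> x \<cdot> x = B x (c \<cdot> x) \<cdot> x" if c: "c \<in> E" for c
    using B_T[OF c x(1) x(1)] x(1) c B_swap[OF x(1) c] B_swap[OF x(1) E_mult[OF c x(1)]]
    by (simp add: B_self square_0 B_0 mult_lin)
  have 2: "B x c \<cdot> x \<cdot> x = g x x *s B x c" if c: "c \<in> E" for c
  proof -
    have "B x c \<cdot> x \<cdot> x + 2 *s (B x (c \<cdot> x) \<cdot> x) = (3 * g x x) *s B x c"
      using B_T[OF x(1) c x(1)] x(1) c by (simp add: square_0 B_0 mult_lin)
    then have "3 *s (B x c \<cdot> x \<cdot> x) = 3 *s (g x x *s B x c)"
      unfolding 1[OF c, symmetric] by (simp add: sc2 sc3 sc3r add.assoc)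
    then show ?thesis using three scale_cancel_left by blast
  qed
  have "g x x *s (B x a \<cdot> x) = B x (a \<cdot> x) \<cdot> x \<cdot> x" 
    using 1[OF a] 2[OF a] by (metis mult_sc_l)
  also have "\<dots> = g x x *s B x (a \<cdot> x)" using 2 E_mult a x by blast
  finally show ?thesis using x scale_cancel_left by metis
qed

text \<open>
  The value of \<open>B\<close> at orthogonal \<open>c, d\<close> is annihilated by \<open>c d\<close>, that is, it is the value at \<open>c d\<close> of some
  homomorphism from \<open>E\<close>.
\<close>

lemma B_line: assumes cd: "c \<in> E" "d \<in> E" "g c d = 0" "g c c \<noteq> 0" "g d d \<noteq> 0"
  shows "B c d \<cdot> (c \<cdot> d) = 0"
proof -
  \<comment> \<open>the defining condition is used for \<open>c, c x, x\<close>, where \<open>c x\<close> is a multiple of \<open>d\<close>\<close>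
  define x where "x = c \<cdot> d"
  have x: "x \<in> E" "g x x \<noteq> 0" "g c x = 0"
    using g_mult_mult[OF cd(1,2,2)] g_mult_self'[OF cd(1,2)] g_sym[OF cd(1), of x] cd
    unfolding x_def by (auto simp: E_mult)
  have cx: "c \<cdot> x \<in> E" using cd x E_mult by blast
  have "c \<cdot> x \<cdot> x = g x x *s c" using cross[OF cd(1) x(1)] x by simp
  then have "(B c (c \<cdot> x) \<cdot> x) \<cdot> x = 0"
    using B_T[OF cd(1) cx x(1)] B_self[OF cx] B_self[OF cd(1)] x cd by (simp add: B_sc2)
  then have 1: "B c (c \<cdot> x) \<cdot> x = 0" using cube[OF x(1), of "B c (c \<cdot> x)"] x by (simp add: mult_lin)
  have "c \<cdot> x = g c c *s d" 
    unfolding x_def using cross'(2)[OF cd(2,1)] cd g_sym[OF cd(1,2)] by simp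
  then show ?thesis using 1 cd unfolding x_def[symmetric] by (simp add: B_sc2 mult_lin)
qed

text \<open>
  For \<open>x\<close> orthogonal to \<open>s\<close>, a nonzero value at \<open>s\<close> of a homomorphism from \<open>E\<close> is an eigenvector of \<open>R\<^sub>x\<^sup>2\<close> with eigenvalue \<open>g(x,x)\<close>.
\<close>

lemma ker_orth:
  assumes "s \<in> E" "x \<in> E" "g s s \<noteq> 0" "g x x \<noteq> 0" "g s x = 0" "y \<cdot> s = 0" "y \<cdot> x = 0"
  shows "y = 0"
proof -
  have "dyad s s y \<cdot> x \<cdot> x = g x x *s dyad s s y" 
    using assms by (simp add: dyad_mult cross E_mult dyad_lin)
  then show ?thesis using dyad_of_killed[of s y] assms three by (simp add: mult_lin)
qed

text \<open>
  Think of the coefficients of \<open>B\<close> at the lines of the Fano plane: by \<open>B_mult\<close> and \<open>B_line\<close>, for frame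
  vectors \<open>c, d\<close> the value \<open>B c d\<close> is the product \<open>c d\<close> with a coefficient that only depends on the line
  through \<open>c\<close> and \<open>d\<close>. For three lines that form a triangle the condition on \<open>B\<close> says that twice the
  coefficient of one line is the sum of the other two. Two such relations, with the roles exchanged,
  show that three times the difference of two coefficients is zero. In the proof, \<open>p\<close> and \<open>q\<close> are the
  values on two lines that form a triangle with the line through \<open>c\<close> and \<open>a\<close>, where \<open>B\<close> vanishes.
\<close>

lemma B_step: assumes t: "triple c a x" and ca: "B c a = 0" shows "B c (a \<cdot> x) = 0"
proof -
  have E: "c \<in> E" "a \<in> E" "x \<in> E" "a \<cdot> x \<in> E" "c \<cdot> x \<in> E" "c \<cdot> a \<in> E" "a \<cdot> c \<in> E"
    and n: "g c c \<noteq> 0" "g a a \<noteq> 0" "g x x \<noteq> 0" and o: "g c a = 0" "g c x = 0" "g a x = 0" "g (c \<cdot> a) x = 0"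
    using t unfolding triple_def by (auto simp: E_mult)
  have o': "g a c = 0" "g x c = 0" "g x a = 0" using o g_sym E by metis+
  have na: "g (a \<cdot> x) (a \<cdot> x) \<noteq> 0" "g (c \<cdot> x) (c \<cdot> x) \<noteq> 0"
    using g_mult_mult[OF E(2,3,3)] g_mult_mult[OF E(1,3,3)] n o by auto
  define s where "s = a \<cdot> c \<cdot> x"
  have s1: "a \<cdot> x \<cdot> c = - s" unfolding s_def using swap_orth[of a x c] E o o' by simp
  have s2: "c \<cdot> (a \<cdot> x) = s" using anti_E[OF E(4,1)] s1 by simp
  have ac: "a \<cdot> c = - (c \<cdot> a)" using anti_E E by blast
  have s3: "c \<cdot> a \<cdot> x = - s" unfolding s_def ac by (simp add: mult_lin)
  have s4: "a \<cdot> (c \<cdot> x) = - s"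
    using anti_E[OF E(5,2)] swap_orth[of c x a] E o o' s3 by simp
  have "triple c a (x \<cdot> a \<cdot> c)" using t triple_mult triple_mult' by blast
  moreover have "x \<cdot> a \<cdot> c = s" using anti_E[OF E(2,3)] s1 by (simp add: mult_lin)
  ultimately have sE: "s \<in> E" "g c s = 0" "g a s = 0" "g s s \<noteq> 0" unfolding triple_def by auto
  have sx: "g s x = 0" unfolding s_def using g_mult_self E by blast
  have xs: "g x s = 0" using sx g_sym sE E by metis
  define p where "p = B c (a \<cdot> x)"
  define q where "q = B a (c \<cdot> x)"
  have ps: "p \<cdot> s = 0" unfolding p_def s2[symmetric] 
    using B_line[of c "a \<cdot> x"] E n na g_mult_rot[of c a x] o g_sym[of c "a \<cdot> x"] by simp
  have "q \<cdot> (a \<cdot> (c \<cdot> x)) = 0" unfolding q_def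
    using B_line[of a "c \<cdot> x"] E n na g_mult_rot[of a c x] ac o g_sym[of a "c \<cdot> x"] by (simp add: g_neg)
  then have qs: "q \<cdot> s = 0" unfolding s4 by (simp add: mult_lin)
  \<comment> \<open>first relation: base line through \<open>c\<close> and \<open>a x\<close>\<close>
  have "(q + 2 *s p) \<cdot> x = 0"
    using B_T[OF E(1,2,3)] B_swap[OF E(2,5)] ca o unfolding p_def q_def by (simp add: mult_lin)
  then have "q + 2 *s p = 0"
    using ker_orth[OF sE(1) E(3) sE(4) n(3) sx, of "q + 2 *s p"] ps qs by (simp add: mult_lin)
  then have q: "q = - (2 *s p)" by (simp add: eq_neg_iff_add_eq_0)
  \<comment> \<open>second relation: base line through \<open>c\<close> and \<open>a\<close>, reached as \<open>a' x\<close>\<close>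
  define a' where "a' = c \<cdot> a \<cdot> x"
  have a'E: "a' \<in> E" unfolding a'_def using E E_mult by blast
  have a'x: "a' \<cdot> x = g x x *s (c \<cdot> a)" unfolding a'_def using cross[of "c \<cdot> a" x] E o by simp
  have "B c (c \<cdot> a) = - (B c (a \<cdot> c))" using anti_E[OF E(2,1)] E by (simp add: B_neg)
  also have "\<dots> = 0" using B_mult[OF E(1) n(1) E(2)] ca by (simp add: mult_lin)
  finally have b1: "B c (a' \<cdot> x) = 0" unfolding a'x using E by (simp add: B_lin)
  have "a' = a \<cdot> x \<cdot> c" unfolding a'_def s3 s1 by simp
  then have b2: "B c a' = p \<cdot> c" unfolding p_def using B_mult[OF E(1) n(1) E(4)] by simp
  have "a' = a \<cdot> (c \<cdot> x)" unfolding a'_def s3 s4 by simp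
  then have "B (c \<cdot> x) a' = B (c \<cdot> x) a \<cdot> (c \<cdot> x)" using B_mult[OF E(5) na(2) E(2)] by simp
  also have "B (c \<cdot> x) a = 2 *s p" using B_swap[OF E(2,5)] q unfolding q_def by simp
  finally have b3: "B (c \<cdot> x) a' = 2 *s (p \<cdot> (c \<cdot> x))" by (simp add: mult_lin)
  have T: "(p \<cdot> c \<cdot> x - 2 *s (p \<cdot> (c \<cdot> x))) \<cdot> x = 0"
    using B_T[OF E(1) a'E E(3)] b1 b2 b3 o by simp
  \<comment> \<open>write \<open>p\<close> as the value at \<open>s\<close> of a homomorphism, to compute its products inside \<open>E\<close>\<close>
  define r where "r = 3 * g s s"
  have r: "r \<noteq> 0" unfolding r_def using sE three by simp
  have pr: "r *s p = dyad s s p" unfolding r_def using dyad_of_killed sE ps by metis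
  have sc: "s \<cdot> c \<in> E" using sE E E_mult by blast
  have scs: "s \<cdot> (c \<cdot> x) = - (s \<cdot> c \<cdot> x)"
  proof -
    have "c \<cdot> x \<cdot> s = - (c \<cdot> s \<cdot> x)" using swap_orth[of c x s] E sE o xs by simp
    then show ?thesis using anti_E[OF E(5) sE(1)] anti_E[OF sE(1) E(1)] by (simp add: mult_lin)
  qed
  have scx: "s \<cdot> c \<cdot> x \<cdot> x = g x x *s (s \<cdot> c)"
  proof -
    have "g (s \<cdot> c) x = g (x \<cdot> s) c" using g_mult_rot E sE by blast
    also have "x \<cdot> s = - (g x x *s (a \<cdot> c))"
      unfolding s_def using cross'(1)[OF E(7,3)] g_mult_rot[of x a c] g_mult_swap[of a x c] E o ac 
        by (simp add: g_neg)
    also have "g \<dots> c = 0" using E by (simp add: g_neg g_sc E_cl g_mult_self)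
    finally show ?thesis using cross[OF sc E(3)] by simp
  qed
  have "r *s (p \<cdot> c \<cdot> x - 2 *s (p \<cdot> (c \<cdot> x))) = dyad s s p \<cdot> c \<cdot> x - 2 *s (dyad s s p \<cdot> (c \<cdot> x))"
    unfolding pr[symmetric] by (simp add: mult_lin scale_right_diff_distrib)
  also have "\<dots> = 3 *s dyad s (s \<cdot> c \<cdot> x) p"
    using E sE by (simp add: dyad_mult E_mult scs dyad_lin sc2 sc3)
  finally have "r *s ((p \<cdot> c \<cdot> x - 2 *s (p \<cdot> (c \<cdot> x))) \<cdot> x) = 3 *s (dyad s (s \<cdot> c \<cdot> x) p \<cdot> x)"
    by (metis mult_sc_l)
  then have "dyad s (s \<cdot> c \<cdot> x) p \<cdot> x = 0" using T three by simp
  then have "dyad s (s \<cdot> c) p = 0" using E sE sc n by (simp add: dyad_mult E_mult scx dyad_lin)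
  then have "dyad s (s \<cdot> c) p \<cdot> c = 0" by (simp add: mult_lin)
  moreover have "s \<cdot> c \<cdot> c = g c c *s s" using cross[OF sE(1) E(1)] sE g_sym[OF sE(1) E(1)] by simp
  ultimately have "dyad s s p = 0" using E sE sc n by (simp add: dyad_mult dyad_lin)
  then show ?thesis using pr r unfolding p_def by (metis scale_eq_0_iff)
qed

text \<open>
  Starting from \<open>a\<close>, multiplication by \<open>c\<close> (\<open>B_mult\<close>) and by \<open>x\<close> or \<open>a\<close> (\<open>B_step\<close>) reach the whole frame.
\<close>

lemma B_row: assumes t: "triple c a x" and ca: "B c a = 0" and d: "d \<in> E" shows "B c d = 0"
proof -
  have E: "c \<in> E" "a \<in> E" "x \<in> E" and n: "g c c \<noteq> 0" "g a a \<noteq> 0" and o: "g x a = 0"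
    using t g_sym unfolding triple_def by auto
  have m: "B c (b \<cdot> c) = 0" if "b \<in> E" "B c b = 0" for b
    using B_mult[OF E(1) n(1) that(1)] that by (simp add: mult_lin)
  have ax: "B c (a \<cdot> x) = 0" using B_step[OF t ca] .
  have xa: "B c (x \<cdot> a) = 0" using ax anti_E[OF E(2,3)] E by (simp add: B_neg E_mult)
  have "triple c a (x \<cdot> a)" using t triple_mult' by blast
  then have "triple c (x \<cdot> a) a" using triple_swap' by blast
  then have "B c (x \<cdot> a \<cdot> a) = 0" using B_step xa by blast
  then have x: "B c x = 0" using cross[OF E(3,2)] o n E by (simp add: B_lin)
  have ca': "B c (c \<cdot> a) = 0" using m[OF E(2) ca] anti_E[OF E(2,1)] E by (simp add: B_neg E_mult)
  have "frame c a x \<subseteq> {d \<in> E. B c d = 0}"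
    using triple_frame(1)[OF t] ca ca' x xa m B_self[OF E(1)] E unfolding frame_def by (auto simp: E_mult)
  moreover have "subspace {d \<in> E. B c d = 0}"
    unfolding subspace_def using E by (auto simp: B_lin E_cl)
  ultimately show ?thesis using frame_induct[OF t] d by blast
qed

text \<open>
  The rows of \<open>c\<close>, \<open>a\<close> and \<open>x\<close> vanish by \<open>B_row\<close>. Linearising \<open>B_mult\<close> at \<open>y + z\<close> with \<open>z\<close> one of them yields
  \<open>B y (b z) = B y b \<cdot> z\<close>, so the zeros of \<open>B y\<close> are closed under multiplication by the generators.
\<close>

lemma B_zero: assumes t: "triple c a x" and ca: "B c a = 0" and d: "y \<in> E" "d \<in> E" shows "B y d = 0"
proof -
  have E: "c \<in> E" "a \<in> E" "x \<in> E" using t unfolding triple_def by auto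
  have c: "B c d = 0" if "d \<in> E" for d using B_row t ca that by blast
  have "triple a c x" "triple x c a" using t triple_swap triple_swap' by blast+
  moreover have "B a c = 0" "B x c = 0" using B_swap[of c a] B_swap[of c x] c E by auto
  ultimately have r: "B z d = 0" if "d \<in> E" "z \<in> {c, a, x}" for z d
    using B_row c that by blast
  have alt: "B z (b \<cdot> z) - B z b \<cdot> z = 0" if b: "b \<in> E" and z: "z \<in> E" for b z
    by (rule alternating_if_anisotropic[where q = "\<lambda>x y. B x (b \<cdot> y) - B x b \<cdot> y", OF _ _ _ _ _ e_E(1) n1 z])
      (use b in \<open>simp_all add: B_lin mult_lin E_cl B_mult scale_right_diff_distrib algebra_simps\<close>)
  have m: "B y (b \<cdot> z) = B y b \<cdot> z" if b: "b \<in> E" and z: "z \<in> {c, a, x}" for b z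
  proof -
    have zE: "z \<in> E" using z E by blast
    let ?w = "y + z"
    \<comment> \<open>of the two mixed terms, the one with \<open>z\<close> in the first place is zero\<close>
    have "B ?w (b \<cdot> ?w) - B ?w b \<cdot> ?w = 0" using alt b zE d E_add by blast
    then have "(B y (b \<cdot> y) - B y b \<cdot> y) + (B y (b \<cdot> z) - B y b \<cdot> z) = 0"
      using b d zE r[OF _ z] by (simp add: B_lin mult_lin E_cl algebra_simps)
    then show ?thesis using alt[OF b d(1)] by simp
  qed
  have z: "B y z = 0" if z: "z \<in> {c, a, x}" for z using r[OF d(1) z] B_swap[of z y] z E d by auto
  have "frame c a x \<subseteq> {d \<in> E. B y d = 0}"
    using triple_frame(1)[OF t] z m E unfolding frame_def by (auto simp: E_mult mult_lin)
  moreover have "subspace {d \<in> E. B y d = 0}"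
    unfolding subspace_def using d by (auto simp: B_lin E_cl)
  ultimately show ?thesis using frame_induct[OF t] d by blast
qed

end

section \<open>The coordinate space and its product\<close>

text \<open>
  For \<open>u \<in> U\<close> this is the homomorphism \<open>E \<rightarrow> M\<close> with value \<open>u\<close> at \<open>e1\<close> (\<open>phi_e1\<close>, \<open>phi_mult\<close>); it corresponds to
  \<open>b \<mapsto> b \<otimes> u\<close>.
\<close>

definition phi where "phi u b = (1 / (3 * g e1 e1)) *s dyad e1 b u"

definition U where "U = {u. u \<cdot> e1 = 0}"

lemma subspace_U: "subspace U"
  unfolding subspace_def U_def by (simp add: mult_lin)

lemma phi_lin1: "phi (u + u') b = phi u b + phi u' b" "phi (r *s u) b = r *s phi u b" "phi 0 b = 0"
  unfolding phi_def by (simp_all add: dyad_lin scale_right_distrib)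

lemma phi_lin2: "b \<in> E \<Longrightarrow> b' \<in> E \<Longrightarrow> phi u (b + b') = phi u b + phi u b'"
  "b \<in> E \<Longrightarrow> phi u (r *s b) = r *s phi u b" "phi u 0 = 0"
  "b \<in> E \<Longrightarrow> phi u (- b) = - phi u b"
  "b \<in> E \<Longrightarrow> b' \<in> E \<Longrightarrow> phi u (b - b') = phi u b - phi u b'"
  unfolding phi_def using e_E by (simp_all add: dyad_lin scale_right_distrib scale_right_diff_distrib)

lemma phi_e1: "u \<in> U \<Longrightarrow> phi u e1 = u"
  unfolding phi_def U_def using dyad_of_killed[OF e_E(1)] n1 three by simp

lemma phi_mult: "b \<in> E \<Longrightarrow> c \<in> E \<Longrightarrow> phi u b \<cdot> c = phi u (b \<cdot> c)"
  unfolding phi_def using e_E by (simp add: mult_lin dyad_mult)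

lemma dyad_phi: "b \<in> E \<Longrightarrow> c \<in> E \<Longrightarrow> d \<in> E \<Longrightarrow> dyad c d (phi u b) = (3 * g b c) *s phi u d"
  unfolding phi_def using e_E by (simp add: dyad_lin dyad_dyad mult.commute)

lemma phi_inj: assumes "u \<in> U" "b \<in> E" "g b b \<noteq> 0" "phi u b = 0" shows "u = 0"
  using dyad_phi[OF assms(2,2) e_E(1), of u] assms three by (simp add: dyad_lin phi_e1)

lemma dyad_in_U: "z \<in> E \<Longrightarrow> r *s dyad z e1 y \<in> U"
  unfolding U_def using e_E by (simp add: mult_lin dyad_mult square_0 dyad_lin)

lemma phi_dyad: assumes "z \<in> E" "d \<in> E" shows "phi (r *s dyad z e1 y) d = r *s dyad z d y"
  unfolding phi_def using assms e_E n1 three by (simp add: dyad_lin dyad_dyad)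

lemma ker_phi: assumes "z \<in> E" "g z z \<noteq> 0" "y \<cdot> z = 0"
  shows "phi ((1 / (3 * g z z)) *s dyad z e1 y) z = y"
  using assms three by (simp add: phi_dyad dyad_of_killed)

lemma phi_expand: "m = (\<Sum>s\<in>frame e1 e2 e3. phi ((1 / (3 * g s s)) *s dyad s e1 m) s)"
proof -
  have "(\<Sum>s\<in>frame e1 e2 e3. phi ((1 / (3 * g s s)) *s dyad s e1 m) s) =
    (\<Sum>s\<in>frame e1 e2 e3. (1 / (3 * g s s)) *s dyad s s m)"
    using triple_frame(1)[OF triple] by (intro sum.cong refl phi_dyad) auto
  then show ?thesis using dyad_expand[OF triple, of m] by simp
qed

text \<open>
  Take \<open>n = phi w b\<close>, \<open>m = phi u a\<close> and two equal arguments in \<open>h\<close>. The first argument of the bilinear map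
  then has the form \<open>b z\<close>, and products span \<open>E\<close>.
\<close>

lemma phi_product_h_bilinear: "h_bilinear (\<lambda>c a. phi w c \<cdot> phi u a)"
proof -
  have T: "(phi w c \<cdot> phi u a \<cdot> x - phi w (c \<cdot> x) \<cdot> phi u a + 2 *s (phi w c \<cdot> phi u (a \<cdot> x))) \<cdot> x
     = (3 * g c x) *s (phi w x \<cdot> phi u a)" if E: "c \<in> E" "a \<in> E" "x \<in> E" for c a x
  proof -
    let ?m = "phi u a"
    have t: "tri (phi w c) ?m x = phi w c \<cdot> phi u a \<cdot> x - phi w (c \<cdot> x) \<cdot> phi u a + 2 *s (phi w c \<cdot> phi u (a \<cdot> x))"
      if "c \<in> E" for c
      unfolding triple_product_def using that E by (simp add: phi_mult)
    have 1: "tri (phi w (b \<cdot> z)) ?m x \<cdot> x = (3 * g (b \<cdot> z) x) *s (phi w x \<cdot> ?m)"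
      if bz: "b \<in> E" "z \<in> E" for b z
    proof -
      have "tri (phi w b \<cdot> z) ?m x \<cdot> x + tri (phi w b \<cdot> z) ?m x \<cdot> x
         + tri (phi w b \<cdot> x) z x \<cdot> ?m + tri (phi w b \<cdot> x) z x \<cdot> ?m = 0"
        using h_identity[OF bz(2) E(3) E(3)] .
      then have "(tri (phi w b \<cdot> z) ?m x \<cdot> x + tri (phi w b \<cdot> x) z x \<cdot> ?m)
         + (tri (phi w b \<cdot> z) ?m x \<cdot> x + tri (phi w b \<cdot> x) z x \<cdot> ?m) = 0"
        by (simp add: add.assoc add.commute add.left_commute)
      then have 2: "tri (phi w b \<cdot> z) ?m x \<cdot> x + tri (phi w b \<cdot> x) z x \<cdot> ?m = 0" by (rule cancel2)
      have "tri (phi w (b \<cdot> x)) z x = phi w (tri (b \<cdot> x) z x)"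
        unfolding triple_product_def using E bz by (simp add: phi_mult phi_lin2 E_cl)
      also have "tri (b \<cdot> x) z x = - (3 * g (b \<cdot> z) x *s x)"
        using E bz g_mult_swap[of b x z] g_mult_self[of b x] g_mult_swap[of b z x]
        by (simp add: tri_E E_cl)
      finally show ?thesis using 2 E bz
        by (simp add: phi_mult phi_lin2 E_cl mult_lin)
    qed
    define q where "q c = tri (phi w c) ?m x \<cdot> x - (3 * g c x) *s (phi w x \<cdot> ?m)" for c
    let ?S = "{c \<in> E. q c = 0}"
    have "q (c + c') = q c + q c'" "q (r *s c) = r *s q c" if "c \<in> E" "c' \<in> E" for c c' r
      unfolding q_def triple_product_def using that E
      by (simp_all add: mult_lin phi_lin2 g_lin algebra_simps)
    then have "subspace ?S"
      unfolding subspace_def using E_0 by (auto simp: E_cl q_def[of 0] triple_product_def phi_lin2 mult_lin g_lin E)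
    then have "E \<subseteq> ?S" by (rule product_induct) (use 1 E_mult in \<open>auto simp: q_def\<close>)
    then show ?thesis using t E by (auto simp: q_def)
  qed
  show ?thesis unfolding h_bilinear_def
    using T by (auto simp: phi_lin2 mult_lin)
qed

lemma phi_mult_h_bilinear: "h_bilinear (\<lambda>c a. phi v (c \<cdot> a))"
proof -
  have "(phi v (c \<cdot> a) \<cdot> x - phi v (c \<cdot> x \<cdot> a) + 2 *s phi v (c \<cdot> (a \<cdot> x))) \<cdot> x
    = (3 * g c x) *s phi v (x \<cdot> a)" if E: "c \<in> E" "a \<in> E" "x \<in> E" for c a x
  proof -
    have "(phi v (c \<cdot> a) \<cdot> x - phi v (c \<cdot> x \<cdot> a) + 2 *s phi v (c \<cdot> (a \<cdot> x))) \<cdot> x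
      = phi v (tri c a x \<cdot> x)"
      unfolding triple_product_def using E by (simp add: phi_mult phi_lin2 E_cl mult_lin)
    also have "tri c a x \<cdot> x = (3 * g c x) *s (x \<cdot> a)"
      using E anti_E[OF E(2,3)] by (simp add: tri_E mult_lin square_0)
    finally show ?thesis using E by (simp add: phi_lin2 E_cl)
  qed
  then show ?thesis unfolding h_bilinear_def by (auto simp: phi_lin2 mult_lin E_cl)
qed

lemma h_bilinear_diff: "h_bilinear B \<Longrightarrow> h_bilinear B' \<Longrightarrow> h_bilinear (\<lambda>c a. B c a - B' c a)"
  unfolding h_bilinear_def
  by (auto simp: mult_lin algebra_simps scale_right_diff_distrib) 

text \<open>
  The coefficient of \<open>e1 e2\<close> in \<open>phi w e1 \<cdot> phi u e2\<close>. Being explicit, it is bilinear and respects the parity.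
\<close>

definition umul where
  "umul w u = (1 / (3 * g (e1 \<cdot> e2) (e1 \<cdot> e2))) *s dyad (e1 \<cdot> e2) e1 (phi w e1 \<cdot> phi u e2)"

lemma umul_U: "umul w u \<in> U"
  unfolding umul_def using dyad_in_U e_E E_mult by blast

text \<open>
  Both sides satisfy \<open>h_bilinear\<close> and they agree at \<open>(e1, e2)\<close>, so \<open>B_zero\<close> applies to their difference.
\<close>

lemma phi_phi: assumes ab: "a \<in> E" "b \<in> E" shows "phi w a \<cdot> phi u b = phi (umul w u) (a \<cdot> b)"
proof -
  let ?B = "\<lambda>c a. phi w c \<cdot> phi u a"
  have o: "g e1 e2 = 0" "g e2 e2 \<noteq> 0" using triple unfolding triple_def by auto
  have n: "g (e1 \<cdot> e2) (e1 \<cdot> e2) \<noteq> 0" using g_mult_mult[OF e_E(1,2,2)] o n1 by simp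
  have "?B e1 e2 \<cdot> (e1 \<cdot> e2) = 0"
    using B_line[OF phi_product_h_bilinear e_E(1,2) o(1) n1 o(2)] by simp
  then have "?B e1 e2 = phi (umul w u) (e1 \<cdot> e2)"
    unfolding umul_def using ker_phi[of "e1 \<cdot> e2"] n e_E E_mult by simp
  then have "?B a b - phi (umul w u) (a \<cdot> b) = 0"
    using B_zero[OF h_bilinear_diff[OF phi_product_h_bilinear phi_mult_h_bilinear] triple _ ab] by simp
  then show ?thesis by simp
qed

lemma umul_unique: assumes "v \<in> U" "phi w e1 \<cdot> phi u e2 = phi v (e1 \<cdot> e2)" shows "umul w u = v"
proof -
  have o: "g e1 e2 = 0" "g e2 e2 \<noteq> 0" using triple unfolding triple_def by auto
  have n: "g (e1 \<cdot> e2) (e1 \<cdot> e2) \<noteq> 0" using g_mult_mult[OF e_E(1,2,2)] o n1 by simp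
  show ?thesis unfolding umul_def assms(2) using n three e_E assms(1)
    by (simp add: dyad_phi E_cl phi_e1)
qed

lemma umul_lin: "umul (w + w') u = umul w u + umul w' u" "umul w (u + u') = umul w u + umul w u'"
  "umul (r *s w) u = r *s umul w u" "umul w (r *s u) = r *s umul w u"
  unfolding umul_def by (simp_all add: phi_lin1 mult_lin dyad_lin scale_right_distrib)

end

section \<open>Linear extension and bilinear products on finitely supported functions\<close>

abbreviation lookup where "lookup \<equiv> Poly_Mapping.lookup"
abbreviation keys where "keys \<equiv> Poly_Mapping.keys"
abbreviation single where "single \<equiv> Poly_Mapping.single"

lemma lookup_pm_scale [simp]: "lookup (pm_scale c f) k = c * lookup f k"
  unfolding pm_scale_def by (simp add: map.rep_eq when_def)

lemma vector_space_pm_scale: "vector_space (pm_scale :: 'f::field \<Rightarrow> ('k \<Rightarrow>\<^sub>0 'f) \<Rightarrow> _)"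
  by unfold_locales (auto intro!: poly_mapping_eqI simp: lookup_add algebra_simps)

lemma pm_scale_single [simp]: "pm_scale c (single k a) = single k (c * a)"
  by (rule poly_mapping_eqI) (simp add: lookup_single when_def)

lemma keys_pm_scale: "keys (pm_scale c f) \<subseteq> keys f"
  by (auto simp: in_keys_iff)

definition lext :: "('f::field \<Rightarrow> 'b \<Rightarrow> 'b) \<Rightarrow> ('k \<Rightarrow> 'b) \<Rightarrow> ('k \<Rightarrow>\<^sub>0 'f) \<Rightarrow> 'b::ab_group_add" where
  "lext sc h f = (\<Sum>k\<in>keys f. sc (lookup f k) (h k))"

locale lin_space = vector_space sc for sc :: "'f::field \<Rightarrow> 'b::ab_group_add \<Rightarrow> 'b"
begin

lemma lext_add: fixes h :: "'k \<Rightarrow> 'b" shows "lext sc h (f + f') = lext sc h f + lext sc h f'"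
  unfolding lext_def
  by (rule setsum_keys_plus_distrib[where f = "\<lambda>k c. sc c (h k)"]) (simp_all add: scale_left_distrib)

lemma lext_superset: "finite A \<Longrightarrow> keys f \<subseteq> A \<Longrightarrow> lext sc h f = (\<Sum>k\<in>A. sc (lookup f k) (h k))"
  unfolding lext_def by (rule sum.mono_neutral_left) (auto simp: in_keys_iff)

lemma lext_scale: "lext sc h (pm_scale c f) = sc c (lext sc h f)"
  using lext_superset[OF finite_keys keys_pm_scale, of h c f]
  by (simp add: lext_def scale_sum_right)

lemma lext_single [simp]: "lext sc h (single k c) = sc c (h k)"
  using lext_superset[of "{k}" "single k c" h] by simp

lemma lext_0 [simp]: "lext sc h 0 = 0"
  by (simp add: lext_def)

lemma lext_uminus: "lext sc h (- f) = - lext sc h f"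
  using lext_add[of h f "- f"] by (simp add: eq_neg_iff_add_eq_0 add.commute)

lemma lext_diff: "lext sc h (f - f') = lext sc h f - lext sc h f'"
  using lext_add[of h f "- f'"] by (simp add: lext_uminus)

lemma lext_in_subspace: "subspace S \<Longrightarrow> (\<And>k. k \<in> keys f \<Longrightarrow> h k \<in> S) \<Longrightarrow> lext sc h f \<in> S"
  unfolding lext_def by (intro subspace_sum subspace_scale)

lemma lext_fun_add: "lext sc (\<lambda>k. h k + h' k) f = lext sc h f + lext sc h' f"
  unfolding lext_def by (simp add: scale_right_distrib sum.distrib)

lemma lext_fun_scale: "lext sc (\<lambda>k. sc c (h k)) f = sc c (lext sc h f)"
  unfolding lext_def by (simp add: scale_sum_right mult.commute)

end

interpretation pm: lin_space "pm_scale :: 'f::field \<Rightarrow> ('k \<Rightarrow>\<^sub>0 'f) \<Rightarrow> _"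
  unfolding lin_space_def by (rule vector_space_pm_scale)

lemma pm_expand: "(f :: 'k \<Rightarrow>\<^sub>0 'f::field) = lext pm_scale (\<lambda>k. single k 1) f"
proof (rule poly_mapping_eqI)
  fix k
  have "lookup (lext pm_scale (\<lambda>k. single k 1) f) k = (\<Sum>j\<in>keys f. if j = k then lookup f k else 0)"
    unfolding lext_def lookup_sum by (intro sum.cong) (auto simp: lookup_single when_def)
  then show "lookup f k = lookup (lext pm_scale (\<lambda>k. single k 1) f) k"
    by (simp add: in_keys_iff)
qed

lemma pm_bilin_eq: "pm_bilin m f g = lext pm_scale (\<lambda>i. lext pm_scale (m i) g) f"
  unfolding pm_bilin_def lext_def pm.scale_sum_right by simp

lemma pm_bilin_add: "pm_bilin m (f + f') g = pm_bilin m f g + pm_bilin m f' g"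
  "pm_bilin m f (g + g') = pm_bilin m f g + pm_bilin m f g'"
  unfolding pm_bilin_eq by (simp_all add: pm.lext_add pm.lext_fun_add)

lemma pm_bilin_scale: "pm_bilin m (pm_scale c f) g = pm_scale c (pm_bilin m f g)"
  "pm_bilin m f (pm_scale c g) = pm_scale c (pm_bilin m f g)"
  unfolding pm_bilin_eq by (simp_all add: pm.lext_scale pm.lext_fun_scale)

lemma pm_bilin_single: "pm_bilin m (single i a) (single j b) = pm_scale (a * b) (m i j)"
  unfolding pm_bilin_eq by simp

lemma pm_bilin_uminus: "pm_bilin m (- f) g = - pm_bilin m f g" "pm_bilin m f (- g) = - pm_bilin m f g"
  using pm_bilin_scale(1)[where c = "-1" and m = m and f = f and g = g]
    pm_bilin_scale(2)[where c = "-1" and m = m and f = f and g = g] by simp_all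

lemma pm_bilin_diff: "pm_bilin m (f - f') g = pm_bilin m f g - pm_bilin m f' g"
  "pm_bilin m f (g - g') = pm_bilin m f g - pm_bilin m f g'"
  using pm_bilin_add[of m f "- f'" g] pm_bilin_add(2)[of m f g "- g'"]  by (simp_all add: pm_bilin_uminus)

lemma pm_bilin_0: "pm_bilin m 0 g = 0" "pm_bilin m f 0 = 0"
  unfolding pm_bilin_eq by (simp_all add: lext_def)

lemmas pm_bilin_lin = pm_bilin_add pm_bilin_scale pm_bilin_uminus pm_bilin_diff pm_bilin_0 pm_bilin_single

lemma pm_keys_subspace: "pm.subspace {f. keys f \<subseteq> A}"
  unfolding pm.subspace_def
  by (auto dest!: subsetD[OF keys_add] subsetD[OF keys_pm_scale])

lemma pm_bilin_keys:
  assumes "\<And>i j. i \<in> keys f \<Longrightarrow> j \<in> keys g \<Longrightarrow> keys (m i j) \<subseteq> A"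
  shows "keys (pm_bilin m f g) \<subseteq> A"
proof -
  have "pm_bilin m f g \<in> {f. keys f \<subseteq> A}"
    unfolding pm_bilin_eq by (intro pm.lext_in_subspace pm_keys_subspace) (use assms in simp)
  then show ?thesis by simp
qed

section \<open>Quotients and tensor products\<close>

text \<open>
  The operations of the quotient are unions of cosets; for an ideal these collapse to the coset of
  the result on representatives. The carrier may be a proper subset of the type, as for the
  pairs underlying a tensor product.
\<close>

locale coset_ideal =
  fixes X :: "('f::field, 'a::ab_group_add, 'z) alg_scheme" and I :: "'a set"
  assumes add_X: "add X = (+)" and zer_X: "zer X = 0"
    and I_0: "0 \<in> I" and I_diff: "i \<in> I \<Longrightarrow> j \<in> I \<Longrightarrow> i - j \<in> I"
    and I_smul: "x \<in> carr X \<Longrightarrow> i \<in> I \<Longrightarrow> smul X c (x + i) - smul X c x \<in> I"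
    and I_mul: "x \<in> carr X \<Longrightarrow> y \<in> carr X \<Longrightarrow> i \<in> I \<Longrightarrow> j \<in> I \<Longrightarrow>
      mul X (x + i) (y + j) - mul X x y \<in> I"
begin

abbreviation cs where "cs \<equiv> alg_coset X I"

lemma I_neg: "i \<in> I \<Longrightarrow> - i \<in> I" using I_diff[of 0 i] I_0 by simp
lemma I_add: "i \<in> I \<Longrightarrow> j \<in> I \<Longrightarrow> i + j \<in> I" using I_diff[of i "- j"] I_neg by simp

lemma cs_eq: "cs x = cs y \<longleftrightarrow> x - y \<in> I"
proof
  have "x \<in> cs x" unfolding alg_coset_def add_X using I_0 by force
  then show "x - y \<in> I" if "cs x = cs y" using that unfolding alg_coset_def add_X by auto
next
  have s: "cs x \<subseteq> cs y" if d: "x - y \<in> I" for x y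
  proof
    fix z assume "z \<in> cs x"
    then obtain i where "i \<in> I" "z = x + i" unfolding alg_coset_def add_X by auto
    then have "z = y + ((x - y) + i)" "(x - y) + i \<in> I" using I_add d by auto
    then show "z \<in> cs y" unfolding alg_coset_def add_X by blast
  qed
  assume d: "x - y \<in> I"
  then have "y - x \<in> I" using I_neg by fastforce
  then show "cs x = cs y" using s d by blast
qed

lemma cs_add: "add (alg_quot X I) (cs x) (cs y) = cs (x + y)"
proof -
  have "cs (x + i + (y + j)) = cs (x + y)" if "i \<in> I" "j \<in> I" for i j
    using that I_add unfolding cs_eq by (simp add: algebra_simps)
  then have "(\<Union>a\<in>cs x. \<Union>b\<in>cs y. cs (a + b)) = (\<Union>a\<in>cs x. \<Union>b\<in>cs y. cs (x + y))"
    unfolding alg_coset_def[of X I x] alg_coset_def[of X I y] add_X by (intro SUP_cong refl) auto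
  moreover have "cs x \<noteq> {}" "cs y \<noteq> {}" unfolding alg_coset_def using I_0 by auto
  ultimately show ?thesis unfolding alg_quot_def by (simp add: add_X)
qed

lemma cs_smul: assumes "x \<in> carr X" shows "smul (alg_quot X I) c (cs x) = cs (smul X c x)"
proof -
  have "cs (smul X c (x + i)) = cs (smul X c x)" if "i \<in> I" for i
    using that I_smul assms unfolding cs_eq by simp
  then have "(\<Union>a\<in>cs x. cs (smul X c a)) = (\<Union>a\<in>cs x. cs (smul X c x))"
    unfolding alg_coset_def[of X I x] add_X by (intro SUP_cong refl) auto
  moreover have "cs x \<noteq> {}" unfolding alg_coset_def using I_0 by auto
  ultimately show ?thesis unfolding alg_quot_def by simp
qed

lemma cs_mul: assumes "x \<in> carr X" "y \<in> carr X"
  shows "mul (alg_quot X I) (cs x) (cs y) = cs (mul X x y)"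
proof -
  have "cs (mul X (x + i) (y + j)) = cs (mul X x y)" if "i \<in> I" "j \<in> I" for i j
    using that I_mul assms unfolding cs_eq by simp
  then have "(\<Union>a\<in>cs x. \<Union>b\<in>cs y. cs (mul X a b)) = (\<Union>a\<in>cs x. \<Union>b\<in>cs y. cs (mul X x y))"
    unfolding alg_coset_def[of X I x] alg_coset_def[of X I y] add_X by (intro SUP_cong refl) auto
  moreover have "cs x \<noteq> {}" "cs y \<noteq> {}" unfolding alg_coset_def using I_0 by auto
  ultimately show ?thesis unfolding alg_quot_def by simp
qed

lemma cs_carr: "carr (alg_quot X I) = cs ` carr X"
  and cs_zer: "zer (alg_quot X I) = cs 0"
  unfolding alg_quot_def by (simp_all add: zer_X)

end

locale tensor_pair = A: nonassoc_algebra A + B: nonassoc_algebra B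
  for A :: "('f::field, 'a, 'y) alg_scheme" and B :: "('f, 'b, 'z) alg_scheme"
begin

abbreviation W where "W \<equiv> free_pairs A B"
abbreviation N where "N \<equiv> tensor_null A B"
abbreviation tmul (infixl "**" 70) where "tmul \<equiv> mul W"

lemma W_simps: "carr W = {f. keys f \<subseteq> carr A \<times> carr B}" "zer W = 0" "add W = (+)" "smul W = pm_scale"
  unfolding free_pairs_def by simp_all

lemma tmul_eq: "f ** g = pm_bilin (\<lambda>(a, b) (a', b'). single (mul A a a', mul B b b') 1) f g"
  unfolding free_pairs_def by simp

lemma tmul_lin: "(f + f') ** g = f ** g + f' ** g" "f ** (g + g') = f ** g + f ** g'"
  "pm_scale c f ** g = pm_scale c (f ** g)" "f ** pm_scale c g = pm_scale c (f ** g)"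
  "(- f) ** g = - (f ** g)" "f ** (- g) = - (f ** g)"
  "(f - f') ** g = f ** g - f' ** g" "f ** (g - g') = f ** g - f ** g'"
  "0 ** g = 0" "f ** 0 = 0"
  unfolding tmul_eq by (rule pm_bilin_lin)+

lemma tmul_single [simp]: "single (a, b) c ** single (a', b') c' = single (mul A a a', mul B b b') (c * c')"
  unfolding tmul_eq pm_bilin_single by simp

lemma N_subspace: "pm.subspace N" unfolding tensor_null_def by simp

lemmas N_closed = pm.subspace_add[OF N_subspace] pm.subspace_diff[OF N_subspace]
  pm.subspace_scale[OF N_subspace] pm.subspace_0[OF N_subspace] pm.subspace_neg[OF N_subspace]

lemma N_rel:
  "a \<in> carr A \<Longrightarrow> a' \<in> carr A \<Longrightarrow> b \<in> carr B \<Longrightarrow> single (add A a a', b) 1 - single (a, b) 1 - single (a', b) 1 \<in> N"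
  "a \<in> carr A \<Longrightarrow> b \<in> carr B \<Longrightarrow> b' \<in> carr B \<Longrightarrow> single (a, add B b b') 1 - single (a, b) 1 - single (a, b') 1 \<in> N"
  "a \<in> carr A \<Longrightarrow> b \<in> carr B \<Longrightarrow> single (smul A c a, b) 1 - single (a, b) c \<in> N"
  "a \<in> carr A \<Longrightarrow> b \<in> carr B \<Longrightarrow> single (a, smul B c b) 1 - single (a, b) c \<in> N"
  unfolding tensor_null_def tensor_relations_def by (rule pm.span_base, blast)+

lemma N_induct:
  assumes S: "pm.subspace S"
    and "\<And>a a' b. a \<in> carr A \<Longrightarrow> a' \<in> carr A \<Longrightarrow> b \<in> carr B \<Longrightarrow> single (add A a a', b) 1 - single (a, b) 1 - single (a', b) 1 \<in> S"
    and "\<And>a b b'. a \<in> carr A \<Longrightarrow> b \<in> carr B \<Longrightarrow> b' \<in> carr B \<Longrightarrow> single (a, add B b b') 1 - single (a, b) 1 - single (a, b') 1 \<in> S"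
    and "\<And>a b c. a \<in> carr A \<Longrightarrow> b \<in> carr B \<Longrightarrow> single (smul A c a, b) 1 - single (a, b) c \<in> S"
    and "\<And>a b c. a \<in> carr A \<Longrightarrow> b \<in> carr B \<Longrightarrow> single (a, smul B c b) 1 - single (a, b) c \<in> S"
  shows "N \<subseteq> S"
  unfolding tensor_null_def tensor_relations_def
  by (rule pm.span_minimal[OF _ S]) (use assms(2-) in auto)

lemma single_W: "a \<in> carr A \<Longrightarrow> b \<in> carr B \<Longrightarrow> single (a, b) c \<in> carr W"
  unfolding W_simps by auto

lemma W_subspace: "pm.subspace (carr W)"
  unfolding W_simps by (rule pm_keys_subspace)

lemma N_W: "N \<subseteq> carr W"
  by (rule N_induct[OF W_subspace])
    (intro pm.subspace_diff[OF W_subspace] single_W A.add_closed B.add_closed A.smul_closed B.smul_closed; assumption)+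

lemma W_induct:
  assumes "f \<in> carr W" and S: "pm.subspace S"
    and "\<And>a b. a \<in> carr A \<Longrightarrow> b \<in> carr B \<Longrightarrow> single (a, b) 1 \<in> S"
  shows "f \<in> S"
  apply (subst pm_expand[of f])
  apply (rule pm.lext_in_subspace[OF S])
  using assms unfolding W_simps by auto

lemma mul_W: assumes "f \<in> carr W" "g \<in> carr W" shows "f ** g \<in> carr W"
proof -
  have "keys (f ** g) \<subseteq> carr A \<times> carr B"
    unfolding tmul_eq by (rule pm_bilin_keys) (use assms in \<open>auto simp: W_simps subset_iff intro!: A.mul_closed B.mul_closed\<close>)
  then show ?thesis unfolding W_simps by simp
qed

lemma N_ideal_left: assumes f: "f \<in> carr W" and n: "n \<in> N" shows "f ** n \<in> N"
proof -
  have 1: "n \<in> {n. single (a, b) 1 ** n \<in> N}" if ab: "a \<in> carr A" "b \<in> carr B" for a b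
  proof -
    have "N \<subseteq> {n. single (a, b) 1 ** n \<in> N}"
      apply (rule N_induct)
      subgoal by (simp add: pm.subspace_def tmul_lin N_closed)
      using ab by (simp_all add: tmul_lin A.mul_closed B.mul_closed A.mul_add_right B.mul_add_right
          A.mul_smul_right B.mul_smul_right N_rel)
    then show ?thesis using n by blast
  qed
  have "f \<in> {f. f ** n \<in> N}"
    by (rule W_induct[OF f]) (use 1 in \<open>auto simp: pm.subspace_def tmul_lin N_closed\<close>)
  then show ?thesis by simp
qed

lemma N_ideal_right: assumes f: "f \<in> carr W" and n: "n \<in> N" shows "n ** f \<in> N"
proof -
  have 1: "n \<in> {n. n ** single (a, b) 1 \<in> N}" if ab: "a \<in> carr A" "b \<in> carr B" for a b
  proof -
    have "N \<subseteq> {n. n ** single (a, b) 1 \<in> N}"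
      apply (rule N_induct)
      subgoal by (simp add: pm.subspace_def tmul_lin N_closed)
      using ab by (simp_all add: tmul_lin A.mul_closed B.mul_closed A.mul_add_left B.mul_add_left
          A.mul_smul_left B.mul_smul_left N_rel)
    then show ?thesis using n by blast
  qed
  have "f \<in> {f. n ** f \<in> N}"
    by (rule W_induct[OF f]) (use 1 in \<open>auto simp: pm.subspace_def tmul_lin N_closed\<close>)
  then show ?thesis by simp
qed

sublocale T: coset_ideal W N
proof
  fix x y i j :: "'a \<times> 'b \<Rightarrow>\<^sub>0 'f" and c :: 'f
  assume x: "x \<in> carr W" and i: "i \<in> N"
  show "smul W c (x + i) - smul W c x \<in> N"
    unfolding W_simps using N_closed i by (simp add: pm.scale_right_distrib)
  assume y: "y \<in> carr W" and j: "j \<in> N"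
  have "(x + i) ** (y + j) - x ** y = x ** j + (i ** y + i ** j)"
    by (simp add: tmul_lin algebra_simps)
  then show "(x + i) ** (y + j) - x ** y \<in> N"
    using N_ideal_left[OF x j] N_ideal_right[OF y i] N_ideal_left[OF subsetD[OF N_W i] j]
    by (simp add: N_closed(1))
qed (simp_all add: W_simps N_closed)

lemma tensor_quot: "tensor A B = alg_quot W N"
  unfolding tensor_def by simp

text \<open>
  The universal property: the linear extension of a bilinear map is defined on the tensor product.
\<close>

lemma N_kernel:
  assumes V: "lin_space sc"
    and "\<And>a a' b. a \<in> carr A \<Longrightarrow> a' \<in> carr A \<Longrightarrow> b \<in> carr B \<Longrightarrow> h (add A a a', b) = h (a, b) + h (a', b)"
    and "\<And>a b b'. a \<in> carr A \<Longrightarrow> b \<in> carr B \<Longrightarrow> b' \<in> carr B \<Longrightarrow> h (a, add B b b') = h (a, b) + h (a, b')"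
    and "\<And>a b c. a \<in> carr A \<Longrightarrow> b \<in> carr B \<Longrightarrow> h (smul A c a, b) = sc c (h (a, b))"
    and "\<And>a b c. a \<in> carr A \<Longrightarrow> b \<in> carr B \<Longrightarrow> h (a, smul B c b) = sc c (h (a, b))"
    and n: "n \<in> N"
  shows "lext sc h n = 0"
proof -
  interpret V: lin_space sc by fact
  have "N \<subseteq> {n. lext sc h n = 0}"
    by (rule N_induct) (simp_all add: pm.subspace_def V.lext_add V.lext_scale V.lext_diff assms)
  then show ?thesis using n by blast
qed

end

section \<open>Identities read off from the Grassmann envelope\<close>

lemma grassmann_simps: "carr grassmann = {g. keys g \<subseteq> {S. finite S}}" "zer grassmann = 0"
  "add grassmann = (+)" "smul grassmann = pm_scale" "mul grassmann = pm_bilin grassmann_basis_mul"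
  "even_part grassmann = {g. keys g \<subseteq> {S. finite S \<and> even (card S)}}"
  "odd_part grassmann = {g. keys g \<subseteq> {S. finite S \<and> odd (card S)}}"
  unfolding grassmann_def by simp_all

lemma nonassoc_grassmann: "nonassoc_algebra (grassmann :: ('f::field, nat set \<Rightarrow>\<^sub>0 'f) superalg)"
proof -
  have S: "pm.subspace {g :: nat set \<Rightarrow>\<^sub>0 'f. keys g \<subseteq> {S. finite S}}" by (rule pm_keys_subspace)
  have m: "keys (pm_bilin grassmann_basis_mul x y) \<subseteq> {S. finite S}"
    if "keys x \<subseteq> {S. finite S}" "keys y \<subseteq> {S. finite S}" for x y :: "nat set \<Rightarrow>\<^sub>0 'f"
    by (rule pm_bilin_keys) (use that in \<open>auto simp: grassmann_basis_mul_def\<close>)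
  have n: "\<exists>y. keys y \<subseteq> {S. finite S} \<and> x + y = 0" if "keys x \<subseteq> {S. finite S}" for x :: "nat set \<Rightarrow>\<^sub>0 'f"
    using pm.subspace_neg[OF S] that by (intro exI[of _ "- x"]) simp
  show ?thesis
    by unfold_locales
      (use pm.subspace_add[OF S] pm.subspace_scale[OF S] m n in
        \<open>auto simp: grassmann_simps algebra_simps pm_bilin_lin pm.scale_left_distrib pm.scale_right_distrib\<close>)
qed

definition gr :: "nat set \<Rightarrow> nat set \<Rightarrow>\<^sub>0 'f::field" where "gr S = single S 1"

lemma gr_mul:
  "mul grassmann (gr {}) (gr S) = gr S" "mul grassmann (gr S) (gr {}) = gr S"
  "mul grassmann (gr {0}) (gr {1}) = gr {0, 1}" "mul grassmann (gr {1}) (gr {0}) = - gr {0, 1}"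
proof -
  have c1: "{(i, j). i = Suc 0 \<and> j = 0 \<and> j < i} = {(Suc 0, 0)}" by auto
  have c2: "{(i, j). i = 0 \<and> j = Suc 0 \<and> j < i} = {}" by auto
  show "mul grassmann (gr {}) (gr S) = gr S" "mul grassmann (gr S) (gr {}) = gr S"
    "mul grassmann (gr {0}) (gr {1}) = gr {0, 1}" "mul grassmann (gr {1}) (gr {0}) = - gr {0, 1}"
    by (simp_all add: grassmann_simps gr_def pm_bilin_single grassmann_basis_mul_def insert_commute c1 c2
        flip: single_uminus)
qed

locale malcev_super =
  fixes scale :: "'f::field \<Rightarrow> 'm::ab_group_add \<Rightarrow> 'm" (infixr "*s" 69)
    and mult :: "'m \<Rightarrow> 'm \<Rightarrow> 'm" (infixl "\<cdot>" 80)
    and M0 M1 :: "'m set" and M :: "('f, 'm) superalg"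
  assumes M_eq: "M = graded (type_alg scale mult) M0 M1"
    and malcev: "malcev_superalgebra M"
begin

lemma M_simps: "carr M = UNIV" "zer M = 0" "add M = (+)" "smul M = scale" "mul M = mult"
  "even_part M = M0" "odd_part M = M1" "parity_part M 0 = M0" "parity_part M 1 = M1" "parity_part M (Suc 0) = M1"
  unfolding M_eq graded_def type_alg_def parity_part_def by simp_all

sublocale M: superalgebra M
  using malcev unfolding malcev_superalgebra_def by blast

sublocale lin_space scale
  using M.smul_add M.add_smul M.smul_smul M.smul_one
  by unfold_locales (simp_all add: M_simps)

lemma mult_lins: "(x + y) \<cdot> z = x \<cdot> z + y \<cdot> z" "x \<cdot> (y + z) = x \<cdot> y + x \<cdot> z"
    "(r *s x) \<cdot> y = r *s (x \<cdot> y)" "x \<cdot> (r *s y) = r *s (x \<cdot> y)"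
  using M.mul_add_left M.mul_add_right M.mul_smul_left M.mul_smul_right by (simp_all add: M_simps)

lemma mult_negs: "(- x) \<cdot> y = - (x \<cdot> y)" "x \<cdot> (- y) = - (x \<cdot> y)"
  using mult_lins(3)[of "-1" x y] mult_lins(4)[of x "-1" y] by simp_all

lemma mult_diffs: "(x - y) \<cdot> z = x \<cdot> z - y \<cdot> z" "x \<cdot> (y - z) = x \<cdot> y - x \<cdot> z"
  using mult_lins(1)[of x "-y" z] mult_lins(2)[of x y "-z"] by (simp_all add: mult_negs)

lemma part_sub: "subspace (parity_part M p)"
  using M.part_subspace[of p] unfolding lin_subspace_def subspace_def M_simps by blast

lemma part_split: "\<exists>a\<in>M0. \<exists>b\<in>M1. x = a + b"
  using M.part_sum[of x] by (simp add: M_simps)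

lemma part_inter: "x \<in> M0 \<Longrightarrow> x \<in> M1 \<Longrightarrow> x = 0"
  using M.part_disjoint by (auto simp: M_simps)

sublocale tensor_pair "grassmann :: ('f, nat set \<Rightarrow>\<^sub>0 'f) superalg" M
  unfolding tensor_pair_def using nonassoc_grassmann M.nonassoc_algebra_axioms by blast

notation tmul (infixl "**" 70)

abbreviation \<Gamma> where "\<Gamma> \<equiv> grassmann_envelope M"

text \<open>
  Representatives of elements of the envelope. Computing with them, modulo the null space \<open>N\<close>, keeps
  all sums in a type instead of a quotient.
\<close>

definition reps where "reps = {f \<in> carr W. T.cs f \<in> carr \<Gamma>}"

sublocale \<Gamma>: malcev_algebra \<Gamma>
  using malcev unfolding malcev_superalgebra_def by blast

lemma \<Gamma>_simps: "zer \<Gamma> = T.cs 0" "add \<Gamma> = add (alg_quot W N)" "mul \<Gamma> = mul (alg_quot W N)"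
  unfolding grassmann_envelope_def Let_def restr_def tensor_quot by (simp_all add: T.cs_zer)

lemma reps_W: "f \<in> reps \<Longrightarrow> f \<in> carr W" unfolding reps_def by blast

lemma reps_add: "f \<in> reps \<Longrightarrow> h \<in> reps \<Longrightarrow> f + h \<in> reps"
  using \<Gamma>.add_closed[of "T.cs f" "T.cs h"] pm.subspace_add[OF W_subspace]
  unfolding reps_def by (auto simp: \<Gamma>_simps T.cs_add)

lemma reps_mul: "f \<in> reps \<Longrightarrow> h \<in> reps \<Longrightarrow> f ** h \<in> reps"
  using \<Gamma>.mul_closed[of "T.cs f" "T.cs h"] mul_W
  unfolding reps_def by (auto simp: \<Gamma>_simps T.cs_mul)

lemma reps_single:
  assumes "S \<in> {{}} \<and> x \<in> M0 \<or> (\<exists>i. S = {i}) \<and> x \<in> M1"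
  shows "single (gr S, x) 1 \<in> reps"
proof -
  let ?G = "grassmann :: ('f, nat set \<Rightarrow>\<^sub>0 'f) superalg"
  have "single (gr S, x) 1 \<in> carr W"
    by (rule single_W) (use assms in \<open>auto simp: grassmann_simps gr_def M_simps\<close>)
  moreover have "T.cs (single (gr S, x) 1) \<in> carr \<Gamma>"
  proof -
    have c: "carr \<Gamma> = {add (alg_quot W N) x y | x y. x \<in> tensor_sub ?G M (even_part ?G) M0 \<and>
        y \<in> tensor_sub ?G M (odd_part ?G) M1}"
      unfolding grassmann_envelope_def Let_def restr_def tensor_quot by (simp add: M_simps)
    have z: "T.cs 0 \<in> tensor_sub ?G M P Q" for P Q
      unfolding tensor_sub_def by (rule imageI) simp
    have t: "T.cs (single (gr S, x) 1) \<in> tensor_sub ?G M P Q" if "gr S \<in> P" "x \<in> Q" for P Q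
      unfolding tensor_sub_def by (rule imageI) (use that in simp)
    have "gr S \<in> even_part ?G \<and> x \<in> M0 \<or> gr S \<in> odd_part ?G \<and> x \<in> M1"
      using assms by (auto simp: grassmann_simps gr_def)
    then show ?thesis
    proof (elim disjE conjE)
      assume "gr S \<in> even_part ?G" "x \<in> M0"
      from t[OF this] z show ?thesis
        unfolding c mem_Collect_eq
        by (intro exI[of _ "T.cs (single (gr S, x) 1)"] exI[of _ "T.cs 0"]) (simp add: T.cs_add)
    next
      assume "gr S \<in> odd_part ?G" "x \<in> M1"
      from t[OF this] z show ?thesis
        unfolding c mem_Collect_eq
        by (intro exI[of _ "T.cs 0"] exI[of _ "T.cs (single (gr S, x) 1)"]) (simp add: T.cs_add)
    qed
  qed
  ultimately show ?thesis unfolding reps_def by blast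
qed

definition jac where "jac x y z = (x ** y) ** z + (y ** z) ** x + (z ** x) ** y"

lemma reps_square: "f \<in> reps \<Longrightarrow> f ** f \<in> N"
  using \<Gamma>.square_zero[of "T.cs f"] reps_W[of f] unfolding reps_def 
  by (auto simp: \<Gamma>_simps T.cs_mul T.cs_eq)

lemma reps_anti: assumes "f \<in> reps" "h \<in> reps" shows "f ** h + h ** f \<in> N"
proof -
  have "(f + h) ** (f + h) - f ** f - h ** h \<in> N"
    by (intro N_closed(2) reps_square reps_add assms)
  then show ?thesis by (simp add: tmul_lin algebra_simps)
qed

lemma reps_malcev: assumes "x \<in> reps" "y \<in> reps" "z \<in> reps" shows "jac x y (x ** z) - jac x y z ** x \<in> N"
proof -
  have c: "T.cs x \<in> carr \<Gamma>" "T.cs y \<in> carr \<Gamma>" "T.cs z \<in> carr \<Gamma>" using assms unfolding reps_def by auto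
  have j: "jacobian \<Gamma> (T.cs x) (T.cs y) (T.cs z) = T.cs (jac x y z) \<and> jac x y z \<in> reps" 
    if "x \<in> reps" "y \<in> reps" "z \<in> reps" for x y z
    using that unfolding jacobian_def jac_def
    by (simp add: \<Gamma>_simps T.cs_mul T.cs_add reps_W reps_mul reps_add)
  show ?thesis using \<Gamma>.malcev_identity[OF c] assms j[of x y "x ** z"] j[of x y z]
    by (simp add: reps_mul reps_W T.cs_mul T.cs_eq \<Gamma>_simps)
qed

lemma reps_malcev_lin:
  assumes "x \<in> reps" "w \<in> reps" "y \<in> reps" "z \<in> reps"
  shows "jac x y (w ** z) + jac w y (x ** z) - jac x y z ** w - jac w y z ** x \<in> N"
proof -
  define Q where "Q x = jac x y (x ** z) - jac x y z ** x" for x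
  have "Q (x + w) - Q x - Q w \<in> N"
    unfolding Q_def by (intro N_closed(2) reps_malcev reps_add assms)
  then show ?thesis unfolding Q_def jac_def by (simp add: tmul_lin algebra_simps)
qed

text \<open>
  The coordinate at the Grassmann basis element \<open>e\<^sub>S\<close>, a linear map on \<open>G \<otimes> M\<close>. Applied to an identity of
  the envelope that is evaluated at pure tensors, it yields the corresponding identity of \<open>M\<close>.
\<close>

definition \<theta> where "\<theta> S = lext scale (\<lambda>(g, x). lookup g S *s x)"

lemma \<theta>_N: assumes "n \<in> N" shows "\<theta> S n = 0"
  unfolding \<theta>_def 
  by (rule N_kernel[OF lin_space_axioms _ _ _ _ assms])
    (simp_all add: grassmann_simps M_simps lookup_add scale_left_distrib scale_right_distrib mult.commute)

lemma \<theta>_lin: "\<theta> S (f + h) = \<theta> S f + \<theta> S h" "\<theta> S (f - h) = \<theta> S f - \<theta> S h"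
  "\<theta> S (single (g, x) c) = c *s lookup g S *s x"
  unfolding \<theta>_def by (simp_all add: lext_add lext_diff)

lemma lookup_gr: "lookup (gr S) S = 1" "lookup (- gr S) S = -1"
  unfolding gr_def by simp_all

text \<open>
  The tensor \<open>e\<^sub>S \<otimes> v\<close> with this \<open>S\<close> lies in the envelope.
\<close>

abbreviation hom_pair :: "nat set \<Rightarrow> 'm \<Rightarrow> bool" where "hom_pair S v \<equiv> S = {} \<and> v \<in> M0 \<or> S = {0} \<and> v \<in> M1"

lemma even_square: assumes "a \<in> M0" shows "a \<cdot> a = 0"
proof -
  let ?f = "single (gr {}, a) (1::'f)"
  have "\<theta> {} (?f ** ?f) = 0" using assms by (intro \<theta>_N reps_square reps_single) auto
  then show ?thesis by (simp add: \<theta>_lin gr_mul lookup_gr M_simps)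
qed

lemma even_anti: assumes "a \<in> M0" shows "a \<cdot> v = - (v \<cdot> a)"
proof -
  have h: "a \<cdot> v = - (v \<cdot> a)" if v: "hom_pair S v" for S v
  proof -
    let ?f = "single (gr {}, a) (1::'f)" and ?h = "single (gr S, v) (1::'f)"
    have "\<theta> S (?f ** ?h + ?h ** ?f) = 0" using assms v by (intro \<theta>_N reps_anti reps_single) auto
    then show ?thesis by (simp add: \<theta>_lin gr_mul lookup_gr M_simps eq_neg_iff_add_eq_0)
  qed
  obtain v0 v1 where "v0 \<in> M0" "v1 \<in> M1" "v = v0 + v1" using part_split by blast
  then show ?thesis using h[of "{}" v0] h[of "{0}" v1] by (simp add: mult_lins)
qed

lemma odd_comm: assumes "v \<in> M1" "w \<in> M1" shows "v \<cdot> w = w \<cdot> v"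
proof -
  let ?f = "single (gr {0}, v) (1::'f)" and ?h = "single (gr {1}, w) (1::'f)"
  have "\<theta> {0,1} (?f ** ?h + ?h ** ?f) = 0" using assms by (intro \<theta>_N reps_anti reps_single) auto
  then show ?thesis by (simp add: \<theta>_lin gr_mul lookup_gr M_simps del: One_nat_def)
qed

definition jacM where "jacM x y z = x \<cdot> y \<cdot> z + y \<cdot> z \<cdot> x + z \<cdot> x \<cdot> y"

text \<open>
  With only one argument outside the even part, every term of the linearised Malcev identity
  has the same Grassmann factor, so that no signs occur.
\<close>

lemma malcev_one:
  assumes E: "w \<in> M0" "y \<in> M0" "z \<in> M0"
  shows "jacM v y (w \<cdot> z) + jacM w y (v \<cdot> z) - jacM v y z \<cdot> w - jacM w y z \<cdot> v = 0"
proof -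
  have h: "jacM v y (w \<cdot> z) + jacM w y (v \<cdot> z) - jacM v y z \<cdot> w - jacM w y z \<cdot> v = 0" if v: "hom_pair S v" for S v
  proof -
    let ?s = "\<lambda>x. single (gr {}, x) (1::'f)" and ?h = "single (gr S, v) (1::'f)"
    have "\<theta> S (jac ?h (?s y) (?s w ** ?s z) + jac (?s w) (?s y) (?h ** ?s z) - jac ?h (?s y) (?s z) ** ?s w
       - jac (?s w) (?s y) (?s z) ** ?h) = 0"
      using E v by (intro \<theta>_N reps_malcev_lin reps_single) auto
    then show ?thesis
      by (simp add: \<theta>_lin jac_def tmul_lin gr_mul lookup_gr M_simps jacM_def mult_lins)
  qed
  obtain v0 v1 where v: "v0 \<in> M0" "v1 \<in> M1" "v = v0 + v1" using part_split by blast
  have "jacM v y (w \<cdot> z) + jacM w y (v \<cdot> z) - jacM v y z \<cdot> w - jacM w y z \<cdot> v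
    = (jacM v0 y (w \<cdot> z) + jacM w y (v0 \<cdot> z) - jacM v0 y z \<cdot> w - jacM w y z \<cdot> v0)
     + (jacM v1 y (w \<cdot> z) + jacM w y (v1 \<cdot> z) - jacM v1 y z \<cdot> w - jacM w y z \<cdot> v1)"
    unfolding v(3) jacM_def by (simp add: mult_lins algebra_simps)
  then show ?thesis using h[of "{}" v0] h[of "{0}" v1] v by simp
qed

lemma even_mult: "a \<in> M0 \<Longrightarrow> b \<in> M0 \<Longrightarrow> a \<cdot> b \<in> M0"
  using M.part_mul[of a 0 b 0] by (simp add: M_simps)

text \<open>
  Sagle's identity is half of a combination of three instances of the linearised Malcev identity.
\<close>

lemma sagle_one:
  assumes two: "(2::'f) \<noteq> 0" and E: "y \<in> M0" "z \<in> M0" "t \<in> M0"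
  shows "(v \<cdot> z) \<cdot> (y \<cdot> t) = v \<cdot> y \<cdot> z \<cdot> t - v \<cdot> t \<cdot> y \<cdot> z - v \<cdot> ((y \<cdot> z) \<cdot> t) - v \<cdot> (z \<cdot> t) \<cdot> y"
proof -
  define s where "s = (v \<cdot> z) \<cdot> (y \<cdot> t) - (v \<cdot> y \<cdot> z \<cdot> t - v \<cdot> t \<cdot> y \<cdot> z - v \<cdot> ((y \<cdot> z) \<cdot> t) - v \<cdot> (z \<cdot> t) \<cdot> y)"
  note a = even_anti[OF E(1), of v] even_anti[OF E(2), of v] even_anti[OF E(3), of v]
    even_anti[OF E(1), of "v \<cdot> w" for w] even_anti[OF E(2), of "v \<cdot> w" for w] even_anti[OF E(3), of "v \<cdot> w" for w]
    even_anti[OF E(1), of "v \<cdot> w \<cdot> w'" for w w'] even_anti[OF E(2), of "v \<cdot> w \<cdot> w'" for w w'] even_anti[OF E(3), of "v \<cdot> w \<cdot> w'" for w w']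
    even_anti[OF even_mult[OF E(1,2)], of v] even_anti[OF even_mult[OF E(1,3)], of v] even_anti[OF even_mult[OF E(2,3)], of v]
    even_anti[OF even_mult[OF E(1,2)], of "v \<cdot> w" for w] even_anti[OF even_mult[OF E(1,3)], of "v \<cdot> w" for w] even_anti[OF even_mult[OF E(2,3)], of "v \<cdot> w" for w]
    even_anti[OF even_mult[OF even_mult[OF E(1,2)] E(3)], of v] even_anti[OF even_mult[OF even_mult[OF E(1,3)] E(2)], of v]
    even_anti[OF even_mult[OF even_mult[OF E(2,3)] E(1)], of v]
  note b = even_anti[OF E(2), of y] even_anti[OF E(3), of y] even_anti[OF E(3), of z]
    even_anti[OF E(1), of "z \<cdot> t"] even_anti[OF E(2), of "y \<cdot> t"] even_anti[OF E(3), of "y \<cdot> z"]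
  have "s + s = (jacM v z (y \<cdot> t) + jacM y z (v \<cdot> t) - jacM v z t \<cdot> y - jacM y z t \<cdot> v)
    + (jacM v y (t \<cdot> z) + jacM t y (v \<cdot> z) - jacM v y z \<cdot> t - jacM t y z \<cdot> v)
    - (jacM v t (z \<cdot> y) + jacM z t (v \<cdot> y) - jacM v t y \<cdot> z - jacM z t y \<cdot> v)"
    unfolding s_def jacM_def by (simp add: mult_lins mult_negs mult_diffs a b algebra_simps)
  also have "\<dots> = 0" using malcev_one E by simp
  finally have "s + s = 0" .
  then have "2 *s s = 0" using scale_left_distrib[of 1 1 s] by simp
  then have "s = 0" using two by simp
  then show ?thesis unfolding s_def by simp
qed

abbreviation tri where "tri \<equiv> triple_product scale mult"

text \<open>
  The identity without signs is bilinear in \<open>n\<close> and \<open>m\<close>, so it extends from homogeneous to all elements.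
\<close>

lemma class_H_two:
  assumes H: "in_class_H M" and E: "z \<in> M0" "x \<in> M0" "u \<in> M0"
  shows "tri (n \<cdot> z) m u \<cdot> x + tri (n \<cdot> z) m x \<cdot> u + tri (n \<cdot> x) z u \<cdot> m + tri (n \<cdot> u) z x \<cdot> m = 0"
    (is "?h n m = 0")
proof -
  have h: "?h n m = 0" if "n \<in> parity_part M q" "m \<in> parity_part M p" for n m p q
  proof -
    have "super_h M 0 p 0 0 n z m x u = 0"
      using H that E unfolding in_class_H_def by (metis M_simps(2,8))
    then show ?thesis unfolding super_h_def supertriple_def triple_product_def by (simp add: M_simps)
  qed
  have add1: "?h (n + n') m = ?h n m + ?h n' m" and add2: "?h n (m + m') = ?h n m + ?h n m'" for n n' m m'
    unfolding triple_product_def by (simp_all add: mult_lins mult_diffs algebra_simps)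
  obtain n0 n1 where n: "n0 \<in> M0" "n1 \<in> M1" "n = n0 + n1" using part_split by blast
  obtain m0 m1 where m: "m0 \<in> M0" "m1 \<in> M1" "m = m0 + m1" using part_split by blast
  show ?thesis unfolding n(3) m(3) add1 add2
    using h[of n0 0 m0 0] h[of n0 0 m1 1] h[of n1 1 m0 0] h[of n1 1 m1 1] n m M_simps(8,9) by simp
qed

end

section \<open>The exceptional algebras as vector products\<close>

lemma char_nz:
  assumes "CHAR('f::field) \<noteq> 2" "CHAR('f) \<noteq> 3"
  shows "(2::'f) \<noteq> 0" "(3::'f) \<noteq> 0"
proof -
  have "\<not> CHAR('f) dvd n" if "n \<noteq> CHAR('f)" "n = 2 \<or> n = 3" for n
  proof
    assume d: "CHAR('f) dvd n"
    then have "CHAR('f) \<le> 3" "CHAR('f) \<noteq> 0" using that by (auto dest: dvd_imp_le)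
    moreover have "c \<le> 3 \<Longrightarrow> c \<noteq> 0 \<Longrightarrow> c \<in> {1, 2, 3}" for c :: nat by auto
    ultimately have "CHAR('f) \<in> {1, 2, 3}" by blast
    then show False using d that CHAR_not_1[where 'a = 'f] by auto
  qed
  then have "(of_nat 2 :: 'f) \<noteq> 0" "(of_nat 3 :: 'f) \<noteq> 0"
    using of_nat_eq_0_iff_char_dvd[where 'a = 'f] assms by metis+
  then show "(2::'f) \<noteq> 0" "(3::'f) \<noteq> 0" by simp_all
qed

text \<open>
  All that will be used about an exceptional algebra. The last conjunct provides a triple.
\<close>

definition cross_form :: "('f::field \<Rightarrow> 'm::ab_group_add \<Rightarrow> 'm) \<Rightarrow> ('m \<Rightarrow> 'm \<Rightarrow> 'm) \<Rightarrow> 'm set \<Rightarrow> ('m \<Rightarrow> 'm \<Rightarrow> 'f) \<Rightarrow> bool" where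
  "cross_form scale mult E g \<longleftrightarrow>
     (\<forall>a\<in>E. \<forall>b\<in>E. g a b = g b a) \<and> (\<forall>a\<in>E. \<forall>b\<in>E. \<forall>c\<in>E. g (a + b) c = g a c + g b c) \<and>
     (\<forall>r. \<forall>a\<in>E. \<forall>b\<in>E. g (scale r a) b = r * g a b) \<and>
     (\<forall>x\<in>E. \<forall>y\<in>E. mult (mult x y) y = scale (g y y) x - scale (g x y) y) \<and>
     (\<exists>a\<in>E. \<exists>b\<in>E. \<exists>c\<in>E. g a b = 0 \<and> g a c = 0 \<and> g b c = 0 \<and> g (mult a b) c = 0 \<and>
        g a a \<noteq> 0 \<and> g b b \<noteq> 0 \<and> g c c \<noteq> 0)"

text \<open>
  For an algebra with a unit it is enough to verify the vector product identity for commutators modulo the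
  line of the unit, with a form that does not see the unit; an isomorphism transports it to \<open>E\<close>
  by means of representatives of cosets.
\<close>

lemma commutator_quotient_cross_form:
  fixes sc :: "'f::field \<Rightarrow> 'v::ab_group_add \<Rightarrow> 'v" and mu :: "'v \<Rightarrow> 'v \<Rightarrow> 'v" and G :: "'v \<Rightarrow> 'v \<Rightarrow> 'f"
    and unit :: 'v and scale :: "'f \<Rightarrow> 'm::ab_group_add \<Rightarrow> 'm" and mult :: "'m \<Rightarrow> 'm \<Rightarrow> 'm"
  defines "I \<equiv> {sc c unit | c. True}"
    and "com \<equiv> \<lambda>x y. mu x y + sc (-1) (mu y x)"
  assumes sc: "\<And>r x y. sc r (x + y) = sc r x + sc r y" "\<And>r s x. sc (r + s) x = sc r x + sc s x"
      "\<And>r s x. sc r (sc s x) = sc (r * s) x" "\<And>x. sc 1 x = x"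
    and com: "\<And>x y z. com (x + y) z = com x z + com y z" "\<And>x y z. com z (x + y) = com z x + com z y"
      "\<And>c x. com (sc c unit) x = 0" "\<And>c x. com x (sc c unit) = 0"
    and G: "\<And>x y. G x y = G y x" "\<And>x y z. G (x + y) z = G x z + G y z" "\<And>r x y. G (sc r x) y = r * G x y"
      "\<And>c x. G (sc c unit) x = 0"
    and cross: "\<And>x y. \<exists>c. com (com x y) y + sc (- G y y) x + sc (G x y) y = sc c unit"
    and triple: "G x1 x2 = 0" "G x1 x3 = 0" "G x2 x3 = 0" "G (com x1 x2) x3 = 0"
      "G x1 x1 \<noteq> 0" "G x2 x2 \<noteq> 0" "G x3 x3 \<noteq> 0"
    and M: "M = graded (type_alg scale mult) M0 M1" and E: "subalgebra M E"
    and vs: "vector_space scale"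
    and iso: "alg_isomorphic (restr M E) (alg_quot (commutator_alg (type_alg sc mu)) I)"
  shows "\<exists>g. cross_form scale mult E g"
proof -
  let ?X = "commutator_alg (type_alg sc mu)"
  interpret vs: vector_space scale by (rule vs)
  have X: "carr ?X = UNIV" "zer ?X = 0" "add ?X = (+)" "smul ?X = sc" "mul ?X = com"
    unfolding commutator_alg_def type_alg_def com_def by simp_all
  have sc0: "sc r 0 = 0" "sc 0 x = 0" for r x
    using sc(1)[of r 0 0] sc(2)[of 0 0 x] by simp_all
  have scm: "sc (- r) x = - sc r x" for r x
    using sc(2)[of r "- r" x] sc0 by (simp add: eq_neg_iff_add_eq_0 add.commute)
  have I: "0 \<in> I" "i \<in> I \<Longrightarrow> j \<in> I \<Longrightarrow> i - j \<in> I" "i \<in> I \<Longrightarrow> sc r i \<in> I" for i j r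
  proof -
    show "0 \<in> I" unfolding I_def using sc0(2)[of unit] by (metis (mono_tags) mem_Collect_eq)
    show "sc r i \<in> I" if "i \<in> I" using that sc(3) unfolding I_def by auto
    show "i - j \<in> I" if ij: "i \<in> I" "j \<in> I"
    proof -
      obtain c d where "i = sc c unit" "j = sc d unit" using ij unfolding I_def by auto
      then have "i - j = sc (c + (- d)) unit" unfolding sc(2) scm by simp
      then show ?thesis unfolding I_def by blast
    qed
  qed
  have comI: "com i x = 0" "com x i = 0" and GI: "G i x = 0" if "i \<in> I" for i x
    using that com(3,4) G(4) unfolding I_def by auto
  interpret Q: coset_ideal ?X I
    by unfold_locales (simp_all add: X I sc com comI)
  obtain \<phi> where \<phi>: "alg_hom_bij \<phi> (restr M E) (alg_quot ?X I)" using iso unfolding alg_isomorphic_def by blast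
  have R: "carr (restr M E) = E" "zer (restr M E) = 0" "add (restr M E) = (+)" "smul (restr M E) = scale" "mul (restr M E) = mult"
    unfolding restr_def M graded_def type_alg_def by simp_all
  have bij: "bij_betw \<phi> E (range Q.cs)"
    and \<phi>_add: "\<And>x y. x \<in> E \<Longrightarrow> y \<in> E \<Longrightarrow> \<phi> (x + y) = add (alg_quot ?X I) (\<phi> x) (\<phi> y)"
    and \<phi>_smul: "\<And>c x. x \<in> E \<Longrightarrow> \<phi> (scale c x) = smul (alg_quot ?X I) c (\<phi> x)"
    and \<phi>_mul: "\<And>x y. x \<in> E \<Longrightarrow> y \<in> E \<Longrightarrow> \<phi> (mult x y) = mul (alg_quot ?X I) (\<phi> x) (\<phi> y)"
    using \<phi> unfolding alg_hom_bij_def R Q.cs_carr X by auto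
  have Ecl: "x + y \<in> E" "scale c x \<in> E" "mult x y \<in> E" if "x \<in> E" "y \<in> E" for x y c
    using E that unfolding subalgebra_def lin_subspace_def M graded_def type_alg_def by auto
  have Ed: "x - y \<in> E" if "x \<in> E" "y \<in> E" for x y
    using Ecl(1)[OF that(1) Ecl(2)[OF that(2,2)], of "-1"] by simp
  define r where "r a = (SOME v. \<phi> a = Q.cs v)" for a
  have r: "\<phi> a = Q.cs (r a)" if "a \<in> E" for a
  proof -
    have "\<phi> a \<in> range Q.cs" using bij that unfolding bij_betw_def by blast
    then obtain v where "\<phi> a = Q.cs v" by blast
    then show ?thesis unfolding r_def by (rule someI)
  qed
  have inj: "a = b" if "a \<in> E" "b \<in> E" "r a - r b \<in> I" for a b
  proof -
    have "\<phi> a = \<phi> b" using r[OF that(1)] r[OF that(2)] that(3) unfolding Q.cs_eq[symmetric] by simp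
    then show ?thesis using bij that unfolding bij_betw_def inj_on_def by blast
  qed
  have r_add: "r (a + b) - (r a + r b) \<in> I" if "a \<in> E" "b \<in> E" for a b
    using r[OF Ecl(1)[OF that]] r[OF that(1)] r[OF that(2)] \<phi>_add[OF that] Q.cs_add[of "r a" "r b"]
    unfolding Q.cs_eq[symmetric] by simp
  have r_sc: "r (scale c a) - sc c (r a) \<in> I" if "a \<in> E" for a c
    using r[OF Ecl(2)[OF that that], of c] r[OF that] \<phi>_smul[OF that, of c] Q.cs_smul[of "r a" c]
    unfolding Q.cs_eq[symmetric] by (simp add: X)
  have r_mul: "r (mult a b) - com (r a) (r b) \<in> I" if "a \<in> E" "b \<in> E" for a b
    using r[OF Ecl(3)[OF that]] r[OF that(1)] r[OF that(2)] \<phi>_mul[OF that] Q.cs_mul[of "r a" "r b"]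
    unfolding Q.cs_eq[symmetric] by (simp add: X)
  have Iadd: "i + j \<in> I" if "i \<in> I" "j \<in> I" for i j using Q.I_add that .
  have GI': "G x z = G y z" if "x - y \<in> I" for x y z
    using GI[OF that, of z] G(2)[of "x - y" y z] by simp
  have comI': "com x z = com y z" if "x - y \<in> I" for x y z
    using comI(1)[OF that, of z] com(1)[of "x - y" y z] by simp
  define g where "g a b = G (r a) (r b)" for a b
  have g: "g a b = g b a" for a b unfolding g_def using G(1) .
  have surj: "\<exists>a\<in>E. r a - x \<in> I" for x
  proof -
    have "\<phi> ` E = range Q.cs" using bij by (simp add: bij_betw_def)
    then have "Q.cs x \<in> \<phi> ` E" by simp
    then obtain a where "a \<in> E" "Q.cs x = \<phi> a" by (rule imageE)
    then have "Q.cs (r a) = Q.cs x" using r by simp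
    then show ?thesis unfolding Q.cs_eq using \<open>a \<in> E\<close> by blast
  qed
  obtain a b c where abc: "a \<in> E" "r a - x1 \<in> I" "b \<in> E" "r b - x2 \<in> I" "c \<in> E" "r c - x3 \<in> I"
    using surj[of x1] surj[of x2] surj[of x3] by blast
  have gG: "g p q = G x y" if "r p - x \<in> I" "r q - y \<in> I" for p q x y
    unfolding g_def using GI'[OF that(1), of "r q"] GI'[OF that(2), of x] G(1)[of x "r q"] G(1)[of x y] by simp
  have "r (mult a b) - com x1 x2 \<in> I"
  proof -
    have "com (r a) (r b) = com x1 x2"
      using comI'[OF abc(2)] comI(2)[OF abc(4), of x1] com(2)[of x1 "r b - x2" x2] by simp
    then show ?thesis using r_mul[OF abc(1,3)] by simp
  qed
  then have t: "g a b = 0 \<and> g a c = 0 \<and> g b c = 0 \<and> g (mult a b) c = 0 \<and> g a a \<noteq> 0 \<and> g b b \<noteq> 0 \<and> g c c \<noteq> 0"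
    using triple gG[OF abc(2,4)] gG[OF abc(2,6)] gG[OF abc(4,6)] gG[OF _ abc(6), of "mult a b"]
      gG[OF abc(2,2)] gG[OF abc(4,4)] gG[OF abc(6,6)] by simp
  have gadd: "g (x + y) z = g x z + g y z" if "x \<in> E" "y \<in> E" for x y z
    unfolding g_def using GI'[OF r_add[OF that], of "r z"] G(2) by simp
  have gsc: "g (scale s x) z = s * g x z" if "x \<in> E" for x z s
    unfolding g_def using GI'[OF r_sc[OF that], of s "r z"] G(3) by simp
  have cr: "mult (mult x y) y = scale (g y y) x - scale (g x y) y" if xy: "x \<in> E" "y \<in> E" for x y
  proof (rule inj)
    let ?l = "mult (mult x y) y" and ?a = "scale (g y y) x" and ?b = "scale (g x y) y"
    have m: "mult x y \<in> E" by (rule Ecl(3)[OF xy])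
    have ab: "?a \<in> E" "?b \<in> E" by (rule Ecl(2)[OF xy(1,1)], rule Ecl(2)[OF xy(2,2)])
    show "?l \<in> E" "?a - ?b \<in> E" by (rule Ecl(3)[OF m xy(2)], rule Ed[OF ab])
    have "r ?l - com (r (mult x y)) (r y) \<in> I" by (rule r_mul[OF m xy(2)])
    moreover have "com (r (mult x y)) (r y) = com (com (r x) (r y)) (r y)"
      using comI'[OF r_mul[OF xy]] .
    ultimately have 1: "r ?l - com (com (r x) (r y)) (r y) \<in> I" by simp
    have 2: "com (com (r x) (r y)) (r y) + sc (- g y y) (r x) + sc (g x y) (r y) \<in> I"
      using cross[of "r x" "r y"] unfolding I_def g_def by blast
    have 3: "r ?a - sc (g y y) (r x) \<in> I" "r ?b - sc (g x y) (r y) \<in> I" by (rule r_sc, rule xy)+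
    have 4: "r ?a - (r (?a - ?b) + r ?b) \<in> I"
      using r_add[OF Ed[OF ab] ab(2)] by simp
    have e: "r ?l - r (?a - ?b) = (r ?l - com (com (r x) (r y)) (r y))
       + (com (com (r x) (r y)) (r y) + sc (- g y y) (r x) + sc (g x y) (r y))
       + (r ?a - (r (?a - ?b) + r ?b)) - (r ?a - sc (g y y) (r x)) + (r ?b - sc (g x y) (r y))"
      unfolding scm by (simp add: algebra_simps)
    show "r ?l - r (?a - ?b) \<in> I"
      unfolding e by (intro Iadd I(2) 1 2 3 4)
  qed
  show ?thesis unfolding cross_form_def using g gadd gsc cr t abc by blast
qed

text \<open>
  Four times the polar form of \<open>x \<mapsto> x\<^sup>2\<close> on trace zero elements, extended by zero to the unit.
\<close>

fun split_form :: "'f::field cmat \<Rightarrow> 'f cmat \<Rightarrow> 'f" where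
  "split_form (a, \<alpha>, \<beta>, b) (c, \<gamma>, \<delta>, d) = (a - b) * (c - d) + 2 * (vec3_dot \<alpha> \<delta> + vec3_dot \<beta> \<gamma>)"

text \<open>
  The same form in the coordinates of the doubling process.
\<close>

fun oct_form :: "'f::field \<Rightarrow> 'f oct \<Rightarrow> 'f oct \<Rightarrow> 'f" where
  "oct_form \<gamma> ((x0, x1, x2, x3), (x4, x5, x6, x7)) ((y0, y1, y2, y3), (y4, y5, y6, y7)) =
     4 * (\<gamma> * (x4 * y4 + x5 * y5 + x6 * y6 + x7 * y7) - (x1 * y1 + x2 * y2 + x3 * y3))"

lemma split_cross:
  fixes x y :: "'f::field cmat"
  defines "com \<equiv> \<lambda>x y :: 'f cmat. cmat_mul x y + cmat_scale (-1) (cmat_mul y x)"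
  shows "\<exists>c. com (com x y) y + cmat_scale (- split_form y y) x + cmat_scale (split_form x y) y = cmat_scale c cmat_unit"
proof -
  define e where "e = com (com x y) y + cmat_scale (- split_form y y) x + cmat_scale (split_form x y) y"
  obtain a a1 a2 a3 b1 b2 b3 b where x: "x = (a, (a1, a2, a3), (b1, b2, b3), b)" by (metis surj_pair)
  obtain c c1 c2 c3 d1 d2 d3 d where y: "y = (c, (c1, c2, c3), (d1, d2, d3), d)" by (metis surj_pair)
  have "e = cmat_scale (fst e) cmat_unit"
    unfolding e_def x y com_def by (simp add: cmat_unit_def zero_prod_def; simp add: algebra_simps)
  then show ?thesis unfolding e_def by blast
qed

lemma oct_cross:
  fixes x y :: "'f::field oct" and \<gamma> :: 'f
  defines "com \<equiv> \<lambda>x y :: 'f oct. oct_mul \<gamma> x y + oct_scale (-1) (oct_mul \<gamma> y x)"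
  shows "\<exists>c. com (com x y) y + oct_scale (- oct_form \<gamma> y y) x + oct_scale (oct_form \<gamma> x y) y = oct_scale c oct_unit"
proof -
  define e where "e = com (com x y) y + oct_scale (- oct_form \<gamma> y y) x + oct_scale (oct_form \<gamma> x y) y"
  obtain x0 x1 x2 x3 x4 x5 x6 x7 where x: "x = ((x0, x1, x2, x3), (x4, x5, x6, x7))" by (metis surj_pair)
  obtain y0 y1 y2 y3 y4 y5 y6 y7 where y: "y = ((y0, y1, y2, y3), (y4, y5, y6, y7))" by (metis surj_pair)
  have "e = oct_scale (fst (fst e)) oct_unit"
    unfolding e_def x y com_def by (simp add: oct_unit_def zero_prod_def; simp add: algebra_simps)
  then show ?thesis unfolding e_def by blast
qed

text \<open>
  The triple consists of two anticommuting elements with square \<open>-1\<close> and a third element \<open>v\<close>, orthogonal to them and to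
  their product, with \<open>v\<^sup>2 = 1\<close> in the split case and \<open>v\<^sup>2 = \<gamma>\<close> in the other one.
\<close>

lemma exceptional_cross_form:
  fixes scale :: "'f::field \<Rightarrow> 'm::ab_group_add \<Rightarrow> 'm" and mult :: "'m \<Rightarrow> 'm \<Rightarrow> 'm"
  assumes two: "(2::'f) \<noteq> 0" and M: "M = graded (type_alg scale mult) M0 M1" and E: "subalgebra M E"
    and vs: "vector_space scale" and exc: "exceptional_malcev (restr M E)"
  shows "\<exists>g. cross_form scale mult E g"
proof -
  have four: "(4::'f) \<noteq> 0"
    using two by (metis mult_eq_0_iff numeral_Bit0 mult_2 one_add_one numeral_One)
  have split: ?thesis if iso: "alg_isomorphic (restr M E) (M7_split :: ('f, 'f cmat set) alg)"
    apply (rule commutator_quotient_cross_form[where G = split_form and ?x1.0 = "(0, (1,0,0), (-1,0,0), 0)"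
        and ?x2.0 = "(0, (0,1,0), (0,-1,0), 0)" and ?x3.0 = "(1, (0,0,0), (0,0,0), -1)",
        OF _ _ _ _ _ _ _ _ _ _ _ _ split_cross _ _ _ _ _ _ _ M E vs iso[unfolded M7_split_def cayley_split_def]])
    by (simp_all only: split_paired_all)
      (simp_all add: algebra_simps cmat_unit_def zero_prod_def four)
  have div: ?thesis if \<gamma>: "\<gamma> \<noteq> 0" and iso: "alg_isomorphic (restr M E) (M7_div \<gamma>)" for \<gamma> :: 'f
    apply (rule commutator_quotient_cross_form[where G = "oct_form \<gamma>" and ?x1.0 = "((0,1,0,0), (0,0,0,0))"
        and ?x2.0 = "((0,0,1,0), (0,0,0,0))" and ?x3.0 = "((0,0,0,0), (1,0,0,0))",
        OF _ _ _ _ _ _ _ _ _ _ _ _ oct_cross _ _ _ _ _ _ _ M E vs iso[unfolded M7_div_def oct_alg_def]])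
    by (simp_all only: split_paired_all)
      (simp_all add: algebra_simps oct_unit_def zero_prod_def four \<gamma>)
  show ?thesis using exc split div unfolding exceptional_malcev_def by blast
qed

section \<open>The coordinate superalgebra\<close>

locale coordinatization = exceptional_action scale mult E g e1 e2 e3 + S: malcev_super scale mult M0 M1 M
  for scale :: "'f::field \<Rightarrow> 'm::ab_group_add \<Rightarrow> 'm" (infixr "*s" 69)
    and mult :: "'m \<Rightarrow> 'm \<Rightarrow> 'm" (infixl "\<cdot>" 80) and E g e1 e2 e3 M0 M1 M +
  assumes E_even: "E \<subseteq> M0" and class_H: "in_class_H M" and E_subalgebra: "subalgebra M E"
begin

abbreviation Mp where "Mp \<equiv> parity_part M"

lemmas Mp_closed = subspace_add[OF S.part_sub] subspace_diff[OF S.part_sub]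
  subspace_scale[OF S.part_sub] subspace_neg[OF S.part_sub] subspace_0[OF S.part_sub]

lemma Mp_mult: "x \<in> Mp p \<Longrightarrow> y \<in> Mp q \<Longrightarrow> x \<cdot> y \<in> Mp (p + q)"
  using S.M.part_mul by (simp add: S.M_simps)

lemma E_Mp: "a \<in> E \<Longrightarrow> a \<in> Mp 0"
  using E_even by (auto simp: S.M_simps)

lemma Mp_E: "x \<in> Mp p \<Longrightarrow> a \<in> E \<Longrightarrow> x \<cdot> a \<in> Mp p"
  using Mp_mult[OF _ E_Mp, of x p a] by simp

lemma dyad_Mp: "a \<in> E \<Longrightarrow> b \<in> E \<Longrightarrow> x \<in> Mp p \<Longrightarrow> dyad a b x \<in> Mp p"
  unfolding dyad_def by (intro Mp_closed Mp_E E_mult)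

lemma phi_Mp: "u \<in> Mp p \<Longrightarrow> b \<in> E \<Longrightarrow> phi u b \<in> Mp p"
  unfolding phi_def using e_E by (intro Mp_closed dyad_Mp)

lemma Mp_cases: "Mp p = (if even p then M0 else M1)"
  unfolding parity_part_def by (simp add: S.M_simps)

lemma super_anti: assumes "m \<in> Mp p" "n \<in> Mp q" shows "m \<cdot> n = - ((- 1) ^ (p * q) *s (n \<cdot> m))"
proof (cases "even p \<or> even q")
  case True
  then have "m \<cdot> n = - (n \<cdot> m)"
    using assms S.even_anti[of m n] S.even_anti[of n m] by (auto simp: Mp_cases split: if_splits)
  then show ?thesis using True by auto
next
  case False
  then show ?thesis using assms S.odd_comm[of m n] by (simp add: Mp_cases)
qed

lemma phi_diff: "phi (u - u') b = phi u b - phi u' b"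
  using phi_lin1(1)[of u "- u'" b] phi_lin1(2)[of "-1" u' b] by simp

lemma e12: "g (e1 \<cdot> e2) (e1 \<cdot> e2) \<noteq> 0" "g e1 e2 = 0" "g e2 e2 \<noteq> 0" "e1 \<cdot> e2 \<in> E"
proof -
  show o: "g e1 e2 = 0" "g e2 e2 \<noteq> 0" "e1 \<cdot> e2 \<in> E"
    using triple E_mult unfolding triple_def by auto
  show "g (e1 \<cdot> e2) (e1 \<cdot> e2) \<noteq> 0" using g_mult_mult[OF e_E(1,2,2)] o n1 by simp
qed

lemma umul_Mp: "w \<in> Mp p \<Longrightarrow> u \<in> Mp q \<Longrightarrow> umul w u \<in> Mp (p + q)"
  unfolding umul_def using e_E e12 by (intro Mp_closed dyad_Mp Mp_mult phi_Mp)

lemma umul_comm: assumes "u \<in> U" "w \<in> U" "u \<in> Mp p" "w \<in> Mp q"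
  shows "umul u w = (- 1) ^ (p * q) *s umul w u"
proof (rule umul_unique)
  show "(- 1) ^ (p * q) *s umul w u \<in> U" using subspace_scale[OF subspace_U umul_U] .
  have "phi u e1 \<cdot> phi w e2 = - ((- 1) ^ (p * q) *s (phi w e2 \<cdot> phi u e1))"
    using super_anti phi_Mp assms e_E by blast
  also have "phi w e2 \<cdot> phi u e1 = - phi (umul w u) (e1 \<cdot> e2)"
    using phi_phi[OF e_E(2,1)] anti_E[OF e_E(1,2)] e12 by (simp add: phi_lin2)
  finally show "phi u e1 \<cdot> phi w e2 = phi ((- 1) ^ (p * q) *s umul w u) (e1 \<cdot> e2)"
    by (simp add: phi_lin1)
qed

text \<open>
  Take \<open>y = t = e1\<close>, \<open>z = a\<close>, \<open>x = b\<close> and \<open>u = phi c e2\<close> in \<open>h\<close>. As \<open>a\<close> and \<open>b\<close> are values of homomorphisms at \<open>e1\<close>,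
  the products \<open>e1 a\<close>, \<open>e1 b\<close> and \<open>a b\<close> vanish, and only the two terms of the claim remain, up to a common
  factor.
\<close>

lemma umul_right_comm:
  assumes "a \<in> U" "b \<in> U" and p: "a \<in> Mp p" "b \<in> Mp q" "c \<in> Mp r"
  shows "umul (umul c a) b = (- 1) ^ (p * q) *s umul (umul c b) a"
proof -
  let ?s = "(- 1) ^ (p * q) :: 'f" and ?f = "e1 \<cdot> e2"
  have ab: "a \<cdot> e1 = 0" "b \<cdot> e1 = 0" "a = phi a e1" "b = phi b e1"
    using assms phi_e1 unfolding U_def by auto
  have e: "e1 \<cdot> a = 0" "e1 \<cdot> b = 0" using anticomm[OF e_E(1), of a] anticomm[OF e_E(1), of b] ab by auto
  have w: "e1 \<cdot> phi c e2 = phi c ?f"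
    using anticomm[OF e_E(1), of "phi c e2"] anti_E[OF e_E(1,2)] e_E e12 by (simp add: phi_mult phi_lin2)
  have f: "?f \<cdot> e1 \<in> E" "?f \<cdot> e1 \<cdot> e1 = g e1 e1 *s ?f" "?f \<cdot> e1 = - (g e1 e1 *s e2)"
    using e_E e12 cross[OF e12(4) e_E(1)] g_mult_self'[OF e_E(1,2)] cross'(3)[OF e_E(2,1)] g_sym[OF e_E(1,2)]
    by (simp_all add: E_cl)
  \<comment> \<open>the two surviving terms, computed in \<open>E\<close> with coefficients in \<open>U\<close>\<close>
  have pp: "phi c ?f \<cdot> x \<cdot> y = g e1 e1 *s phi (umul (umul c x) y) ?f" if "x = phi x e1" "y = phi y e1" for x y
  proof -
    have "phi c ?f \<cdot> phi x e1 \<cdot> phi y e1 = phi (umul (umul c x) y) (?f \<cdot> e1 \<cdot> e1)"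
      using e_E e12 f by (simp add: phi_phi)
    then show ?thesis using that f e12 by (simp add: phi_lin2)
  qed
  have "a \<cdot> b = 0" using phi_phi[OF e_E(1,1), of a b] ab(3,4) e_E by (simp add: square_0 phi_lin2)
  have "super_h M p 0 q r e1 a e1 b (phi c e2) = 0"
    using class_H p E_Mp[OF e_E(1)] phi_Mp[OF p(3) e_E(2)] unfolding in_class_H_def by (metis S.M_simps(2))
  then have "(- 1) ^ (r * (p + 0) + q * 0) *s ((phi c ?f \<cdot> a \<cdot> b + (- ?s) *s (phi c ?f \<cdot> b \<cdot> a) + 2 *s (phi c ?f \<cdot> (a \<cdot> b))) \<cdot> e1) = 0"
    unfolding super_h_def supertriple_def by (simp add: S.M_simps e w mult_lin)
  then have "(phi c ?f \<cdot> a \<cdot> b - ?s *s (phi c ?f \<cdot> b \<cdot> a)) \<cdot> e1 = 0"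
    using \<open>a \<cdot> b = 0\<close> by (simp add: mult_lin)
  then have "g e1 e1 *s (phi (umul (umul c a) b - ?s *s umul (umul c b) a) (?f \<cdot> e1)) = 0"
    unfolding pp[OF ab(3,4)] pp[OF ab(4,3)] using e_E e12
    by (simp add: mult_lin phi_mult phi_diff phi_lin1 scale_right_diff_distrib mult.commute
        del: scale_eq_0_iff)
  then have "phi (umul (umul c a) b - ?s *s umul (umul c b) a) e2 = 0"
    unfolding f(3) using n1 e_E by (simp add: phi_lin2 E_sc)
  moreover have "umul (umul c a) b - ?s *s umul (umul c b) a \<in> U"
    using subspace_U umul_U by (intro subspace_diff subspace_scale)
  ultimately have "umul (umul c a) b - ?s *s umul (umul c b) a = 0" using phi_inj e_E e12 by blast
  then show ?thesis by simp
qed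

text \<open>
  Write \<open>x a\<close> as \<open>\<plusminus> a x\<close>, exchange \<open>x\<close> and \<open>b\<close> by \<open>umul_right_comm\<close>, and move \<open>x\<close> back to the front; the signs cancel.
\<close>

lemma umul_assoc_hom:
  assumes U: "x \<in> U" "a \<in> U" "b \<in> U" and p: "x \<in> Mp r" "a \<in> Mp p" "b \<in> Mp q"
  shows "umul (umul x a) b = umul x (umul a b)"
proof -
  have s: "(- 1) ^ i *s (- 1) ^ j *s v = (- 1) ^ (i + j) *s v" for i j v by (simp add: power_add)
  have "umul (umul x a) b = (- 1) ^ (r * p) *s umul (umul a x) b"
    unfolding umul_comm[OF U(1,2) p(1,2)] by (simp add: umul_lin)
  also have "umul (umul a x) b = (- 1) ^ (r * q) *s umul (umul a b) x"
    using umul_right_comm U p by blast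
  also have "umul (umul a b) x = (- 1) ^ ((p + q) * r) *s umul x (umul a b)"
    using umul_comm[OF umul_U U(1) umul_Mp p(1)] p by blast
  finally have "umul (umul x a) b = (- 1) ^ (r * p + (r * q + (p + q) * r)) *s umul x (umul a b)"
    unfolding s .
  moreover have "even (r * p + (r * q + (p + q) * r))" by (simp add: algebra_simps)
  ultimately show ?thesis by simp
qed

lemma U_split: assumes "u \<in> U" shows "\<exists>v\<in>U \<inter> M0. \<exists>w\<in>U \<inter> M1. u = v + w"
proof -
  obtain v w where vw: "v \<in> M0" "w \<in> M1" "u = v + w" using S.part_split by blast
  have "v \<cdot> e1 + w \<cdot> e1 = 0" using assms vw unfolding U_def by (simp add: mult_lin)
  moreover have "v \<cdot> e1 \<in> Mp 0" "w \<cdot> e1 \<in> Mp 1" using Mp_E[of v 0] Mp_E[of w 1] e_E vw by (simp_all add: S.M_simps)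
  moreover from calculation have "v \<cdot> e1 \<in> Mp 1"
    using Mp_closed(4)[of "w \<cdot> e1" 1] by (simp add: eq_neg_iff_add_eq_0[symmetric])
  ultimately have "v \<cdot> e1 = 0" using S.part_inter by (simp add: S.M_simps)
  then have "v \<in> U" "w \<in> U" using \<open>v \<cdot> e1 + w \<cdot> e1 = 0\<close> unfolding U_def by auto
  then show ?thesis using vw by blast
qed

lemma umul_assoc: assumes U: "x \<in> U" "a \<in> U" "b \<in> U" shows "umul (umul x a) b = umul x (umul a b)"
proof -
  have M: "v \<in> M0 \<Longrightarrow> v \<in> Mp 0" "v \<in> M1 \<Longrightarrow> v \<in> Mp 1" for v by (simp_all add: S.M_simps)
  obtain x0 x1 where x: "x0 \<in> U \<inter> M0" "x1 \<in> U \<inter> M1" "x = x0 + x1" using U_split U by blast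
  obtain a0 a1 where a: "a0 \<in> U \<inter> M0" "a1 \<in> U \<inter> M1" "a = a0 + a1" using U_split U by blast
  obtain b0 b1 where b: "b0 \<in> U \<inter> M0" "b1 \<in> U \<inter> M1" "b = b0 + b1" using U_split U by blast
  have "umul (umul x' a') b' = umul x' (umul a' b')" if "x' \<in> {x0, x1}" "a' \<in> {a0, a1}" "b' \<in> {b0, b1}" for x' a' b'
  proof -
    have h: "z \<in> U \<and> (\<exists>r. z \<in> Mp r)" if "z \<in> U \<inter> M0 \<or> z \<in> U \<inter> M1" for z using that M by blast
    have "x' \<in> U \<inter> M0 \<or> x' \<in> U \<inter> M1" "a' \<in> U \<inter> M0 \<or> a' \<in> U \<inter> M1" "b' \<in> U \<inter> M0 \<or> b' \<in> U \<inter> M1"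
      using that x a b by auto
    from this[THEN h] show ?thesis using umul_assoc_hom[of x' a' b'] by blast
  qed
  then show ?thesis unfolding x(3) a(3) b(3) by (simp add: umul_lin)
qed

definition Ualg :: "('f, 'm) superalg" where
  "Ualg = \<lparr>carr = U, zer = 0, add = (+), smul = scale, mul = umul, even_part = U \<inter> M0, odd_part = U \<inter> M1\<rparr>"

lemma Ualg_simps: "carr Ualg = U" "zer Ualg = 0" "add Ualg = (+)" "smul Ualg = scale" "mul Ualg = umul"
  "even_part Ualg = U \<inter> M0" "odd_part Ualg = U \<inter> M1" "parity_part Ualg p = U \<inter> Mp p"
  unfolding Ualg_def parity_part_def by (simp_all add: S.M_simps)

lemma U_closed: "0 \<in> U" "u \<in> U \<Longrightarrow> v \<in> U \<Longrightarrow> u + v \<in> U" "u \<in> U \<Longrightarrow> c *s u \<in> U" "u \<in> U \<Longrightarrow> - u \<in> U"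
  using subspace_U subspace_0 subspace_add subspace_scale subspace_neg by blast+

lemma superalgebra_Ualg: "superalgebra Ualg"
proof
  fix x y :: 'm and p q
  show "x \<in> parity_part Ualg p \<Longrightarrow> y \<in> parity_part Ualg q \<Longrightarrow> mul Ualg x y \<in> parity_part Ualg (p + q)"
    using umul_U umul_Mp by (simp add: Ualg_simps)
  show "lin_subspace Ualg (parity_part Ualg p)"
    unfolding lin_subspace_def using U_closed Mp_closed by (auto simp: Ualg_simps)
  show "x \<in> carr Ualg \<Longrightarrow> \<exists>a\<in>parity_part Ualg 0. \<exists>b\<in>parity_part Ualg 1. x = add Ualg a b"
    using U_split by (simp add: Ualg_simps S.M_simps)
  show "parity_part Ualg 0 \<inter> parity_part Ualg 1 = {zer Ualg}"
    using S.M.part_disjoint U_closed by (auto simp: Ualg_simps S.M_simps)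
  show "x \<in> carr Ualg \<Longrightarrow> \<exists>y\<in>carr Ualg. add Ualg x y = zer Ualg"
    using U_closed(4) by (intro bexI[of _ "- x"]) (simp_all add: Ualg_simps)
qed (use U_closed umul_U in \<open>simp_all add: Ualg_simps umul_lin scale_left_distrib scale_right_distrib algebra_simps\<close>)

lemma associative_Ualg: "associative_alg Ualg"
  unfolding associative_alg_def using umul_assoc by (simp add: Ualg_simps)

lemma supercommutative_Ualg: "supercommutative Ualg"
  unfolding supercommutative_def using umul_comm by (auto simp: Ualg_simps)

section \<open>The isomorphism with the tensor product\<close>

lemma restr_simps: "carr (restr M E) = E" "zer (restr M E) = 0" "add (restr M E) = (+)"
  "smul (restr M E) = scale" "mul (restr M E) = mult"
  unfolding restr_def by (simp_all add: S.M_simps)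

lemma nonassoc_restr: "nonassoc_algebra (restr M E)"
proof
  fix x :: 'm
  show "x \<in> carr (restr M E) \<Longrightarrow> \<exists>y\<in>carr (restr M E). add (restr M E) x y = zer (restr M E)"
    using E_neg by (intro bexI[of _ "- x"]) (simp_all add: restr_simps)
qed (simp_all add: restr_simps E_cl mult_lin scale_left_distrib scale_right_distrib algebra_simps)

sublocale TP: tensor_pair "restr M E" Ualg
  unfolding tensor_pair_def using nonassoc_restr superalgebra_Ualg superalgebra.axioms(1) by blast

notation TP.tmul (infixl "**" 70)

text \<open>
  The map \<open>E \<otimes> U \<rightarrow> M\<close>, \<open>a \<otimes> u \<mapsto> phi u a\<close>, on the level of representatives.
\<close>

definition Psi where "Psi = lext scale (\<lambda>(a, u). phi u a)"

lemma Psi_lin: "Psi (f + h) = Psi f + Psi h" "Psi (f - h) = Psi f - Psi h" "Psi (pm_scale c f) = c *s Psi f"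
  "Psi (single (a, u) c) = c *s phi u a" "Psi 0 = 0"
  unfolding Psi_def by (simp_all add: S.lext_add S.lext_diff S.lext_scale)

lemma Psi_N: "n \<in> TP.N \<Longrightarrow> Psi n = 0"
  unfolding Psi_def
  by (rule TP.N_kernel[OF S.lin_space_axioms])
    (simp_all add: restr_simps Ualg_simps phi_lin1 phi_lin2)

lemma Psi_mult:
  assumes f: "f \<in> carr TP.W" and h: "h \<in> carr TP.W"
  shows "Psi (f ** h) = Psi f \<cdot> Psi h"
proof -
  have 1: "Psi (single (a, u) 1 ** h) = phi u a \<cdot> Psi h" if "a \<in> E" "u \<in> U" for a u
  proof -
    have "h \<in> {h. Psi (single (a, u) 1 ** h) = phi u a \<cdot> Psi h}"
      by (rule TP.W_induct[OF h])
        (use that in \<open>auto simp: pm.subspace_def TP.tmul_lin Psi_lin mult_lin restr_simps Ualg_simps phi_phi\<close>)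
    then show ?thesis by simp
  qed
  have "f \<in> {f. Psi (f ** h) = Psi f \<cdot> Psi h}"
    by (rule TP.W_induct[OF f])
      (use 1 in \<open>auto simp: pm.subspace_def TP.tmul_lin Psi_lin mult_lin restr_simps Ualg_simps\<close>)
  then show ?thesis by simp
qed

abbreviation basis where "basis \<equiv> frame e1 e2 e3"

lemmas basis_frame = triple_frame[OF triple]

text \<open>
  The coefficient \<open>u\<close> of the basis vector \<open>s\<close> in \<open>m = \<Sum>\<^sub>s phi u s\<close>.
\<close>

definition component where "component s m = (1 / (3 * g s s)) *s dyad s e1 m"

lemma component_U: "s \<in> basis \<Longrightarrow> component s m \<in> U"
  unfolding component_def using basis_frame by (intro dyad_in_U) blast

lemma component_lin: "component s (m + m') = component s m + component s m'" "component s (c *s m) = c *s component s m" "component s 0 = 0"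
  unfolding component_def by (simp_all add: dyad_lin scale_right_distrib mult.commute)

lemma component_phi: "s \<in> basis \<Longrightarrow> a \<in> E \<Longrightarrow> u \<in> U \<Longrightarrow> component s (phi u a) = (g a s / g s s) *s u"
  unfolding component_def using basis_frame e_E three by (simp add: dyad_phi phi_e1 subset_iff)

definition normal_form :: "'m \<Rightarrow> 'm \<times> 'm \<Rightarrow>\<^sub>0 'f" where "normal_form m = (\<Sum>s\<in>basis. single (s, component s m) 1)"

lemma Psi_normal_form: "Psi (normal_form m) = m"
proof -
  have "Psi (sum f A) = (\<Sum>s\<in>A. Psi (f s))" for f and A :: "'m set"
    by (induction A rule: infinite_finite_induct) (auto simp: Psi_lin)
  then show ?thesis unfolding normal_form_def using phi_expand[of m] by (simp add: Psi_lin component_def)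
qed

lemma normal_form_keys: assumes "\<And>s. s \<in> basis \<Longrightarrow> component s m \<in> V" shows "keys (normal_form m) \<subseteq> E \<times> V"
proof -
  have "normal_form m \<in> {f. keys f \<subseteq> E \<times> V}"
    unfolding normal_form_def by (rule pm.subspace_sum[OF pm_keys_subspace]) (use assms basis_frame in auto)
  then show ?thesis by simp
qed

lemma normal_form_W: "normal_form m \<in> carr TP.W"
  using normal_form_keys[of m U] component_U by (simp add: TP.W_simps restr_simps Ualg_simps)

lemma sum_left_N:
  assumes "finite A" "A \<subseteq> E" "u \<in> U"
  shows "(\<Sum>s\<in>A. r s *s s) \<in> E \<and> single (\<Sum>s\<in>A. r s *s s, u) 1 - (\<Sum>s\<in>A. single (s, u) (r s)) \<in> TP.N"
  using assms
proof (induction A rule: finite_induct)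
  case empty
  have "single (0 *s 0, u) 1 - single (0, u) 0 \<in> TP.N"
    using TP.N_rel(3)[of 0 u 0] empty E_0 by (simp add: restr_simps Ualg_simps)
  then show ?case using E_0 by simp
next
  case (insert s A)
  let ?t = "\<Sum>s\<in>A. r s *s s"
  have E: "s \<in> E" "?t \<in> E" "r s *s s \<in> E" using insert E_sc by auto
  have 1: "single (r s *s s + ?t, u) 1 - single (r s *s s, u) 1 - single (?t, u) 1 \<in> TP.N"
    using TP.N_rel(1)[of "r s *s s" ?t u] E insert.prems by (simp add: restr_simps Ualg_simps)
  have 2: "single (r s *s s, u) 1 - single (s, u) (r s) \<in> TP.N"
    using TP.N_rel(3)[of s u "r s"] E insert.prems by (simp add: restr_simps Ualg_simps)
  have 3: "single (?t, u) 1 - (\<Sum>s\<in>A. single (s, u) (r s)) \<in> TP.N" using insert by blast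
  have "single (r s *s s + ?t, u) 1 - (single (s, u) (r s) + (\<Sum>s\<in>A. single (s, u) (r s)))
      = (single (r s *s s + ?t, u) 1 - single (r s *s s, u) 1 - single (?t, u) 1)
        + (single (r s *s s, u) 1 - single (s, u) (r s))
        + (single (?t, u) 1 - (\<Sum>s\<in>A. single (s, u) (r s)))" by simp
  also have "\<dots> \<in> TP.N" by (intro TP.N_closed(1) 1 2 3)
  finally show ?case using insert.hyps E E_add by simp
qed

text \<open>
  Every tensor is equivalent to one supported on the frame, with the components as second factors. So an
  element of the kernel of \<open>Psi\<close>, having zero components, is null.
\<close>

lemma normal_form_Psi_N: assumes f: "f \<in> carr TP.W" shows "f - normal_form (Psi f) \<in> TP.N"
proof -
  have N_sum: "(\<And>s. s \<in> A \<Longrightarrow> h s \<in> TP.N) \<Longrightarrow> (\<Sum>s\<in>A. h s) \<in> TP.N" for h and A :: "'m set"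
    using pm.subspace_sum[OF TP.N_subspace] by blast
  have add: "normal_form (m + m') - normal_form m - normal_form m' \<in> TP.N" for m m'
  proof -
    have "normal_form (m + m') - normal_form m - normal_form m' = (\<Sum>s\<in>basis. single (s, component s m + component s m') 1 
      - single (s, component s m) 1 - single (s, component s m') 1)"
      unfolding normal_form_def component_lin by (simp add: sum_subtractf)
    also have "\<dots> \<in> TP.N"
    proof (rule N_sum)
      fix s assume "s \<in> basis"
      then show "single (s, component s m + component s m') 1 - single (s, component s m) 1 - single (s, component s m') 1 \<in> TP.N"
        using TP.N_rel(2)[of s "component s m" "component s m'"] component_U basis_frame(1)
        by (auto simp: restr_simps Ualg_simps)
    qed
    finally show ?thesis .
  qed
  have sc: "normal_form (c *s m) - pm_scale c (normal_form m) \<in> TP.N" for c m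
  proof -
    have "normal_form (c *s m) - pm_scale c (normal_form m) = (\<Sum>s\<in>basis. single (s, c *s component s m) 1 - single (s, component s m) c)"
      unfolding normal_form_def component_lin pm.scale_sum_right by (simp add: sum_subtractf)
    also have "\<dots> \<in> TP.N"
    proof (rule N_sum)
      fix s assume "s \<in> basis"
      then show "single (s, c *s component s m) 1 - single (s, component s m) c \<in> TP.N"
        using TP.N_rel(4)[of s "component s m" c] component_U basis_frame(1)
        by (auto simp: restr_simps Ualg_simps)
    qed
    finally show ?thesis .
  qed
  \<comment> \<open>expand \<open>a\<close> in the frame and move the scalars to the second factor\<close>
  have pure: "single (a, u) 1 - normal_form (phi u a) \<in> TP.N" if au: "a \<in> E" "u \<in> U" for a u
  proof -
    have 1: "single (a, u) 1 - (\<Sum>s\<in>basis. single (s, u) (g a s / g s s)) \<in> TP.N"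
      using sum_left_N[OF finite_frame basis_frame(1) au(2), of "\<lambda>s. g a s / g s s"]
        frame_expand[OF triple au(1)] by simp
    have "(\<Sum>s\<in>basis. single (s, u) (g a s / g s s)) - normal_form (phi u a)
       = (\<Sum>s\<in>basis. - (single (s, (g a s / g s s) *s u) 1 - single (s, u) (g a s / g s s)))"
      unfolding normal_form_def sum_subtractf[symmetric] using au by (intro sum.cong refl) (simp add: component_phi)
    also have "\<dots> \<in> TP.N"
    proof (rule N_sum)
      fix s assume "s \<in> basis"
      then have "single (s, (g a s / g s s) *s u) 1 - single (s, u) (g a s / g s s) \<in> TP.N"
        using TP.N_rel(4)[of s u "g a s / g s s"] au basis_frame(1) by (auto simp: restr_simps Ualg_simps)
      then show "- (single (s, (g a s / g s s) *s u) 1 - single (s, u) (g a s / g s s)) \<in> TP.N"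
        by (rule TP.N_closed(5))
    qed
    finally have 2: "(\<Sum>s\<in>basis. single (s, u) (g a s / g s s)) - normal_form (phi u a) \<in> TP.N" .
    show ?thesis using TP.N_closed(1)[OF 1 2] by simp
  qed
  let ?S = "{f. f - normal_form (Psi f) \<in> TP.N}"
  have "pm.subspace ?S"
    unfolding pm.subspace_def
  proof (intro conjI allI ballI impI)
    show "0 \<in> ?S" using sc[of 0 0] TP.N_closed(5) by (auto simp: Psi_lin)
    fix x y assume x: "x \<in> ?S" and y: "y \<in> ?S"
    have "x + y - normal_form (Psi (x + y)) = (x - normal_form (Psi x)) + (y - normal_form (Psi y))
        - (normal_form (Psi x + Psi y) - normal_form (Psi x) - normal_form (Psi y))" by (simp add: Psi_lin)
    also have "\<dots> \<in> TP.N" using x y by (intro TP.N_closed(2)[OF TP.N_closed(1) add]) auto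
    finally show "x + y \<in> ?S" by simp
  next
    fix c x assume x: "x \<in> ?S"
    have "pm_scale c x - normal_form (Psi (pm_scale c x)) = pm_scale c (x - normal_form (Psi x))
        - (normal_form (c *s Psi x) - pm_scale c (normal_form (Psi x)))" by (simp add: Psi_lin pm.scale_right_diff_distrib)
    also have "\<dots> \<in> TP.N" using x by (intro TP.N_closed(2)[OF TP.N_closed(3) sc]) auto
    finally show "pm_scale c x \<in> ?S" by simp
  qed
  then have "f \<in> ?S"
    by (rule TP.W_induct[OF f]) (use pure in \<open>auto simp: restr_simps Ualg_simps Psi_lin\<close>)
  then show ?thesis by simp
qed

definition Phi where "Phi m = TP.T.cs (normal_form m)"

lemma Phi_Psi: "f \<in> carr TP.W \<Longrightarrow> Phi (Psi f) = TP.T.cs f"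
  unfolding Phi_def TP.T.cs_eq using normal_form_Psi_N[of f] TP.N_closed(5)[of "f - normal_form (Psi f)"] by simp

lemma Phi_hom: "alg_hom_bij Phi M (tensor_super (restr M E) Ualg)"
proof -
  have T: "carr (tensor_super (restr M E) Ualg) = TP.T.cs ` carr TP.W"
    "add (tensor_super (restr M E) Ualg) = add (alg_quot TP.W TP.N)"
    "smul (tensor_super (restr M E) Ualg) = smul (alg_quot TP.W TP.N)"
    "mul (tensor_super (restr M E) Ualg) = mul (alg_quot TP.W TP.N)"
    unfolding tensor_super_def graded_def TP.tensor_quot by (simp_all add: TP.T.cs_carr)
  have "inj Phi"
  proof (rule injI)
    fix m m' assume "Phi m = Phi m'"
    then have "normal_form m - normal_form m' \<in> TP.N" unfolding Phi_def TP.T.cs_eq .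
    then show "m = m'" using Psi_N[of "normal_form m - normal_form m'"] by (simp add: Psi_lin Psi_normal_form)
  qed
  moreover have "range Phi = TP.T.cs ` carr TP.W"
    using Phi_Psi normal_form_W unfolding Phi_def by (auto simp: image_iff)
  moreover have "Phi (m + m') = add (alg_quot TP.W TP.N) (Phi m) (Phi m')" for m m'
    using Phi_Psi[OF pm.subspace_add[OF TP.W_subspace normal_form_W normal_form_W], of m m']
    unfolding Phi_def[of m] Phi_def[of m'] by (simp add: TP.T.cs_add Psi_lin Psi_normal_form)
  moreover have "Phi (c *s m) = smul (alg_quot TP.W TP.N) c (Phi m)" for c m
    using Phi_Psi[OF pm.subspace_scale[OF TP.W_subspace normal_form_W], of c m]
    TP.T.cs_smul[OF normal_form_W, of c m]
    unfolding Phi_def[of m] by (simp add: TP.W_simps(4) Psi_lin Psi_normal_form)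
  moreover have "Phi (m \<cdot> m') = mul (alg_quot TP.W TP.N) (Phi m) (Phi m')" for m m'
    using Phi_Psi[OF TP.mul_W[OF normal_form_W normal_form_W], of m m']
    unfolding Phi_def[of m] Phi_def[of m'] by (simp add: TP.T.cs_mul normal_form_W Psi_mult Psi_normal_form)
  ultimately show ?thesis
    unfolding alg_hom_bij_def T bij_betw_def by (simp add: S.M_simps)
qed

lemma Phi_part: "Phi ` Mp p = parity_part (tensor_super (restr M E) Ualg) p"
proof -
  have p: "parity_part (tensor_super (restr M E) Ualg) p = TP.T.cs ` {f. keys f \<subseteq> E \<times> (U \<inter> Mp p)}"
    unfolding tensor_super_def graded_def parity_part_def tensor_sub_def
    by (simp add: restr_simps Ualg_simps S.M_simps)
  show ?thesis unfolding p
  proof (intro equalityI subsetI)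
    fix X assume "X \<in> Phi ` Mp p"
    then obtain m where m: "m \<in> Mp p" "X = Phi m" by blast
    have "component s m \<in> U \<inter> Mp p" if "s \<in> basis" for s
      using that component_U m(1) basis_frame(1) e_E unfolding component_def by (auto intro!: Mp_closed(3) dyad_Mp)
    then have "keys (normal_form m) \<subseteq> E \<times> (U \<inter> Mp p)" by (rule normal_form_keys)
    then show "X \<in> TP.T.cs ` {f. keys f \<subseteq> E \<times> (U \<inter> Mp p)}" unfolding m(2) Phi_def by blast
  next
    fix X assume "X \<in> TP.T.cs ` {f. keys f \<subseteq> E \<times> (U \<inter> Mp p)}"
    then obtain f where f: "keys f \<subseteq> E \<times> (U \<inter> Mp p)" "X = TP.T.cs f" by blast
    have "f \<in> carr TP.W" using f(1) by (auto simp: TP.W_simps restr_simps Ualg_simps)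
    then have "X = Phi (Psi f)" using Phi_Psi f(2) by simp
    moreover have "Psi f \<in> Mp p"
      unfolding Psi_def by (rule S.lext_in_subspace[OF S.part_sub]) (use f(1) phi_Mp in auto)
    ultimately show "X \<in> Phi ` Mp p" by blast
  qed
qed

lemma coordinatization:
  "superalgebra Ualg \<and> associative_alg Ualg \<and> supercommutative Ualg \<and>
     superalg_isomorphic M (tensor_super (restr M E) Ualg)"
  unfolding superalg_isomorphic_def
  using superalgebra_Ualg associative_Ualg supercommutative_Ualg Phi_hom Phi_part by blast

end

theorem theorem3p3:
  fixes scale :: "'f::field \<Rightarrow> 'm::ab_group_add \<Rightarrow> 'm"
    and mult :: "'m \<Rightarrow> 'm \<Rightarrow> 'm"
    and M0 M1 E :: "'m set"
    and M :: "('f, 'm) superalg"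
  assumes "CHAR('f) \<noteq> 2" and "CHAR('f) \<noteq> 3"
    and "M = graded (type_alg scale mult) M0 M1"
    and "malcev_superalgebra M"
    and "in_class_H M"
    and "E \<subseteq> M0" and "subalgebra M E" and "exceptional_malcev (restr M E)"
    and "\<forall>m \<in> M0 \<union> M1. m \<noteq> 0 \<longrightarrow> (\<exists>a\<in>E. mult m a \<noteq> 0)"
  shows "\<exists>U :: ('f, 'm) superalg.
    superalgebra U \<and> associative_alg U \<and> supercommutative U \<and>
    superalg_isomorphic M (tensor_super (restr M E) U)"
proof -
  note two_three = char_nz[OF assms(1,2)]
  interpret S: malcev_super scale mult M0 M1 M by unfold_locales (fact assms)+
  obtain g where g: "cross_form scale mult E g"
    using exceptional_cross_form[OF two_three(1) assms(3,7) S.vector_space_axioms assms(8)] by blast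
  have sub: "S.subspace E" "\<And>a b. a \<in> E \<Longrightarrow> b \<in> E \<Longrightarrow> mult a b \<in> E"
    using assms(7) unfolding subalgebra_def lin_subspace_def S.subspace_def S.M_simps by blast+
  \<comment> \<open>the hypothesis concerns homogeneous elements, but products with \<open>E\<close> preserve the parity\<close>
  have faithful: "m = 0" if m: "\<And>a. a \<in> E \<Longrightarrow> mult m a = 0" for m
  proof -
    obtain m0 m1 where s: "m0 \<in> M0" "m1 \<in> M1" "m = m0 + m1" using S.part_split by blast
    have "mult m0 a = 0 \<and> mult m1 a = 0" if a: "a \<in> E" for a
    proof -
      have "mult m0 a \<in> M0" "mult m1 a \<in> M1"
        using S.M.part_mul[of m0 0 a 0] S.M.part_mul[of m1 1 a 0] s a assms(6) by (auto simp: S.M_simps)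
      moreover have "mult m0 a + mult m1 a = 0" using m[OF a] unfolding s(3) S.mult_lins .
      moreover from calculation have "mult m0 a = - mult m1 a" by (simp only: eq_neg_iff_add_eq_0)
      moreover have "- mult m1 a \<in> M1"
        using S.subspace_neg[OF S.part_sub[of 1]] calculation by (simp add: S.M_simps)
      ultimately show ?thesis using S.part_inter by fastforce
    qed
    then have "m0 = 0" "m1 = 0" using assms(9) s by blast+
    then show ?thesis using s by simp
  qed
  have E: "a \<in> M0" if "a \<in> E" for a using that assms(6) by blast
  interpret C: cross_action scale mult E g
  proof (intro cross_action.intro cross_action_axioms.intro S.vector_space_axioms)
    show "(2::'f) \<noteq> 0" "(3::'f) \<noteq> 0" by (fact two_three)+
    show "S.subspace E" by (fact sub)
    fix x y z r a b c m v t
    show "mult (x + y) z = mult x z + mult y z" "mult x (y + z) = mult x y + mult x z"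
      "mult (scale r x) y = scale r (mult x y)" "mult x (scale r y) = scale r (mult x y)"
      by (fact S.mult_lins)+
    show "a \<in> E \<Longrightarrow> b \<in> E \<Longrightarrow> mult a b \<in> E" by (fact sub(2))
    show "a \<in> E \<Longrightarrow> b \<in> E \<Longrightarrow> g a b = g b a"
      "a \<in> E \<Longrightarrow> b \<in> E \<Longrightarrow> c \<in> E \<Longrightarrow> g (a + b) c = g a c + g b c"
      "a \<in> E \<Longrightarrow> b \<in> E \<Longrightarrow> g (scale r a) b = r * g a b"
      "x \<in> E \<Longrightarrow> y \<in> E \<Longrightarrow> mult (mult x y) y = scale (g y y) x - scale (g x y) y"
      using g unfolding cross_form_def by blast+
    show "a \<in> E \<Longrightarrow> mult a m = - mult m a" "a \<in> E \<Longrightarrow> mult a a = 0"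
      by (rule S.even_anti S.even_square, erule E)+
    show "y \<in> E \<Longrightarrow> z \<in> E \<Longrightarrow> t \<in> E \<Longrightarrow> mult (mult v z) (mult y t) = mult (mult (mult v y) z) t
        - mult (mult (mult v t) y) z - mult v (mult (mult y z) t) - mult (mult v (mult z t)) y"
      by (rule S.sagle_one[OF two_three(1)]; erule E)
    show "(\<And>a. a \<in> E \<Longrightarrow> mult m a = 0) \<Longrightarrow> m = 0" by (rule faithful)
  qed
  obtain e1 e2 e3 where t: "C.triple e1 e2 e3"
    using g unfolding cross_form_def C.triple_def by blast
  note H = S.class_H_two[OF assms(5)]
  interpret coordinatization scale mult E g e1 e2 e3 M0 M1 M
  proof
    fix z x u n m
    show "z \<in> E \<Longrightarrow> x \<in> E \<Longrightarrow> u \<in> E \<Longrightarrow>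
      mult (C.tri (mult n z) m u) x + mult (C.tri (mult n z) m x) u
        + mult (C.tri (mult n x) z u) m + mult (C.tri (mult n u) z x) m = 0"
      using H E by blast
  qed (use t assms in auto)
  show ?thesis using coordinatization by blast
qed

end
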